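(* Let $q$ be a prime power and consider the $GK$ function field over the algebraic closure $K$ of $\mathbb{F}_{q^6}$, with its places $P_0$ and $P_\infty$. For $0\leq k\leq q^2-3$ set $$G_{k,0}^1=\left\{\gamma_{i_1,\,k_1-i_1+2,\,1}^{i_2,\,k_2-i_2+2,\,k+1}:\ \max\{0,k_s-q^2+q+2\}\leq i_s\leq\min\{q,k_s+2\}\text{ and }k<k_s\leq q^2-2\text{ for }s=1,2\right\},$$ $$G_{k,0}^3=\left\{\gamma_{i_1,\,k_1-i_1+2,\,1}^{i_2,\,k-i_2+2,\,k+1}:\ \begin{array}{l}\max\{0,k_1-q^2+q+2\}\leq i_1\leq\min\{q,k_1+2\},\\ \max\{0,k-q^2+q+2\}\leq i_2\leq\min\{q,k+2\},\\ i_2\leq i_1\text{ and }k<k_1\leq q^2-2\end{array}\right\},$$ $$G_{k,0}^4=\{(b,a)\in\mathbb{N}^2:(a,b)\in G_{k,0}^3\}-\mathbf{w}_k,$$ where all indices are integers. Then $$G_0(P_0,P_\infty)=\bigcup_{0\leq j\leq k\leq q^2-3}\left((G_{k,0}^1\cup G_{k,0}^3\cup G_{k,0}^4)+\mathbf{w}_j\right)$$ and $$|G_0(P_0,P_\infty)|=\frac{q(q-1)(10q^8+10q^7-25q^6-9q^5+71q^4-111q^3-86q^2+128q-12)}{120}.$$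
   Context: The $GK$ (Giulietti–Korchmáros) function field is $GK=K(x,y,z)$, where $K$ is the algebraic closure of $\mathbb{F}_{q^6}$, $z^{q^2-q+1}=y\sum_{i=0}^{q}(-1)^{i+1}x^{i(q-1)}$ and $y^{q+1}=x^q+x$. $P_\infty$ is its single place at infinity and $P_0$ is the place corresponding to the point $(0,0,0)$. $\mathbb{N}$ is the set of positive integers, $\mathbb{N}_0=\mathbb{N}\cup\{0\}$. $\ell(D)$ is the $K$-dimension of the Riemann-Roch space of a divisor $D$. A pair $(s_1,s_2)\in\mathbb{N}_0^2$ is a pure gap at $P_0,P_\infty$ if $\ell(s_1P_0+s_2P_\infty)=\ell(s_1P_0+s_2P_\infty-Q)$ for both $Q=P_0$ and $Q=P_\infty$; $G_0(P_0,P_\infty)$ is the set of pure gaps. The notation is $$\gamma_{a_1,b_1,c_1}^{a_2,b_2,c_2}=\big((c_2-1)(q^3+1)+(q+1-a_2)(q^2-q+1)-b_2,\ (c_1-1)(q^3+1)+(q+1-a_1)(q^2-q+1)-b_1\big),$$ and $\mathbf{w}_j=(-j(q^3+1),\,j(q^3+1))\in\mathbb{Z}^2$; $S\pm\mathbf{w}_j$ denotes the translate of a set $S$. *)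

theory Defs
  imports
    "HOL-Algebra.Algebraic_Closure_Type"
    "HOL-Library.Poly_Mapping"
    "HOL-Library.Product_Plus"
begin

text \<open>
  A field extension $F/K$ is given by a ring homomorphism \<open>emb\<close> from the constant field
  (the type \<open>'k\<close>) into the field $F$ (the whole type \<open>'f\<close>). Places, divisors and
  Riemann-Roch spaces follow Stichtenoth, Algebraic Function Fields and Codes, Chapter 1.
\<close>

locale field_ext =
  fixes emb :: "'k::field \<Rightarrow> 'f::field"
  assumes emb_1: "emb 1 = 1"
    and emb_add: "emb (a + b) = emb a + emb b"
    and emb_mult: "emb (a * b) = emb a * emb b"
begin

sublocale vec: vector_space "\<lambda>c f. emb c * f"
  by unfold_locales (simp_all add: emb_1 emb_add emb_mult algebra_simps)

definition transcendental :: "'f \<Rightarrow> bool" where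
  "transcendental t \<longleftrightarrow> (\<forall>p::'k poly. p \<noteq> 0 \<longrightarrow> poly (map_poly emb p) t \<noteq> 0)"

inductive_set adjoin :: "'f set \<Rightarrow> 'f set" for S where
  const: "emb c \<in> adjoin S"
| gen: "s \<in> S \<Longrightarrow> s \<in> adjoin S"
| add: "a \<in> adjoin S \<Longrightarrow> b \<in> adjoin S \<Longrightarrow> a + b \<in> adjoin S"
| uminus: "a \<in> adjoin S \<Longrightarrow> - a \<in> adjoin S"
| mult: "a \<in> adjoin S \<Longrightarrow> b \<in> adjoin S \<Longrightarrow> a * b \<in> adjoin S"
| inverse: "a \<in> adjoin S \<Longrightarrow> inverse a \<in> adjoin S"

definition valuation_ring :: "'f set \<Rightarrow> bool" where
  "valuation_ring R \<longleftrightarrow>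
     range emb \<subset> R \<and> R \<subset> UNIV \<and>
     (\<forall>a\<in>R. \<forall>b\<in>R. a - b \<in> R \<and> a * b \<in> R) \<and>
     (\<forall>f. f \<in> R \<or> inverse f \<in> R)"

text \<open>A place is the maximal ideal, i.e. the set of non-units, of a valuation ring.\<close>

definition max_ideal :: "'f set \<Rightarrow> 'f set" where
  "max_ideal R = {f \<in> R. \<not> (\<exists>g\<in>R. f * g = 1)}"

definition places :: "'f set set" where
  "places = {max_ideal R | R. valuation_ring R}"

text \<open>The valuation ring is recovered from its place $P$: a nonzero $f$ lies in it iff
  $1/f$ is not in $P$.\<close>

definition ring_at :: "'f set \<Rightarrow> 'f set" where
  "ring_at P = {f. f = 0 \<or> inverse f \<notin> P}"

definition uniformizer :: "'f set \<Rightarrow> 'f \<Rightarrow> bool" where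
  "uniformizer P t \<longleftrightarrow> P = {t * f | f. f \<in> ring_at P}"

text \<open>The discrete valuation $v_P$, meaningful for nonzero arguments only.\<close>

definition val :: "'f set \<Rightarrow> 'f \<Rightarrow> int" where
  "val P f = (THE n. \<exists>t u. uniformizer P t \<and> u \<in> ring_at P - P \<and> f = t powi n * u)"

text \<open>Divisors are finitely supported integer-valued functions on the places.\<close>

definition riemann_roch_space :: "('f set \<Rightarrow>\<^sub>0 int) \<Rightarrow> 'f set" where
  "riemann_roch_space D =
     {f. f = 0 \<or> (\<forall>P\<in>places. val P f \<ge> - Poly_Mapping.lookup D P)}"

definition ell :: "('f set \<Rightarrow>\<^sub>0 int) \<Rightarrow> nat" where
  "ell D = vec.dim (riemann_roch_space D)"

definition pure_gaps :: "'f set \<Rightarrow> 'f set \<Rightarrow> (int \<times> int) set" where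
  "pure_gaps P1 P2 =
     {(s1, s2). 0 \<le> s1 \<and> 0 \<le> s2 \<and>
        (let D = Poly_Mapping.single P1 s1 + Poly_Mapping.single P2 s2
         in \<forall>Q\<in>{P1, P2}. ell D = ell (D - Poly_Mapping.single Q 1))}"

end

text \<open>
  Transcendence of $x$ makes the conditions below determine $K(x,y,z)$ up to isomorphism: both
  equations are totally ramified over $x = 0$, so $y$ has degree $q+1$ over $K(x)$
  and $z$ has degree $q^2-q+1$ over $K(x,y)$.
\<close>

locale gk_function_field = field_ext emb
  for emb :: "'k::field \<Rightarrow> 'f::field" +
  fixes q :: nat and x y z :: 'f
  assumes x_transcendental: "transcendental x"
    and generated: "adjoin {x, y, z} = UNIV"
    and eq_z: "z ^ (q\<^sup>2 - q + 1) = y * (\<Sum>i=0..q. (-1) ^ (i + 1) * x ^ (i * (q - 1)))"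
    and eq_y: "y ^ (q + 1) = x ^ q + x"
begin

definition is_P0 :: "'f set \<Rightarrow> bool" where
  "is_P0 P \<longleftrightarrow> P \<in> places \<and> x \<in> P \<and> y \<in> P \<and> z \<in> P"

text \<open>A place is at infinity if one of the coordinate functions has a pole there.\<close>

definition is_Pinf :: "'f set \<Rightarrow> bool" where
  "is_Pinf P \<longleftrightarrow> P \<in> places \<and> \<not> {x, y, z} \<subseteq> ring_at P"

end

text \<open>The argument order is $a_1, b_1, c_1$ (the lower indices), then $a_2, b_2, c_2$ (the upper
  indices).\<close>

definition gamma ::
  "int \<Rightarrow> int \<Rightarrow> int \<Rightarrow> int \<Rightarrow> int \<Rightarrow> int \<Rightarrow> int \<Rightarrow> int \<times> int" where
  "gamma q a1 b1 c1 a2 b2 c2 =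
     ((c2 - 1) * (q^3 + 1) + (q + 1 - a2) * (q\<^sup>2 - q + 1) - b2,
      (c1 - 1) * (q^3 + 1) + (q + 1 - a1) * (q\<^sup>2 - q + 1) - b1)"

definition w :: "int \<Rightarrow> int \<Rightarrow> int \<times> int" where
  "w q j = (- j * (q^3 + 1), j * (q^3 + 1))"

definition G1 :: "int \<Rightarrow> int \<Rightarrow> (int \<times> int) set" where
  "G1 q k = {gamma q i1 (k1 - i1 + 2) 1 i2 (k2 - i2 + 2) (k + 1) | i1 i2 k1 k2.
     max 0 (k1 - q\<^sup>2 + q + 2) \<le> i1 \<and> i1 \<le> min q (k1 + 2) \<and> k < k1 \<and> k1 \<le> q\<^sup>2 - 2 \<and>
     max 0 (k2 - q\<^sup>2 + q + 2) \<le> i2 \<and> i2 \<le> min q (k2 + 2) \<and> k < k2 \<and> k2 \<le> q\<^sup>2 - 2}"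

definition G3 :: "int \<Rightarrow> int \<Rightarrow> (int \<times> int) set" where
  "G3 q k = {gamma q i1 (k1 - i1 + 2) 1 i2 (k - i2 + 2) (k + 1) | i1 i2 k1.
     max 0 (k1 - q\<^sup>2 + q + 2) \<le> i1 \<and> i1 \<le> min q (k1 + 2) \<and>
     max 0 (k - q\<^sup>2 + q + 2) \<le> i2 \<and> i2 \<le> min q (k + 2) \<and>
     i2 \<le> i1 \<and> k < k1 \<and> k1 \<le> q\<^sup>2 - 2}"

definition G4 :: "int \<Rightarrow> int \<Rightarrow> (int \<times> int) set" where
  "G4 q k = (\<lambda>v. v - w q k) ` {(b, a). 0 < b \<and> 0 < a \<and> (a, b) \<in> G3 q k}"

end

theory Submission
  imports Defs
begin

text \<open>
  Put \<open>n = q\<^sup>3 + 1\<close> and \<open>N = q\<^sup>2 - q + 1\<close>. Since \<open>z\<^sup>n\<close> is a polynomial in \<open>x\<close>, the function field is the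
  Kummer extension \<open>K(x)(z)\<close> of degree \<open>n\<close>, and \<open>n = 1\<close> in \<open>K\<close>. Its Galois group fixes \<open>P\<^sub>0\<close> and
  \<open>P\<^sub>\<infinity>\<close>, so the ring of functions without poles elsewhere splits into eigenspaces; these
  turn out to be spanned by the monomials \<open>x\<^sup>k y\<^sup>i z\<^sup>j\<close> with \<open>k \<in> \<int>\<close>, \<open>i \<le> q\<close> and \<open>j < N\<close>. The values of
  these monomials are pairwise distinct at \<open>P\<^sub>0\<close> and at \<open>P\<^sub>\<infinity>\<close>, so the dimension of a Riemann-Roch space
  is the number of monomials in it, and no Riemann-Roch theorem is needed. With \<open>m = i N + j\<close>,
  the pole orders are \<open>- (k n + m)\<close> at \<open>P\<^sub>0\<close> and \<open>(k + i + j) n - m\<close> at \<open>P\<^sub>\<infinity>\<close>. Hence the pure gaps are the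
  pairs \<open>(A n - m, B n - m')\<close> with \<open>A, B \<ge> 1\<close> for which \<open>(A + B, m - m')\<close> is lexicographically
  below \<open>(i + j, 0)\<close>, and likewise with the roles of \<open>(i, j)\<close> and \<open>(i', j')\<close> exchanged.
\<close>

section \<open>Valuation rings\<close>

text \<open>\<open>val\<close> is a definite description, so it carries information about a place
  only once that place is known to be discrete, and a Riemann-Roch space quantifies over all places.
  Hence discreteness has to come before any value. Both rest on one inequality: elements whose
  values differ modulo the values of K(x) are linearly independent over K(x), so there are at most n
  of them. At \<open>P0\<close> the powers of z attain n such values, because z^n, as a polynomial
  in x, has a simple zero at 0; this shows that the degree is n and that x = 0 is totally ramified.
  At infinity the coprimality of n and q^3 gives total ramification. The values on K(x) and at z
  then determine the valuation ring, which makes \<open>P0\<close> and \<open>Pinf\<close> the only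
  places where x is not a unit. That q = 0 in K also gives \<open>F * H\<close> the derivative -1;
  its roots are therefore simple, which is what restricts the coefficients of regular functions to
  Laurent polynomials in x.\<close>

context field_ext
begin

lemma emb_0 [simp]: "emb 0 = 0"
  using emb_add[of 0 0] by (metis add.right_neutral add_left_cancel)

lemma emb_uminus: "emb (- a) = - emb a"
  using emb_add[of a "- a"] by (simp add: eq_neg_iff_add_eq_0 add.commute)

lemma emb_diff: "emb (a - b) = emb a - emb b"
  using emb_add[of a "- b"] by (simp add: emb_uminus)

lemma emb_eq_0_iff [simp]: "emb a = 0 \<longleftrightarrow> a = 0"
  using emb_mult[of a "inverse a"] emb_1 by (cases "a = 0") auto

lemma emb_inverse: "emb (inverse a) = inverse (emb a)"
proof (cases "a = 0")
  case False
  then have "emb a * emb (inverse a) = 1"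
    by (simp flip: emb_mult add: emb_1)
  then show ?thesis by (metis inverse_unique)
qed auto

lemma emb_divide: "emb (a / b) = emb a / emb b"
  by (simp add: divide_inverse emb_mult emb_inverse)

lemma emb_power: "emb (a ^ i) = emb a ^ i"
  by (induction i) (auto simp: emb_1 emb_mult)

lemma emb_sum: "emb (sum g I) = (\<Sum>i\<in>I. emb (g i))"
  by (induction I rule: infinite_finite_induct) (auto simp: emb_add)

end

locale valuation_ring_in = field_ext emb
  for emb :: "'k::field \<Rightarrow> 'f::field" +
  fixes R :: "'f set"
  assumes R: "valuation_ring R"
begin

abbreviation P where "P \<equiv> max_ideal R"

definition units :: "'f set" where
  "units = {u. u \<noteq> 0 \<and> u \<in> R \<and> inverse u \<in> R}"

lemma emb_in: "emb c \<in> R"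
  using R unfolding valuation_ring_def by blast

lemma zero_in [simp]: "0 \<in> R" and one_in [simp]: "1 \<in> R"
  using emb_in[of 0] emb_in[of 1] by (auto simp: emb_1)

lemma diff_in: "a \<in> R \<Longrightarrow> b \<in> R \<Longrightarrow> a - b \<in> R"
  and mult_in: "a \<in> R \<Longrightarrow> b \<in> R \<Longrightarrow> a * b \<in> R"
  and in_or_inverse_in: "a \<in> R \<or> inverse a \<in> R"
  using R unfolding valuation_ring_def by blast+

lemma uminus_in: "a \<in> R \<Longrightarrow> - a \<in> R"
  using diff_in[of 0 a] by simp

lemma add_in: "a \<in> R \<Longrightarrow> b \<in> R \<Longrightarrow> a + b \<in> R"
  using diff_in[of a "- b"] uminus_in[of b] by simp

lemma power_in: "a \<in> R \<Longrightarrow> a ^ i \<in> R"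
  by (induction i) (auto simp: mult_in)

lemma sum_in: "(\<And>i. i \<in> I \<Longrightarrow> g i \<in> R) \<Longrightarrow> sum g I \<in> R"
  by (induction I rule: infinite_finite_induct) (auto simp: add_in)

lemma mem_P_iff: "f \<in> P \<longleftrightarrow> f = 0 \<or> inverse f \<notin> R"
proof -
  have "(\<exists>g\<in>R. f * g = 1) \<longleftrightarrow> f \<noteq> 0 \<and> inverse f \<in> R"
    by (auto simp: inverse_unique intro!: bexI[of _ "inverse f"])
  then show ?thesis
    using in_or_inverse_in[of f] by (auto simp: max_ideal_def)
qed

lemma P_subset: "f \<in> P \<Longrightarrow> f \<in> R"
  by (simp add: max_ideal_def)

lemma zero_in_P [simp]: "0 \<in> P" and one_notin_P [simp]: "1 \<notin> P"
  by (auto simp: mem_P_iff)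

lemma units_iff: "u \<in> units \<longleftrightarrow> u \<in> R \<and> u \<notin> P"
  by (auto simp: units_def mem_P_iff)

lemma ring_at_P: "ring_at P = R"
  using in_or_inverse_in by (auto simp: ring_at_def mem_P_iff)

lemma mult_in_P: "a \<in> P \<Longrightarrow> b \<in> R \<Longrightarrow> a * b \<in> P"
  using mult_in[of b "inverse (a * b)"] by (cases "b = 0") (auto simp: mem_P_iff field_simps)

text \<open>One of b / a and a / b lies in R, so the sum is the term of smaller value times an
  element of R.\<close>

lemma add_in_P:
  assumes "a \<in> P" "b \<in> P" shows "a + b \<in> P"
proof (cases "b = 0 \<or> a = 0")
  case False
  have *: "a + b \<in> P" if "a \<in> P" "b / a \<in> R" "a \<noteq> 0" for a b
  proof -
    have "a * (1 + b / a) \<in> P"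
      using that by (intro mult_in_P add_in) auto
    then show ?thesis using that by (simp add: distrib_left)
  qed
  show ?thesis
    using *[of a b] *[of b a] assms False in_or_inverse_in[of "b / a"] by (auto simp: add.commute)
qed (use assms in auto)

lemma uminus_in_P: "a \<in> P \<Longrightarrow> - a \<in> P"
  using uminus_in[of "inverse (- a)"] by (auto simp: mem_P_iff)

lemma power_in_P: "a \<in> P \<Longrightarrow> i > 0 \<Longrightarrow> a ^ i \<in> P"
  by (cases i) (auto intro: mult_in_P power_in P_subset)

lemma add_unit_P: "u \<in> units \<Longrightarrow> a \<in> P \<Longrightarrow> u + a \<in> units"
  using add_in[of u a] add_in_P[of "u + a" "- a"] uminus_in_P[of a] P_subset[of a]
  by (auto simp: units_iff)

lemma one_unit [simp]: "1 \<in> units"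
  by (auto simp: units_def)

lemma unit_nonzero: "u \<in> units \<Longrightarrow> u \<noteq> 0"
  by (simp add: units_def)

lemma mult_unit: "u \<in> units \<Longrightarrow> v \<in> units \<Longrightarrow> u * v \<in> units"
  by (auto simp: units_def mult_in)

lemma inverse_unit: "u \<in> units \<Longrightarrow> inverse u \<in> units"
  by (auto simp: units_def)

lemma divide_unit: "u \<in> units \<Longrightarrow> v \<in> units \<Longrightarrow> u / v \<in> units"
  by (simp add: divide_inverse mult_unit inverse_unit)

lemma power_unit: "u \<in> units \<Longrightarrow> u ^ i \<in> units"
  by (induction i) (auto simp: mult_unit)

lemma power_int_unit: "u \<in> units \<Longrightarrow> u powi i \<in> units"
  by (auto simp: power_int_def power_unit inverse_unit)

lemma emb_unit: "c \<noteq> 0 \<Longrightarrow> emb c \<in> units"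
  using emb_in[of c] emb_in[of "inverse c"] by (auto simp: units_def emb_inverse)

lemma P_notunit: "a \<in> P \<Longrightarrow> a \<notin> units"
  by (simp add: units_iff)

lemma trichotomy: "f \<noteq> 0 \<Longrightarrow> f \<in> P \<or> f \<in> units \<or> inverse f \<in> P"
  by (auto simp: units_def mem_P_iff)

text \<open>Ultrametric principle without a value group: \<open>g i / g j \<notin> units\<close>
  says that the values differ, so one term has the least value and the sum agrees with it up to a
  unit. It serves independence over K(x), where discreteness is not yet known, and later
  \<open>val_sum\<close>.\<close>

lemma dominant_term:
  assumes "finite I" "I \<noteq> {}" "\<And>i. i \<in> I \<Longrightarrow> g i \<noteq> 0"
    and "\<And>i j. i \<in> I \<Longrightarrow> j \<in> I \<Longrightarrow> i \<noteq> j \<Longrightarrow> g i / g j \<notin> units"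
  shows "\<exists>m\<in>I. sum g I / g m \<in> units \<and> (\<forall>i\<in>I. g i / g m \<in> R)"
  using assms
proof (induction rule: finite_ne_induct)
  case (singleton a)
  then show ?case by auto
next
  case (insert a I)
  then obtain m where m: "m \<in> I" "sum g I / g m \<in> units" "\<forall>i\<in>I. g i / g m \<in> R"
    by auto
  have nz: "g a \<noteq> 0" "g m \<noteq> 0" "a \<noteq> m"
    using insert m by auto
  then have "g a / g m \<notin> units"
    using insert m by auto
  then consider "g a / g m \<in> P" | "g m / g a \<in> P"
    using trichotomy[of "g a / g m"] nz by auto
  then show ?case
  proof cases
    case 1
    have "(sum g I + g a) / g m \<in> units"
      using add_unit_P[OF m(2) 1] by (simp add: add_divide_distrib)
    then show ?thesis
      using insert m P_subset[OF 1] by (intro bexI[of _ m]) (auto simp: add.commute)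
  next
    case 2
    have "g m / g a * (sum g I / g m) \<in> P"
      using m(2) by (intro mult_in_P[OF 2]) (simp add: units_iff)
    then have "1 + sum g I / g a \<in> units"
      using nz by (intro add_unit_P) auto
    moreover have "1 + sum g I / g a = (g a + sum g I) / g a"
      using nz by (simp add: field_simps)
    moreover have "g i / g a \<in> R" if "i \<in> I" for i
      using mult_in[OF m(3)[rule_format, OF that] P_subset[OF 2]] nz by simp
    ultimately show ?thesis
      using insert nz by (intro bexI[of _ a]) auto
  qed
qed

end

section \<open>Discrete valuation rings and the function \<open>val\<close>\<close>

locale discrete_valuation_ring = valuation_ring_in emb R
  for emb :: "'k::field \<Rightarrow> 'f::field" and R +
  fixes \<pi> :: 'f
  assumes pi_in: "\<pi> \<in> P" and pi_nz: "\<pi> \<noteq> 0"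
    and pi_decomp: "\<And>f. f \<noteq> 0 \<Longrightarrow> \<exists>k. \<exists>u\<in>units. f = \<pi> powi k * u"
begin

lemma pi_power_in: "i \<ge> 0 \<Longrightarrow> \<pi> powi i \<in> R"
  using power_in[OF P_subset[OF pi_in]] by (auto simp: power_int_def)

lemma pi_power_in_P: "i > 0 \<Longrightarrow> \<pi> powi i \<in> P"
  using power_in_P[OF pi_in, of "nat i"] by (auto simp: power_int_def)

lemma pi_power_unit_iff: "\<pi> powi i \<in> units \<longleftrightarrow> i = 0"
proof -
  have "\<pi> powi i \<notin> units" if "i > 0" for i
    using P_notunit[OF pi_power_in_P[OF that]] .
  from this[of i] this[of "- i"] show ?thesis
    using inverse_unit[of "\<pi> powi i"] by (cases i "0 :: int" rule: linorder_cases) (auto simp: power_int_minus)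
qed

text \<open>\<open>\<pi>\<close> generates \<open>P\<close>, because an element of \<open>P\<close>
  has a positive exponent in \<open>pi_decomp\<close>, and two generators of one ideal divide each
  other. Thus the exponent in \<open>val\<close> cannot depend on the uniformizer.\<close>

lemma uniformizer_iff: "uniformizer P t \<longleftrightarrow> t / \<pi> \<in> units"
proof
  have P_eq: "P = {\<pi> * f | f. f \<in> R}"
  proof safe
    fix f assume f: "f \<in> P"
    show "\<exists>g. f = \<pi> * g \<and> g \<in> R"
    proof (cases "f = 0")
      case False
      then obtain k u where ku: "u \<in> units" "f = \<pi> powi k * u"
        using pi_decomp by blast
      have "k > 0"
      proof (rule ccontr)
        assume "\<not> k > 0"
        then have "inverse f \<in> R"
          using ku pi_power_in[of "- k"] by (auto simp: power_int_minus units_def mult_in)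
        then show False using f False by (simp add: mem_P_iff)
      qed
      then have "\<pi> powi (k - 1) * u \<in> R"
        using ku pi_power_in[of "k - 1"] by (auto simp: units_def intro: mult_in)
      moreover have "f = \<pi> * (\<pi> powi (k - 1) * u)"
        using ku pi_nz by (simp add: power_int_diff)
      ultimately show ?thesis by blast
    qed (auto intro!: exI[of _ 0])
  qed (auto intro: mult_in_P pi_in)
  {
    assume t: "uniformizer P t"
    then have "t \<in> P" "\<exists>g\<in>R. \<pi> = t * g" "\<exists>g\<in>R. t = \<pi> * g"
      using pi_in one_in P_eq unfolding uniformizer_def ring_at_P by force+
    then obtain g h where gh: "g \<in> R" "h \<in> R" "\<pi> = t * g" "t = \<pi> * h"
      by blast
    have "t \<noteq> 0" using gh(3) pi_nz by auto
    have "t / \<pi> = h" using pi_nz by (subst gh(4)) simp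
    moreover have "inverse (t / \<pi>) = g" using \<open>t \<noteq> 0\<close> by (subst gh(3)) simp
    ultimately show "t / \<pi> \<in> units"
      using pi_nz gh(1,2) \<open>t \<noteq> 0\<close> unfolding units_def by auto
  next
    assume t: "t / \<pi> \<in> units"
    then have "t \<noteq> 0" by (auto simp: units_def)
    have "P = {t * f | f. f \<in> R}"
    proof safe
      fix f assume "f \<in> P"
      then obtain g where "f = \<pi> * g" "g \<in> R" using P_eq by blast
      then show "\<exists>g. f = t * g \<and> g \<in> R"
        using t \<open>t \<noteq> 0\<close> mult_in[of g "inverse (t / \<pi>)"]
        by (intro exI[of _ "g * inverse (t / \<pi>)"]) (auto simp: units_def)
    next
      fix f assume "f \<in> R"
      have "t * f = \<pi> * ((t / \<pi>) * f)"
        using pi_nz by simp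
      also have "\<dots> \<in> P"
        using t \<open>f \<in> R\<close> by (intro mult_in_P pi_in mult_in) (auto simp: units_def)
      finally show "t * f \<in> P" .
    qed
    then show "uniformizer P t" unfolding uniformizer_def ring_at_P .
  }
qed

lemma val_pi_mult:
  assumes "u \<in> units"
  shows "val P (\<pi> powi k * u) = k"
  unfolding val_def
proof (rule the_equality)
  show "\<exists>t v. uniformizer P t \<and> v \<in> ring_at P - P \<and> \<pi> powi k * u = t powi k * v"
    using assms pi_nz by (intro exI[of _ \<pi>] exI[of _ u]) (auto simp: uniformizer_iff ring_at_P units_iff)
next
  fix m assume "\<exists>t v. uniformizer P t \<and> v \<in> ring_at P - P \<and> \<pi> powi k * u = t powi m * v"
  then obtain t v where tv: "t / \<pi> \<in> units" "v \<in> units" "\<pi> powi k * u = t powi m * v"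
    by (auto simp: uniformizer_iff ring_at_P units_iff)
  have nz: "t \<noteq> 0" "u \<noteq> 0" using tv(1) assms by (auto simp: units_def)
  have "\<pi> powi (k - m) = (t / \<pi>) powi m * v / u"
    using tv(3) nz pi_nz by (simp add: power_int_diff power_int_divide_distrib field_simps)
  also have "\<dots> \<in> units"
    by (rule divide_unit[OF mult_unit[OF power_int_unit[OF tv(1)] tv(2)] assms])
  finally show "m = k" by (simp add: pi_power_unit_iff)
qed

lemma decomp: "f \<noteq> 0 \<Longrightarrow> \<exists>u\<in>units. f = \<pi> powi (val P f) * u"
  using pi_decomp[of f] val_pi_mult by force

lemma val_mult:
  assumes "f \<noteq> 0" "g \<noteq> 0"
  shows "val P (f * g) = val P f + val P g"
proof -
  obtain u v where uv: "u \<in> units" "v \<in> units" "f = \<pi> powi (val P f) * u" "g = \<pi> powi (val P g) * v"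
    using decomp assms by meson
  have "f * g = \<pi> powi (val P f + val P g) * (u * v)"
    using pi_nz by (subst uv(3), subst uv(4)) (simp add: power_int_add)
  then show ?thesis using uv by (simp add: val_pi_mult mult_unit)
qed

lemma val_unit: "u \<in> units \<Longrightarrow> val P u = 0"
  using val_pi_mult[of u 0] by simp

lemma val_1 [simp]: "val P 1 = 0" by (simp add: val_unit)

lemma val_emb: "c \<noteq> 0 \<Longrightarrow> val P (emb c) = 0"
  by (simp add: val_unit emb_unit)

lemma val_inverse: "f \<noteq> 0 \<Longrightarrow> val P (inverse f) = - val P f"
  using val_mult[of f "inverse f"] by simp

lemma val_divide: "f \<noteq> 0 \<Longrightarrow> g \<noteq> 0 \<Longrightarrow> val P (f / g) = val P f - val P g"
  by (simp add: divide_inverse val_mult val_inverse)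

lemma val_power: "f \<noteq> 0 \<Longrightarrow> val P (f ^ i) = int i * val P f"
  by (induction i) (auto simp: val_mult algebra_simps)

lemma val_power_int: "f \<noteq> 0 \<Longrightarrow> val P (f powi i) = i * val P f"
  by (auto simp: power_int_def val_power val_inverse)

lemma val_nonneg_iff:
  assumes "f \<noteq> 0" shows "val P f \<ge> 0 \<longleftrightarrow> f \<in> R"
proof -
  obtain u where u: "u \<in> units" "f = \<pi> powi (val P f) * u"
    using decomp assms by meson
  show ?thesis
  proof
    assume "val P f \<ge> 0"
    then show "f \<in> R" using u pi_power_in mult_in by (metis units_iff)
  next
    assume "f \<in> R"
    show "val P f \<ge> 0"
    proof (rule ccontr)
      assume "\<not> val P f \<ge> 0"
      then have "\<pi> powi (- val P f) \<in> P" by (intro pi_power_in_P) auto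
      then have "\<pi> powi (- val P f) * f \<in> P" using \<open>f \<in> R\<close> by (rule mult_in_P)
      moreover have "\<pi> powi (- val P f) * f = u"
        using pi_nz by (subst (2) u(2)) (simp flip: power_int_add add: mult.assoc[symmetric])
      ultimately show False using u by (simp add: units_iff)
    qed
  qed
qed

lemma val_sum:
  assumes "finite I" "I \<noteq> {}" "\<And>i. i \<in> I \<Longrightarrow> g i \<noteq> 0" "inj_on (\<lambda>i. val P (g i)) I"
  shows "\<exists>m\<in>I. sum g I \<noteq> 0 \<and> val P (sum g I) = val P (g m) \<and> (\<forall>i\<in>I. val P (g m) \<le> val P (g i))"
proof -
  have "g i / g j \<notin> units" if "i \<in> I" "j \<in> I" "i \<noteq> j" for i j
    using val_unit[of "g i / g j"] that assms by (auto simp: val_divide inj_on_def)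
  then obtain m where m: "m \<in> I" "sum g I / g m \<in> units" "\<forall>i\<in>I. g i / g m \<in> R"
    using dominant_term[of I g] assms by blast
  have nz: "sum g I \<noteq> 0" "g m \<noteq> 0" using m by (auto simp: units_def)
  have "val P (g m) \<le> val P (g i)" if "i \<in> I" for i
    using val_nonneg_iff[of "g i / g m"] m that assms(3)[of i] nz by (auto simp: val_divide)
  moreover have "val P (sum g I) = val P (g m)"
    using val_unit[OF m(2)] nz by (simp add: val_divide)
  ultimately show ?thesis using m nz by blast
qed

end

text \<open>In a largest set of elements of pairwise different values between those of \<open>1\<close> and \<open>t\<close>,
  the element of least positive value is a uniformizer.\<close>

lemma (in valuation_ring_in) discrete_if_bounded:
  assumes t: "t \<in> P" "t \<noteq> 0"
    and bound: "\<And>W. finite W \<Longrightarrow> 0 \<notin> W \<Longrightarrow>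
      (\<And>a b (r::int). a \<in> W \<Longrightarrow> b \<in> W \<Longrightarrow> a \<noteq> b \<Longrightarrow> t powi r * (a / b) \<notin> units) \<Longrightarrow> card W \<le> n"
  shows "\<exists>\<pi> e. discrete_valuation_ring emb R \<pi> \<and> 0 < e \<and> e \<le> n \<and> t / \<pi> ^ e \<in> units"
proof -
  \<comment> \<open>The elements of a good set have values from 0 up to, but excluding, that of t.
    Different values in that range stay different modulo the value of t, which is what
    \<open>bound\<close> asks for.\<close>
  define good where "good W \<longleftrightarrow> finite W \<and> 1 \<in> W \<and> (\<forall>w\<in>W. w \<noteq> 0 \<and> w \<in> R \<and> t / w \<in> P) \<and>
      (\<forall>a\<in>W. \<forall>b\<in>W. a \<noteq> b \<longrightarrow> a / b \<notin> units)" for W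
  have good_card: "card W \<le> n" if W: "good W" for W
  proof (rule bound)
    fix a b and r :: int assume ab: "a \<in> W" "b \<in> W" "a \<noteq> b"
    have *: "t powi r * (a / b) \<notin> units" if "a \<in> W" "b \<in> W" "r > 0" for a b and r :: int
    proof -
      have "t / b * a * t ^ nat (r - 1) \<in> P"
        using W that t by (intro mult_in_P power_in) (auto simp: good_def P_subset)
      also have "t / b * a * t ^ nat (r - 1) = t powi r * (a / b)"
        using power_int_add[of t 1 "r - 1"] that t by (simp add: power_int_def)
      finally show ?thesis by (rule P_notunit)
    qed
    consider "r > 0" | "r = 0" | "r < 0" by linarith
    then show "t powi r * (a / b) \<notin> units"
    proof cases
      case 3
      have "a \<noteq> 0" "b \<noteq> 0" using W ab by (auto simp: good_def)
      then show ?thesis using *[of b a "- r"] 3 ab inverse_unit[of "t powi r * (a / b)"]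
        by (auto simp: power_int_minus field_simps)
    qed (use * ab W in \<open>auto simp: good_def\<close>)
  qed (use W in \<open>auto simp: good_def\<close>)
  have "good {1}" using t by (auto simp: good_def)
  then obtain W where W: "good W" "\<And>W'. good W' \<Longrightarrow> card W' \<le> card W"
    using ex_has_greatest_nat[of good "{1}" card "Suc n"] good_card by (auto simp: less_Suc_eq_le)
  have finW: "finite W" using W by (auto simp: good_def)
  \<comment> \<open>t is included so that a least positive value exists even when no element of W
    lies in P.\<close>
  define S where "S = insert t (W \<inter> P)"
  have "\<exists>m\<in>S. \<forall>i\<in>S. i / m \<in> R"
  proof -
    have "\<exists>m\<in>S. \<forall>i\<in>S. i / m \<in> R" if "finite S" "S \<noteq> {}" "0 \<notin> S" for S
      using that
    proof (induction rule: finite_ne_induct)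
      case (insert a S)
      then obtain m where m: "m \<in> S" "\<forall>i\<in>S. i / m \<in> R" by auto
      show ?case
      proof (cases "a / m \<in> R")
        case False
        then have *: "m / a \<in> R" using in_or_inverse_in[of "a / m"] by simp
        have "i / a \<in> R" if "i \<in> S" for i
          using mult_in[OF m(2)[rule_format, OF that] *] m(1) insert by (auto split: if_splits)
        then show ?thesis using insert by auto
      qed (use m in auto)
    qed auto
    moreover have "finite S" "S \<noteq> {}" "0 \<notin> S"
      using finW t W by (auto simp: S_def good_def)
    ultimately show ?thesis by blast
  qed
  then obtain \<pi> where pi: "\<pi> \<in> S" "\<And>i. i \<in> S \<Longrightarrow> i / \<pi> \<in> R" by blast
  have piP: "\<pi> \<in> P" "\<pi> \<noteq> 0" using pi(1) W(1) t by (auto simp: S_def good_def)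
  \<comment> \<open>If some f in P had smaller value than \<open>\<pi>\<close>, its value would lie
    strictly between 0 and every value in S, so f could be added to the maximal set W.\<close>
  have P_pi: "f / \<pi> \<in> R" if f: "f \<in> P" for f
  proof (rule ccontr)
    assume nR: "f / \<pi> \<notin> R"
    then have f0: "f \<noteq> 0" by auto
    have pf: "\<pi> / f \<in> P" using nR piP by (auto simp: mem_P_iff)
    have SP: "i / f \<in> P" if "i \<in> S" for i
      using mult_in_P[OF pf pi(2)[OF that]] piP by (simp add: mult.commute)
    have nu: "w / f \<notin> units" if "w \<in> W" for w
    proof (cases "w \<in> P")
      case True
      then show ?thesis using SP[of w] that by (auto simp: S_def P_notunit)
    next
      case False
      then have "w \<in> units" using W that by (auto simp: good_def units_iff)
      then show ?thesis using divide_unit[of w "w / f"] f f0 P_notunit[OF f] unit_nonzero[of w] by auto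
    qed
    have fW: "f \<notin> W" using nu[of f] f0 by auto
    have "good (insert f W)"
      unfolding good_def
    proof (intro conjI ballI impI)
      fix a b assume ab: "a \<in> insert f W" "b \<in> insert f W" "a \<noteq> b"
      have "f / w \<notin> units" if "w \<in> W" for w
        using inverse_unit[of "f / w"] nu[OF that] by auto
      moreover have "a / b \<notin> units" if "a \<in> W" "b \<in> W"
        using W(1) that ab(3) by (simp add: good_def)
      ultimately show "a / b \<notin> units" using ab nu by blast
    qed (use W(1) f f0 SP[of t] finW in \<open>auto simp: good_def S_def P_subset\<close>)
    from W(2)[OF this] show False using fW finW by simp
  qed
  \<comment> \<open>By \<open>P_pi\<close>, dividing an element of P by \<open>\<pi>\<close> stays
    inside R; the first quotient outside P is a unit.\<close>
  have split: "\<exists>i\<le>m. f / \<pi> ^ i \<in> units" if "f \<in> R" "f / \<pi> ^ m \<notin> P" for f m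
    using that
  proof (induction m)
    case 0
    then show ?case by (auto simp: units_iff)
  next
    case (Suc m)
    show ?case
    proof (cases "f / \<pi> ^ m \<in> P")
      case True
      from P_pi[OF this] have "f / \<pi> ^ Suc m \<in> R" by (simp add: field_simps)
      then show ?thesis using Suc by (auto simp: units_iff)
    qed (use Suc in \<open>auto intro: le_SucI\<close>)
  qed
  \<comment> \<open>Otherwise 1, \<open>\<pi>\<close>, ..., \<open>\<pi> ^ n\<close> would form a
    good set with n + 1 elements.\<close>
  have "\<exists>m\<le>n. t / \<pi> ^ m \<notin> P"
  proof (rule ccontr)
    assume "\<not> ?thesis"
    then have tm: "t / \<pi> ^ m \<in> P" if "m \<le> n" for m using that by auto
    have np: "\<pi> ^ i \<notin> units" if "i > 0" for i
      using power_in_P[OF piP(1) that] P_notunit by blast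
    have nd: "\<pi> ^ i / \<pi> ^ j \<notin> units" if "i \<noteq> j" for i j
    proof (cases "i < j")
      case True
      then have "inverse (\<pi> ^ i / \<pi> ^ j) = \<pi> ^ (j - i)"
        using piP by (simp add: power_diff)
      then show ?thesis using inverse_unit[of "\<pi> ^ i / \<pi> ^ j"] np[of "j - i"] True by auto
    next
      case False
      then have "\<pi> ^ i / \<pi> ^ j = \<pi> ^ (i - j)" using piP by (simp add: power_diff)
      then show ?thesis using np[of "i - j"] that False by auto
    qed
    then have inj: "inj_on (\<lambda>i. \<pi> ^ i) {..n}"
      using piP by (auto simp: inj_on_def) (metis divide_self one_unit power_not_zero)
    have "good ((\<lambda>i. \<pi> ^ i) ` {..n})"
      unfolding good_def
    proof (intro conjI ballI impI)
      fix a b assume ab: "a \<in> (\<lambda>i. \<pi> ^ i) ` {..n}" "b \<in> (\<lambda>i. \<pi> ^ i) ` {..n}" "a \<noteq> b"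
      then obtain i j where ij: "a = \<pi> ^ i" "b = \<pi> ^ j" by blast
      show "a / b \<notin> units" using nd[of i j] ab(3) unfolding ij by metis
    next
      show "1 \<in> (\<lambda>i. \<pi> ^ i) ` {..n}" by (rule image_eqI[of _ _ 0]) auto
    next
      fix w assume "w \<in> (\<lambda>i. \<pi> ^ i) ` {..n}"
      then obtain i where i: "i \<le> n" "w = \<pi> ^ i" by blast
      show "w \<noteq> 0" "w \<in> R" "t / w \<in> P"
        unfolding i(2) using tm[OF i(1)] piP by (simp_all add: power_in P_subset)
    qed simp
    from good_card[OF this] show False using card_image[OF inj] by simp
  qed
  then obtain e where e: "e \<le> n" "t / \<pi> ^ e \<in> units"
    using split[OF P_subset[OF t(1)]] by (meson le_trans)
  have e0: "e > 0" using e t by (cases e) (auto simp: units_iff)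
  have decomp_R: "\<exists>i. f / \<pi> ^ i \<in> units" if f: "f \<in> R" "f \<noteq> 0" for f
  proof -
    \<comment> \<open>This excludes an f whose value exceeds every multiple of that of t: its powers
      would be inequivalent modulo powers of t, against \<open>bound\<close>.\<close>
    have "\<exists>m. f / t ^ m \<notin> P"
    proof (rule ccontr)
      assume "\<not> ?thesis"
      then have fm: "f / t ^ m \<in> P" for m by auto
      have *: "t powi r * f ^ i \<in> P" if i0: "i > 0" for r and i :: nat
      proof -
        obtain j where j: "i = Suc j" using i0 gr0_implies_Suc by blast
        have "f / t ^ nat (- r) * (t ^ nat r * f ^ j) \<in> P"
          using f t by (intro mult_in_P fm mult_in power_in) (auto intro: P_subset)
        also have "f / t ^ nat (- r) * (t ^ nat r * f ^ j) = t powi r * f ^ i"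
          unfolding power_int_def j using t by (cases "r \<ge> 0") (auto simp: field_simps)
        finally show ?thesis .
      qed
      have **: "t powi r * (f ^ i / f ^ j) \<notin> units" if "i \<noteq> j" for r i j
      proof (cases "i < j")
        case True
        then have "inverse (t powi r * (f ^ i / f ^ j)) = t powi (- r) * f ^ (j - i)"
          using f t by (simp add: power_diff power_int_minus field_simps)
        then show ?thesis
          using inverse_unit[of "t powi r * (f ^ i / f ^ j)"] *[of "j - i" "- r"] P_notunit True by force
      next
        case False
        then have "f ^ i / f ^ j = f ^ (i - j)" using f by (simp add: power_diff)
        then show ?thesis using *[of "i - j" r] that False P_notunit by auto
      qed
      have inj: "inj_on (\<lambda>i. f ^ i) {..n}"
        using **[of _ _ 0] f by (auto simp: inj_on_def) (metis divide_self one_unit power_not_zero)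
      have "card ((\<lambda>i. f ^ i) ` {..n}) \<le> n"
      proof (rule bound)
        fix a b and r :: int
        assume ab: "a \<in> (\<lambda>i. f ^ i) ` {..n}" "b \<in> (\<lambda>i. f ^ i) ` {..n}" "a \<noteq> b"
        then obtain i j where ij: "a = f ^ i" "b = f ^ j" by blast
        show "t powi r * (a / b) \<notin> units" using **[of i j r] ab(3) unfolding ij by metis
      qed (use f in auto)
      then show False using card_image[OF inj] by simp
    qed
    then obtain m where m: "f / t ^ m \<notin> P" by blast
    have "f / \<pi> ^ (e * m) \<notin> P"
    proof
      assume "f / \<pi> ^ (e * m) \<in> P"
      then have "f / \<pi> ^ (e * m) * inverse ((t / \<pi> ^ e) ^ m) \<in> P"
        using power_unit[OF e(2), of m] by (intro mult_in_P) (auto simp: units_def)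
      also have "f / \<pi> ^ (e * m) * inverse ((t / \<pi> ^ e) ^ m) = f / t ^ m"
        using piP t by (simp add: power_mult field_simps)
      finally show False using m by simp
    qed
    then show ?thesis using split[OF f(1)] by blast
  qed
  have "discrete_valuation_ring emb R \<pi>"
  proof unfold_locales
    fix f :: 'f assume f: "f \<noteq> 0"
    show "\<exists>k. \<exists>u\<in>units. f = \<pi> powi k * u"
    proof (cases "f \<in> R")
      case True
      then obtain i where "f / \<pi> ^ i \<in> units" using decomp_R f by blast
      then show ?thesis using piP by (intro exI[of _ "int i"] bexI[of _ "f / \<pi> ^ i"]) auto
    next
      case False
      then have "inverse f \<in> R" using in_or_inverse_in by auto
      then obtain i where "inverse f / \<pi> ^ i \<in> units" using decomp_R[of "inverse f"] f by auto
      from inverse_unit[OF this] show ?thesis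
        using piP f by (intro exI[of _ "- int i"] bexI[of _ "f * \<pi> ^ i"]) (auto simp: field_simps power_int_minus)
    qed
  qed (use piP in auto)
  with e e0 show ?thesis by blast
qed

section \<open>Rational functions in one element\<close>

context field_ext
begin

section \<open>Extending a subring to a valuation ring\<close>

definition subring_over :: "'f set \<Rightarrow> bool" where
  "subring_over A \<longleftrightarrow> range emb \<subseteq> A \<and> (\<forall>a\<in>A. \<forall>b\<in>A. a - b \<in> A \<and> a * b \<in> A)"

lemma subring_over_closed:
  assumes "subring_over A"
  shows "0 \<in> A" "1 \<in> A" "a \<in> A \<Longrightarrow> b \<in> A \<Longrightarrow> a - b \<in> A" "a \<in> A \<Longrightarrow> b \<in> A \<Longrightarrow> a * b \<in> A"
    "a \<in> A \<Longrightarrow> b \<in> A \<Longrightarrow> a + b \<in> A" "a \<in> A \<Longrightarrow> a ^ i \<in> A"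
proof -
  have e: "emb c \<in> A" for c using assms by (auto simp: subring_over_def)
  have d: "a - b \<in> A" and m: "a * b \<in> A" if "a \<in> A" "b \<in> A" for a b
    using assms that by (auto simp: subring_over_def)
  show 0: "0 \<in> A" and 1: "1 \<in> A" using e[of 0] e[of 1] by (auto simp: emb_1)
  show "a \<in> A \<Longrightarrow> b \<in> A \<Longrightarrow> a - b \<in> A" "a \<in> A \<Longrightarrow> b \<in> A \<Longrightarrow> a * b \<in> A"
    by (fact d m)+
  show "a \<in> A \<Longrightarrow> b \<in> A \<Longrightarrow> a + b \<in> A" using d[of a "0 - b"] d[OF 0, of b] by simp
  show "a \<in> A \<Longrightarrow> a ^ i \<in> A" by (induction i) (auto simp: 1 m)
qed

lemma subring_over_sum:
  assumes "subring_over A" "\<And>i. i \<in> I \<Longrightarrow> g i \<in> A" shows "sum g I \<in> A"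
  using assms(2) by (induction I rule: infinite_finite_induct) (auto simp: subring_over_closed[OF assms(1)])

text \<open>The set is the ring A[g]; as A is a set and not a type, its polynomials are those over
  the whole field with all coefficients in A.\<close>

lemma subring_over_adjoin_one:
  assumes A: "subring_over A"
  shows "subring_over {poly p g | p. \<forall>i. coeff p i \<in> A}" (is "subring_over ?B")
    and "A \<subseteq> {poly p g | p. \<forall>i. coeff p i \<in> A}"
    and "g \<in> {poly p g | p. \<forall>i. coeff p i \<in> A}"
proof -
  note cl = subring_over_closed[OF A]
  have c: "\<forall>i. coeff [:a:] i \<in> A" if "a \<in> A" for a
    using that cl by (auto simp: coeff_pCons split: nat.split)
  show AB: "A \<subseteq> ?B"
  proof
    fix a assume "a \<in> A"
    then show "a \<in> ?B" using c[of a] by (intro CollectI exI[of _ "[:a:]"]) auto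
  qed
  show "g \<in> ?B"
    using cl by (intro CollectI exI[of _ "[:0, 1:]"]) (auto simp: coeff_pCons split: nat.split)
  have "poly p g - poly q g \<in> ?B \<and> poly p g * poly q g \<in> ?B"
    if "\<forall>i. coeff p i \<in> A" "\<forall>i. coeff q i \<in> A" for p q
  proof
    show "poly p g - poly q g \<in> ?B"
      using that cl by (intro CollectI exI[of _ "p - q"]) auto
    show "poly p g * poly q g \<in> ?B"
      using that cl by (intro CollectI exI[of _ "p * q"]) (auto simp: coeff_mult intro!: subring_over_sum[OF A])
  qed
  then show "subring_over ?B"
    using AB A unfolding subring_over_def by blast
qed

text \<open>A subring that is maximal among those not containing \<open>u\<close>, where \<open>1/u\<close> belongs to it, is a
  valuation ring: it is local with \<open>1/u\<close> in its maximal ideal, and relations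
  of degree \<open>m\<close> for \<open>g\<close> and \<open>1/g\<close> with coefficients divisible by \<open>1/u\<close> can be
  lowered to degree \<open>m - 1\<close>.\<close>

lemma exists_valuation_ring:
  assumes A: "subring_over A" and u: "u \<notin> A" "inverse u \<in> A"
  shows "\<exists>R. valuation_ring R \<and> A \<subseteq> R \<and> u \<notin> R"
proof -
  define \<A> where "\<A> = {S. subring_over S \<and> A \<subseteq> S \<and> u \<notin> S}"
  have "\<exists>M\<in>\<A>. \<forall>S\<in>\<A>. M \<subseteq> S \<longrightarrow> S = M"
  proof (rule subset_Zorn_nonempty)
    have "A \<in> \<A>" unfolding \<A>_def using A u(1) by blast
    then show "\<A> \<noteq> {}" by blast
    fix C assume C: "C \<noteq> {}" "subset.chain \<A> C"
    then have CA: "C \<subseteq> \<A>" and ch: "\<And>S T. S \<in> C \<Longrightarrow> T \<in> C \<Longrightarrow> S \<subseteq> T \<or> T \<subseteq> S"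
      by (auto simp: subset.chain_def)
    have "a - b \<in> \<Union>C \<and> a * b \<in> \<Union>C" if "a \<in> \<Union>C" "b \<in> \<Union>C" for a b
    proof -
      obtain S T where ST: "S \<in> C" "a \<in> S" "T \<in> C" "b \<in> T" using \<open>a \<in> \<Union>C\<close> \<open>b \<in> \<Union>C\<close> by blast
      then obtain U where U: "U \<in> C" "a \<in> U" "b \<in> U" using ch[of S T] by blast
      then have "subring_over U" using CA by (auto simp: \<A>_def)
      then have "a - b \<in> U" "a * b \<in> U" using U subring_over_closed by blast+
      then show ?thesis using U(1) by blast
    qed
    then show "\<Union>C \<in> \<A>"
      using C(1) CA unfolding \<A>_def subring_over_def by blast
  qed
  then obtain R where "R \<in> \<A>" and max': "\<forall>S\<in>\<A>. R \<subseteq> S \<longrightarrow> S = R"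
    by (elim bexE)
  then have R: "subring_over R" "A \<subseteq> R" "u \<notin> R"
    by (simp_all add: \<A>_def)
  have max: "S = R" if "subring_over S" "A \<subseteq> S" "u \<notin> S" "R \<subseteq> S" for S
    using max'[rule_format, of S] that by (simp add: \<A>_def)
  note cl = subring_over_closed[OF R(1)]
  define t where "t = inverse u"
  have t: "t \<in> R" "t \<noteq> 0" and ut: "u = inverse t"
    using u R cl(1) by (auto simp: t_def)
  have not1: "1 \<noteq> t * r" if "r \<in> R" for r
    using that R(3) t unfolding ut by (metis inverse_unique)
  define rel where "rel g m \<longleftrightarrow> (\<exists>a. (\<forall>i. a i \<in> R) \<and> 1 = t * (\<Sum>i\<le>m. a i * g ^ i))" for g and m :: nat
  \<comment> \<open>By maximality of R the larger ring R[g] contains u = 1/t; multiplying by t gives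
    the relation.\<close>
  have rel: "\<exists>m. rel g m" if "g \<notin> R" for g
  proof -
    let ?B = "{poly p g | p. \<forall>i. coeff p i \<in> R}"
    have "u \<in> ?B"
      using max[of ?B] subring_over_adjoin_one[OF R(1), of g] that R(2) by blast
    then obtain p where p: "u = poly p g" "\<forall>i. coeff p i \<in> R" by blast
    have "1 = t * (\<Sum>i\<le>degree p. coeff p i * g ^ i)"
      using p(1) t by (simp add: ut poly_altdef[symmetric] flip: p(1))
    then show ?thesis using p(2) unfolding rel_def by blast
  qed
  have pad: "rel g m" if gl: "rel g l" "l \<le> m" for g l m
  proof -
    obtain a where a: "\<forall>i. a i \<in> R" "1 = t * (\<Sum>i\<le>l. a i * g ^ i)"
      using gl unfolding rel_def by blast
    have "(\<Sum>i\<le>l. a i * g ^ i) = (\<Sum>i\<le>m. (if i \<le> l then a i else 0) * g ^ i)"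
      using that by (intro sum.mono_neutral_cong_left) auto
    then show ?thesis using a cl unfolding rel_def
      by (intro exI[of _ "\<lambda>i. if i \<le> l then a i else 0"]) auto
  qed
  \<comment> \<open>If 1/v with v = 1 - t r were outside R, its relation times v^m would put v^m
    into tR. But v^m is 1 modulo tR, so 1 would lie in tR, against \<open>not1\<close>.\<close>
  have unit: "1 - t * r \<noteq> 0" "inverse (1 - t * r) \<in> R" if r: "r \<in> R" for r
  proof -
    define v where "v = 1 - t * r"
    show v0: "1 - t * r \<noteq> 0" using not1[OF r] by auto
    have vd: "\<exists>r'\<in>R. v ^ d = 1 - t * r'" for d
    proof (induction d)
      case 0
      then show ?case using cl(1) by (intro bexI[of _ 0]) auto
    next
      case (Suc d)
      then obtain r' where r': "r' \<in> R" "v ^ d = 1 - t * r'" by blast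
      have "v ^ Suc d = 1 - t * (r + r' - r * t * r')"
        by (simp add: r'(2)) (simp add: v_def algebra_simps)
      moreover have "r + r' - r * t * r' \<in> R" using r r' t cl by auto
      ultimately show ?case by blast
    qed
    show "inverse (1 - t * r) \<in> R"
    proof (rule ccontr)
      assume "inverse (1 - t * r) \<notin> R"
      then obtain m a where a: "\<forall>i. a i \<in> R" "1 = t * (\<Sum>i\<le>m. a i * inverse v ^ i)"
        using rel[of "inverse v"] unfolding rel_def v_def by blast
      have "v ^ m = v ^ m * (t * (\<Sum>i\<le>m. a i * inverse v ^ i))"
        using a(2) by simp
      also have "\<dots> = t * (\<Sum>i\<le>m. a i * v ^ (m - i))"
        unfolding sum_distrib_left using v0[folded v_def]
        by (intro sum.cong) (auto simp: power_diff field_simps)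
      finally have "v ^ m = t * (\<Sum>i\<le>m. a i * v ^ (m - i))" .
      moreover obtain r' where "r' \<in> R" "v ^ m = 1 - t * r'" using vd by blast
      ultimately have "1 = t * ((\<Sum>i\<le>m. a i * v ^ (m - i)) + r')"
        by (simp add: algebra_simps)
      moreover have "(\<Sum>i\<le>m. a i * v ^ (m - i)) + r' \<in> R"
        using a r t \<open>r' \<in> R\<close> cl by (intro cl(5) subring_over_sum[OF R(1)]) (auto simp: v_def)
      ultimately show False using not1 by blast
    qed
  qed
  have lower: "rel g m" if r: "rel g (Suc m)" "rel (inverse g) (Suc m)" and "g \<noteq> 0" for g m
  proof -
    obtain a where a: "\<forall>i. a i \<in> R" "1 = t * (\<Sum>i\<le>Suc m. a i * g ^ i)"
      using r unfolding rel_def by blast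
    obtain b where b: "\<forall>i. b i \<in> R" "1 = t * (\<Sum>i\<le>Suc m. b i * inverse g ^ i)"
      using r unfolding rel_def by blast
    define v where "v = inverse (1 - t * b 0)"
    have v: "v \<in> R" using unit b by (auto simp: v_def)
    define M where "M = Suc m"
    \<comment> \<open>The constant term moves to the left, where \<open>unit\<close> inverts it. The
      relation for 1/g then begins at exponent 1, and multiplying it by the leading term of the
      relation for g replaces that term by lower powers of g.\<close>
    have "1 - t * b 0 = t * (\<Sum>i\<in>{1..M}. b i * inverse g ^ i)"
    proof -
      have "{..M} = insert 0 {1..M}" by auto
      then have "(\<Sum>i\<le>M. b i * inverse g ^ i) = b 0 + (\<Sum>i\<in>{1..M}. b i * inverse g ^ i)"
        by simp
      then show ?thesis using b(2) unfolding M_def by (simp add: algebra_simps)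
    qed
    moreover have "1 = v * (1 - t * b 0)"
      using unit(1)[of "b 0"] b(1) by (simp add: v_def)
    ultimately have v1: "1 = v * t * (\<Sum>i\<in>{1..M}. b i * inverse g ^ i)"
      by (simp only: mult.assoc)
    have "a M * g ^ M = a M * g ^ M * (v * t * (\<Sum>i\<in>{1..M}. b i * inverse g ^ i))"
      using v1 by simp
    also have "\<dots> = (\<Sum>i\<in>{1..M}. a M * v * t * b i * g ^ (M - i))"
      unfolding sum_distrib_left using \<open>g \<noteq> 0\<close>
      by (intro sum.cong) (auto simp: power_diff field_simps)
    also have "\<dots> = (\<Sum>i\<le>m. a M * v * t * b (M - i) * g ^ i)"
      by (rule sum.reindex_bij_witness[of _ "\<lambda>i. M - i" "\<lambda>i. M - i"]) (auto simp: M_def)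
    finally have "1 = t * ((\<Sum>i\<le>m. a i * g ^ i) + (\<Sum>i\<le>m. a M * v * t * b (M - i) * g ^ i))"
      using a(2) by (simp add: M_def)
    also have "\<dots> = t * (\<Sum>i\<le>m. (a i + a M * v * t * b (M - i)) * g ^ i)"
      by (simp add: sum.distrib[symmetric] distrib_right)
    finally have "1 = t * (\<Sum>i\<le>m. (a i + a M * v * t * b (M - i)) * g ^ i)" .
    moreover have "\<forall>i. a i + a M * v * t * b (M - i) \<in> R"
      using a b v t cl by auto
    ultimately show ?thesis unfolding rel_def
      by (intro exI[of _ "\<lambda>i. a i + a M * v * t * b (M - i)"]) auto
  qed
  have total: "g \<in> R \<or> inverse g \<in> R" for g
  proof (rule ccontr)
    assume *: "\<not> (g \<in> R \<or> inverse g \<in> R)"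
    then obtain k l where "rel g k" "rel (inverse g) l" using rel by blast
    then have "rel g (max k l) \<and> rel (inverse g) (max k l)" using pad by (meson max.cobounded1 max.cobounded2)
    moreover have "rel g m \<and> rel (inverse g) m \<Longrightarrow> False" for m
    proof (induction m)
      case 0
      then show ?case using not1 by (auto simp: rel_def)
    next
      case (Suc m)
      have "g \<noteq> 0" using * cl(1) by auto
      then show ?case using Suc lower[of g m] lower[of "inverse g" m] by auto
    qed
    ultimately show False by blast
  qed
  have "t \<notin> range emb"
  proof
    assume "t \<in> range emb"
    then obtain c where "t = emb c" by blast
    then have "u = emb (inverse c)" by (simp add: ut emb_inverse)
    then show False using R(1,3) by (auto simp: subring_over_def)
  qed
  then have "valuation_ring R"
    using R t total unfolding valuation_ring_def subring_over_def by blast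
  then show ?thesis using R by blast
qed

end

section \<open>The subfield K(x)\<close>

locale rational_function_field = field_ext emb
  for emb :: "'k::field \<Rightarrow> 'f::field" +
  fixes x :: 'f
  assumes x_transcendental: "transcendental x"
begin

definition px :: "'k poly \<Rightarrow> 'f" where "px p = poly (map_poly emb p) x"

lemma px_0 [simp]: "px 0 = 0" by (simp add: px_def)

lemma px_pCons: "px (pCons a p) = emb a + x * px p"
  by (simp add: px_def map_poly_pCons)

lemma px_const [simp]: "px [:a:] = emb a" by (simp add: px_pCons)

lemma px_1 [simp]: "px 1 = 1" by (simp add: one_pCons emb_1 px_pCons)

lemma px_X [simp]: "px [:0, 1:] = x" by (simp add: px_pCons emb_1)

lemma px_add: "px (p + s) = px p + px s"
  by (induction p s rule: poly_induct2) (auto simp: px_pCons emb_add algebra_simps)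

lemma px_smult: "px (smult a p) = emb a * px p"
  by (induction p) (auto simp: px_pCons emb_mult algebra_simps)

lemma px_mult: "px (p * s) = px p * px s"
  by (induction p) (auto simp: px_pCons px_add px_smult algebra_simps)

lemma px_uminus: "px (- p) = - px p"
  using px_add[of p "- p"] by (simp add: eq_neg_iff_add_eq_0 add.commute)

lemma px_diff: "px (p - s) = px p - px s"
  using px_add[of p "- s"] by (simp add: px_uminus)

lemma px_power: "px (p ^ i) = px p ^ i"
  by (induction i) (auto simp: px_mult)

lemma px_sum: "px (sum g I) = (\<Sum>i\<in>I. px (g i))"
  by (induction I rule: infinite_finite_induct) (auto simp: px_add)

lemma px_monom: "px (monom c i) = emb c * x ^ i"
  by (induction i) (auto simp: monom_0 monom_Suc px_pCons algebra_simps)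

lemma px_eq_0_iff [simp]: "px p = 0 \<longleftrightarrow> p = 0"
  using x_transcendental by (auto simp: px_def transcendental_def)

lemma px_inject: "px p = px s \<longleftrightarrow> p = s"
  using px_eq_0_iff[of "p - s"] by (simp add: px_diff)

lemma px_altdef: "px p = (\<Sum>i\<le>degree p. emb (coeff p i) * x ^ i)"
proof -
  have "px p = px (\<Sum>i\<le>degree p. monom (coeff p i) i)" by (simp add: poly_as_sum_of_monoms)
  then show ?thesis by (simp add: px_sum px_monom)
qed

lemma x_nonzero [simp]: "x \<noteq> 0"
  using px_eq_0_iff[of "[:0, 1:]"] px_X by auto

lemma x_diff_emb_nonzero: "x - emb a \<noteq> 0"
  using px_eq_0_iff[of "[:- a, 1:]"] by (auto simp: px_pCons emb_uminus emb_1)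

text \<open>\<open>phi\<close> identifies the abstract fraction field of K[X] with K(x).
  Interpreting \<open>field_ext\<close> with it makes F a vector space whose scalars form the type
  \<open>'k poly fract\<close>.\<close>

definition phi :: "'k poly fract \<Rightarrow> 'f" where
  "phi r = (THE v. \<exists>p s. s \<noteq> 0 \<and> r = Fract p s \<and> v = px p / px s)"

lemma phi_Fract: "s \<noteq> 0 \<Longrightarrow> phi (Fract p s) = px p / px s"
  unfolding phi_def
proof (rule the_equality)
  fix v assume s: "s \<noteq> 0" and "\<exists>p' s'. s' \<noteq> 0 \<and> Fract p s = Fract p' s' \<and> v = px p' / px s'"
  then obtain p' s' where *: "s' \<noteq> 0" "Fract p s = Fract p' s'" "v = px p' / px s'" by blast
  then have "px (p * s') = px (p' * s)" using s by (simp add: eq_fract)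
  then show "v = px p / px s" using s * by (simp add: px_mult frac_eq_eq)
qed auto

lemma phi_cases:
  obtains p s where "s \<noteq> 0" "c = Fract p s" "phi c = px p / px s"
  by (cases c) (use phi_Fract in auto)

lemma field_ext_phi: "field_ext phi"
proof
  show "phi 1 = 1" by (simp add: One_fract_def phi_Fract)
next
  fix a b :: "'k poly fract"
  obtain p s where a: "s \<noteq> 0" "a = Fract p s" by (cases a) auto
  obtain p' s' where b: "s' \<noteq> 0" "b = Fract p' s'" by (cases b) auto
  show "phi (a + b) = phi a + phi b"
    using a b by (simp add: phi_Fract px_add px_mult field_simps)
  show "phi (a * b) = phi a * phi b"
    using a b by (simp add: phi_Fract px_mult)
qed

sublocale K: field_ext phi by (rule field_ext_phi)

lemma emb_eq_phi: "emb c = phi (Fract [:c:] 1)"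
  by (simp add: phi_Fract)

lemma px_eq_phi: "px p = phi (Fract p 1)"
  by (simp add: phi_Fract)

lemma subring_px: "subring_over (range px)"
  unfolding subring_over_def
proof (intro conjI ballI)
  show "range emb \<subseteq> range px" using px_const by (metis image_subsetI rangeI)
  fix a b assume "a \<in> range px" "b \<in> range px"
  then show "a - b \<in> range px" "a * b \<in> range px"
    by (auto simp flip: px_diff px_mult)
qed

text \<open>x - a is no unit of K[x], so some valuation ring contains K[x] but not 1 / (x - a).
  \<open>laurent_coefficient\<close> uses it to test coefficients at points a other than 0.\<close>

lemma exists_place_over:
  "\<exists>R. valuation_ring R \<and> x \<in> R \<and> x - emb a \<in> max_ideal R"
proof -
  have "inverse (x - emb a) \<notin> range px"
  proof
    assume "inverse (x - emb a) \<in> range px"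
    then obtain p where "inverse (x - emb a) = px p" by blast
    then have "1 = px ([:- a, 1:] * p)"
      using x_diff_emb_nonzero[of a] by (simp only: px_mult) (simp add: px_pCons emb_uminus emb_1 field_simps)
    then have "[:- a, 1:] * p = 1" using px_inject[of "[:- a, 1:] * p" 1] by simp
    then show False using degree_mult_eq[of "[:- a, 1:]" p] by (cases "p = 0") auto
  qed
  moreover have "x - emb a \<in> range px"
    by (rule image_eqI[of _ _ "[:- a, 1:]"]) (auto simp: px_pCons emb_uminus emb_1)
  ultimately obtain R where R: "valuation_ring R" "range px \<subseteq> R" "inverse (x - emb a) \<notin> R"
    using exists_valuation_ring[OF subring_px, of "inverse (x - emb a)"] by auto
  interpret R: valuation_ring_in emb R by unfold_locales fact
  have "x \<in> R" using range_subsetD[OF R(2), of "[:0, 1:]"] by simp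
  then show ?thesis using R by (intro exI[of _ R]) (auto simp: R.mem_P_iff)
qed

end

locale rational_valuation_ring = rational_function_field emb x + valuation_ring_in emb R
  for emb :: "'k::field \<Rightarrow> 'f::field" and x R
begin

lemma px_in: "x \<in> R \<Longrightarrow> px p \<in> R"
  unfolding px_altdef by (intro sum_in mult_in emb_in power_in)

text \<open>Once the zero at a is split off, the cofactor s satisfies s(x) = s(a) + (x - a) r(x)
  with s(a) nonzero, which is a constant unit plus an element of P.\<close>

lemma px_order:
  assumes a: "x - emb a \<in> P" and p: "p \<noteq> 0"
  shows "px p / (x - emb a) ^ order a p \<in> units"
proof -
  have xR: "x \<in> R" using add_in[OF P_subset[OF a] emb_in[of a]] by simp
  have lin: "px [:- a, 1:] = x - emb a" by (simp add: px_pCons emb_uminus emb_1)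
  obtain s where s: "p = [:- a, 1:] ^ order a p * s" "\<not> [:- a, 1:] dvd s"
    using order_decomp[OF p] by blast
  obtain s' where "s - [:poly s a:] = [:- a, 1:] * s'"
    using poly_eq_0_iff_dvd[of "s - [:poly s a:]" a] by (auto elim: dvdE)
  then have "s = [:- a, 1:] * s' + [:poly s a:]" by (simp only: diff_eq_eq)
  then have "px s = px ([:- a, 1:] * s' + [:poly s a:])" by (rule arg_cong)
  then have "px s = emb (poly s a) + (x - emb a) * px s'"
    by (simp only: px_add px_mult lin px_const add.commute)
  moreover have "poly s a \<noteq> 0" using s(2) by (simp add: poly_eq_0_iff_dvd)
  ultimately have "px s \<in> units"
    using a px_in[OF xR] by (auto intro!: add_unit_P emb_unit mult_in_P)
  moreover have "px p = (x - emb a) ^ order a p * px s"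
    by (subst s(1)) (simp only: px_mult px_power lin)
  ultimately show ?thesis using x_diff_emb_nonzero[of a] by simp
qed

lemma px_degree:
  assumes x: "inverse x \<in> P" and p: "p \<noteq> 0"
  shows "px p / x ^ degree p \<in> units"
proof -
  have *: "x ^ i / x ^ degree p = inverse x ^ (degree p - i)" if "i < degree p" for i
    using that by (simp add: power_diff field_simps)
  have "px p = emb (lead_coeff p) * x ^ degree p + (\<Sum>i<degree p. emb (coeff p i) * x ^ i)"
    unfolding px_altdef by (simp flip: lessThan_Suc_atMost)
  then have "px p / x ^ degree p = emb (lead_coeff p) + (\<Sum>i<degree p. emb (coeff p i) * (x ^ i / x ^ degree p))"
    by (simp add: add_divide_distrib sum_divide_distrib)
  also have "(\<Sum>i<degree p. emb (coeff p i) * (x ^ i / x ^ degree p)) \<in> P"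
  proof -
    have "inverse x ^ (degree p - i) * emb (coeff p i) \<in> P" if "i < degree p" for i
      using that x by (intro mult_in_P power_in_P emb_in) auto
    then have "(\<Sum>i\<in>I. emb (coeff p i) * (x ^ i / x ^ degree p)) \<in> P" if "I \<subseteq> {..<degree p}" for I
      using that
    proof (induction I rule: infinite_finite_induct)
      case (insert j I)
      then have "j < degree p" by auto
      then have "emb (coeff p j) * (x ^ j / x ^ degree p) \<in> P"
        using \<open>\<And>i. i < degree p \<Longrightarrow> inverse x ^ (degree p - i) * emb (coeff p i) \<in> P\<close>[of j] *[of j]
        by (simp add: mult.commute)
      then show ?case using insert by (simp add: add_in_P)
    qed auto
    then show ?thesis by blast
  qed
  then have "emb (lead_coeff p) + (\<Sum>i<degree p. emb (coeff p i) * (x ^ i / x ^ degree p)) \<in> units"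
    using p by (intro add_unit_P emb_unit) auto
  finally show ?thesis .
qed

text \<open>The instances are \<open>x - a\<close> and \<open>1/x\<close>.\<close>

definition parameter :: "'f \<Rightarrow> bool" where
  "parameter t \<longleftrightarrow> t \<in> P \<and> t \<noteq> 0 \<and> (\<forall>p. p \<noteq> 0 \<longrightarrow> (\<exists>r::int. px p / t powi r \<in> units))"

lemma parameter_finite: "x - emb a \<in> P \<Longrightarrow> parameter (x - emb a)"
  using px_order[of a] x_diff_emb_nonzero[of a] unfolding parameter_def by (metis power_int_of_nat)

lemma parameter_infinite:
  assumes "inverse x \<in> P" shows "parameter (inverse x)"
proof -
  have "px p / inverse x powi (- int (degree p)) \<in> units" if "p \<noteq> 0" for p
    using px_degree[OF assms that] by (simp add: power_int_minus power_inverse)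
  then show ?thesis using assms unfolding parameter_def by auto
qed

lemma phi_parameter:
  assumes t: "parameter t" and c: "c \<noteq> 0"
  shows "\<exists>r::int. phi c / t powi r \<in> units"
proof -
  obtain p s where ps: "s \<noteq> 0" "c = Fract p s" "phi c = px p / px s" by (rule phi_cases)
  then have "p \<noteq> 0" using c by (auto simp: Zero_fract_def eq_fract)
  then obtain k l :: int where "px p / t powi k \<in> units" "px s / t powi l \<in> units"
    using t ps unfolding parameter_def by meson
  from divide_unit[OF this] show ?thesis
    unfolding ps(3) using t
    by (intro exI[of _ "k - l"]) (auto simp: parameter_def power_int_diff field_simps)
qed

text \<open>Every nonzero coefficient is a unit times a power of t, so the nonzero terms of a
  relation have pairwise different values and by \<open>dominant_term\<close> cannot sum to 0. This
  is the bound of the ramification index by the degree.\<close>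

lemma independent_if_inequivalent:
  assumes t: "parameter t" and W: "finite W" "0 \<notin> W"
    and ineq: "\<And>a b (r::int). a \<in> W \<Longrightarrow> b \<in> W \<Longrightarrow> a \<noteq> b \<Longrightarrow> t powi r * (a / b) \<notin> units"
  shows "\<not> K.vec.dependent W"
proof (rule K.vec.independent_if_scalars_zero[OF W(1)])
  fix f v assume sum0: "(\<Sum>v\<in>W. phi (f v) * v) = 0" and v: "v \<in> W"
  show "f v = 0"
  proof (rule ccontr)
    assume nz: "f v \<noteq> 0"
    define I where "I = {v\<in>W. f v \<noteq> 0}"
    have "\<exists>m\<in>I. (\<Sum>v\<in>I. phi (f v) * v) / (phi (f m) * m) \<in> units \<and>
       (\<forall>i\<in>I. phi (f i) * i / (phi (f m) * m) \<in> R)"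
    proof (rule dominant_term)
      fix a b assume ab: "a \<in> I" "b \<in> I" "a \<noteq> b"
      then obtain k l :: int where kl: "phi (f a) / t powi k \<in> units" "phi (f b) / t powi l \<in> units"
        using phi_parameter[OF t] unfolding I_def by blast
      have t0: "t \<noteq> 0" using t by (auto simp: parameter_def)
      have nz: "phi (f a) \<noteq> 0" "phi (f b) \<noteq> 0" "b \<noteq> 0" using ab W by (auto simp: I_def)
      show "phi (f a) * a / (phi (f b) * b) \<notin> units"
      proof
        assume "phi (f a) * a / (phi (f b) * b) \<in> units"
        from divide_unit[OF this divide_unit[OF kl]]
        have "t powi (k - l) * (a / b) \<in> units"
          using nz t0 by (simp add: power_int_diff field_simps)
        then show False using ineq ab by (auto simp: I_def)
      qed
    qed (use W v nz in \<open>auto simp: I_def\<close>)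
    moreover have "(\<Sum>v\<in>I. phi (f v) * v) = (\<Sum>v\<in>W. phi (f v) * v)"
      using W by (intro sum.mono_neutral_left) (auto simp: I_def)
    ultimately show False using sum0 unit_nonzero by auto
  qed
qed

end

text \<open>The polynomial is a product of linear factors; if no x - a lay in P, all of them would
  be units, and so would \<open>px p\<close>.\<close>

lemma (in rational_valuation_ring) exists_residue:
  assumes alg: "\<And>p :: 'k poly. degree p > 0 \<Longrightarrow> \<exists>a. poly p a = 0"
    and p: "p \<noteq> 0" "px p \<in> P" and xR: "x \<in> R"
  shows "\<exists>a. x - emb a \<in> P"
  using p
proof (induction "degree p" arbitrary: p)
  case 0
  then obtain c where "p = [:c:]" by (metis degree_0_id)
  then show ?case using 0 emb_unit[of c] P_notunit by auto
next
  case (Suc d)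
  then obtain a where "poly p a = 0" using alg[of p] by auto
  then obtain s where s: "p = [:- a, 1:] * s" by (auto simp: poly_eq_0_iff_dvd elim: dvdE)
  have eq: "px p = (x - emb a) * px s"
    unfolding s by (simp only: px_mult) (simp add: px_pCons emb_uminus emb_1)
  show ?case
  proof (cases "x - emb a \<in> P")
    case False
    then have "x - emb a \<in> units" using diff_in[OF xR emb_in] by (auto simp: units_iff)
    then have "px p * inverse (x - emb a) \<in> P"
      by (intro mult_in_P[OF Suc(4)]) (simp add: units_def)
    moreover have "px p * inverse (x - emb a) = px s"
      using x_diff_emb_nonzero[of a] unfolding eq by simp
    ultimately have "px s \<in> P" by simp
    moreover have "s \<noteq> 0" using Suc(3) s by auto
    moreover from this have "d = degree s" using Suc(2) unfolding s by (subst (asm) degree_mult_eq) auto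
    ultimately show ?thesis using Suc(1)[of s] by blast
  qed auto
qed

section \<open>The function field as a Kummer extension\<close>

sublocale gk_function_field \<subseteq> rational_function_field emb x
  by unfold_locales (rule x_transcendental)

text \<open>\<open>char\<close> records that the characteristic of K divides q; it yields the
  derivative -1 of \<open>F * H\<close> and n = 1 in K.\<close>

locale gk_setting = gk_function_field emb q x y z
  for emb :: "'k::alg_closed_field \<Rightarrow> 'f::field" and q x y z +
  fixes P0 Pinf :: "'f set"
  assumes q2: "q \<ge> 2" and char: "of_nat q = (0 :: 'k)"
    and P0: "is_P0 P0" and Pinf: "is_Pinf Pinf"
begin

definition N :: nat where "N = q\<^sup>2 - q + 1"
definition n :: nat where "n = q ^ 3 + 1"

lemma q_le_q2: "q \<le> q\<^sup>2"
  by (simp add: power2_eq_square)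

lemma n_eq: "n = (q + 1) * N"
proof -
  have "int n = int ((q + 1) * N)"
    using q_le_q2 by (simp add: n_def N_def of_nat_diff algebra_simps power2_eq_square power3_eq_cube)
  then show ?thesis by (simp only: of_nat_eq_iff)
qed

lemma N_pos: "N > 0" and n_pos: "n > 0"
  by (auto simp: N_def n_def)

definition F :: "'k poly" where "F = monom 1 q + monom 1 1"
definition H :: "'k poly" where "H = (\<Sum>i=0..q. monom ((-1) ^ (i + 1)) (i * (q - 1)))"

lemma y_power: "y ^ (q + 1) = px F"
  unfolding eq_y by (simp add: F_def px_add px_monom emb_1)

lemma z_power_N: "z ^ N = y * px H"
  unfolding N_def eq_z H_def by (simp add: px_sum px_monom emb_power emb_uminus emb_1)

lemma z_power_n: "z ^ n = px (F * H ^ (q + 1))"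
proof -
  have "z ^ n = (z ^ N) ^ (q + 1)" unfolding n_eq by (metis power_mult mult.commute)
  also have "\<dots> = y ^ (q + 1) * px H ^ (q + 1)" by (simp only: z_power_N power_mult_distrib)
  finally show ?thesis by (simp only: y_power px_mult px_power)
qed

text \<open>With U = - X^(q-1), F is X (1 - U) and H is minus a geometric sum in U, so the product
  telescopes.\<close>

lemma F_mult_H: "F * H = monom ((-1) ^ (q + 1)) (q\<^sup>2) - monom 1 1"
proof -
  define U :: "'k poly" where "U = - monom 1 (q - 1)"
  have F': "F = monom 1 1 * (1 - U)"
    using q2 by (simp add: F_def U_def algebra_simps mult_monom)
  have Ui: "U ^ i = monom ((-1) ^ i) (i * (q - 1))" for i
    by (induction i) (auto simp: U_def one_pCons monom_0 mult_monom minus_monom add.commute)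
  have H': "H = - (\<Sum>i\<le>q. U ^ i)"
    unfolding H_def Ui by (simp add: sum_negf atLeast0AtMost flip: minus_monom)
  have "F * H = - monom 1 1 * ((1 - U) * (\<Sum>i\<le>q. U ^ i))"
    unfolding F' H' by simp
  also have "(1 - U) * (\<Sum>i\<le>q. U ^ i) = 1 - U ^ Suc q" by (rule sum_gp_basic)
  also have "- monom 1 1 * (1 - U ^ Suc q) = monom 1 1 * U ^ (q + 1) - monom 1 1"
    by (simp add: algebra_simps)
  also have "monom 1 1 * U ^ (q + 1) = monom ((-1) ^ (q + 1)) (1 + (q + 1) * (q - 1))"
    unfolding Ui by (simp add: mult_monom)
  also have "1 + (q + 1) * (q - 1) = q\<^sup>2"
    using q2 by (cases q) (auto simp: power2_eq_square algebra_simps)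
  finally show ?thesis .
qed

lemma degree_FH: "degree (F * H) = q\<^sup>2"
proof -
  have "q\<^sup>2 > 1" using q2 q_le_q2 by linarith
  have "degree (monom ((-1) ^ (q + 1)) (q\<^sup>2) + (- monom 1 1) :: 'k poly) = degree (monom ((-1) ^ (q + 1)) (q\<^sup>2) :: 'k poly)"
    using \<open>q\<^sup>2 > 1\<close> by (intro degree_add_eq_left) (auto simp: degree_monom_eq)
  then show ?thesis unfolding F_mult_H by (simp add: degree_monom_eq)
qed

lemma FH_nonzero: "F \<noteq> 0" "H \<noteq> 0" "F * H \<noteq> 0"
  using degree_FH q2 by auto

lemma degree_F: "degree F = q"
proof -
  have "degree F = degree (monom 1 q :: 'k poly)"
    unfolding F_def using q2 by (intro degree_add_eq_left) (auto simp: degree_monom_eq)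
  then show ?thesis by (simp add: degree_monom_eq)
qed

lemma degree_H: "degree H + q = q\<^sup>2"
  using degree_FH degree_mult_eq[OF FH_nonzero(1,2)] degree_F by simp

lemma pderiv_FH: "pderiv (F * H) = - 1"
  unfolding F_mult_H using char by (simp add: pderiv_diff pderiv_monom of_nat_power q2 one_pCons monom_0)

text \<open>A double root of \<open>F * H\<close> would be a root of its derivative -1. So F and H
  have simple roots and none in common.\<close>

lemma order_FH: "order a F + order a H \<le> 1"
proof -
  have "order a (F * H) < 2"
  proof (rule ccontr)
    assume "\<not> order a (F * H) < 2"
    then have "[:- a, 1:] ^ 2 dvd F * H"
      by (intro power_le_dvd[OF order_1]) auto
    then obtain s where "F * H = [:- a, 1:] ^ 2 * s" by (rule dvdE)
    then have "F * H = [:- a, 1:] * ([:- a, 1:] * s)" by (simp only: power2_eq_square mult.assoc)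
    then have "pderiv (F * H) = [:- a, 1:] * pderiv ([:- a, 1:] * s) + [:- a, 1:] * s * pderiv [:- a, 1:]"
      by (simp only: pderiv_mult)
    also have "\<dots> = [:- a, 1:] * (pderiv ([:- a, 1:] * s) + s * pderiv [:- a, 1:])"
      by (simp only: distrib_left mult.assoc)
    finally have "[:- a, 1:] dvd (- 1 :: 'k poly)" unfolding pderiv_FH by (rule dvdI)
    then show False using dvd_imp_degree_le[of "[:- a, 1:]" "- 1"] by simp
  qed
  then show ?thesis using order_mult[OF FH_nonzero(3)] by simp
qed

lemma order_0_F: "order 0 F = 1" and order_0_H: "order 0 H = 0"
proof -
  have "poly F 0 = 0" using q2 by (simp add: F_def poly_monom)
  then have "order 0 F \<noteq> 0" using order_root[of F 0] FH_nonzero by simp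
  then show "order 0 F = 1" "order 0 H = 0" using order_FH[of 0] by auto
qed

lemma nonzero [simp]: "y \<noteq> 0" "z \<noteq> 0"
proof -
  have "z ^ n \<noteq> 0" unfolding z_power_n using FH_nonzero by simp
  then show "z \<noteq> 0" using n_pos by (auto simp: power_0_left)
  have "y ^ (q + 1) \<noteq> 0" unfolding y_power using FH_nonzero by simp
  then show "y \<noteq> 0" by auto
qed

lemma poly_root_exists: "degree (p :: 'k poly) > 0 \<Longrightarrow> \<exists>a. poly p a = 0"
  by (rule alg_closed_imp_poly_has_root)

end

locale gk_place = gk_setting emb q x y z P0 Pinf + valuation_ring_in emb R
  for emb :: "'k::alg_closed_field \<Rightarrow> 'f::field" and q x y z P0 Pinf R
begin

sublocale rational_valuation_ring emb x R by unfold_locales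

lemma y_in: "x \<in> R \<Longrightarrow> y \<in> R"
proof (rule ccontr)
  assume x: "x \<in> R" and "y \<notin> R"
  then have "inverse y \<in> P" by (simp add: mem_P_iff)
  then have "inverse y ^ (q + 1) * px F \<in> P"
    using px_in[OF x] by (intro mult_in_P power_in_P) auto
  then have "(inverse y * y) ^ (q + 1) \<in> P" by (simp only: y_power power_mult_distrib)
  then show False by simp
qed

lemma z_in: "x \<in> R \<Longrightarrow> z \<in> R"
proof (rule ccontr)
  assume x: "x \<in> R" and "z \<notin> R"
  then have "inverse z \<in> P" by (simp add: mem_P_iff)
  then have "inverse z ^ N * (y * px H) \<in> P"
    using px_in[OF x] y_in[OF x] N_pos by (intro mult_in_P power_in_P mult_in) auto
  then show False unfolding z_power_N[symmetric] by (simp flip: power_mult_distrib)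
qed

lemma x_power_unit: "x \<in> P \<Longrightarrow> x powi r \<in> units \<Longrightarrow> r = 0"
proof (rule ccontr)
  assume x: "x \<in> P" and r: "x powi r \<in> units" "r \<noteq> 0"
  have "x ^ nat \<bar>r\<bar> \<in> P" using x r by (intro power_in_P) auto
  moreover have "x ^ nat \<bar>r\<bar> \<in> units"
    using r inverse_unit[of "x powi r"] by (cases "r \<ge> 0") (auto simp: power_int_def power_inverse)
  ultimately show False by (simp add: P_notunit)
qed

text \<open>At x = 0 the element z^n is x times a unit. Hence the n-th power of the given element is
  a unit times x^(r n + i - j), and this exponent is not 0 because 0 < |i - j| < n.\<close>

lemma powers_inequivalent:
  assumes x: "x \<in> P" and ij: "i < n" "j < n" "i \<noteq> j"
  shows "x powi r * (z ^ i / z ^ j) \<notin> units"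
proof
  assume u: "x powi r * (z ^ i / z ^ j) \<in> units"
  define v where "v = z ^ n / x"
  have "px (F * H ^ (q + 1)) / (x - emb 0) ^ order 0 (F * H ^ (q + 1)) \<in> units"
    using x FH_nonzero by (intro px_order) auto
  moreover have "order 0 (H ^ i) = 0" for i
    using FH_nonzero order_0_H by (induction i) (auto simp: order_mult)
  then have "order 0 (F * H ^ (q + 1)) = 1"
    using FH_nonzero by (simp add: order_mult order_0_F order_0_H del: power_Suc)
  ultimately have v: "v \<in> units" by (simp add: v_def z_power_n)
  have zn: "z ^ n = x * v" by (simp add: v_def)
  have "(x powi r * (z ^ i / z ^ j)) ^ n = x powi (r * int n) * ((z ^ n) ^ i / (z ^ n) ^ j)"
    by (simp add: power_mult_distrib power_divide power_int_mult flip: power_mult) (simp add: mult.commute)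
  also have "\<dots> = x powi (r * int n + int i - int j) * (v ^ i / v ^ j)"
    unfolding zn by (simp add: power_mult_distrib power_int_add power_int_diff)
  finally have "x powi (r * int n + int i - int j) * (v ^ i / v ^ j) \<in> units"
    using power_unit[OF u, of n] by simp
  then have "x powi (r * int n + int i - int j) * (v ^ i / v ^ j) / (v ^ i / v ^ j) \<in> units"
    using v by (intro divide_unit power_unit)
  then have "x powi (r * int n + int i - int j) \<in> units"
    using unit_nonzero[OF v] by simp
  then have *: "r * int n + int i - int j = 0" by (rule x_power_unit[OF x])
  then have "int j - int i = r * int n" by linarith
  then have "int n dvd int j - int i" by simp
  moreover have "\<bar>int j - int i\<bar> < int n" "int j - int i \<noteq> 0" using ij by linarith+
  ultimately show False using dvd_imp_le_int[of "int j - int i" "int n"] by linarith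
qed

end

context gk_setting
begin

definition basis :: "'f set" where "basis = (\<lambda>m. z ^ m) ` {..<n}"

text \<open>Total ramification at \<open>P0\<close> stands in for an irreducibility proof: elements
  inequivalent modulo powers of x are independent over K(x).\<close>

lemma inj_basis: "inj_on (\<lambda>m. z ^ m) {..<n}"
  and independent_basis: "\<not> K.vec.dependent basis"
proof -
  obtain R where R0: "valuation_ring R" "P0 = max_ideal R"
    using P0 by (auto simp: is_P0_def places_def)
  interpret gk_place emb q x y z P0 Pinf R by unfold_locales fact
  have x: "x \<in> P" using P0 R0(2) by (auto simp: is_P0_def)
  have ineq: "x powi r * (z ^ i / z ^ j) \<notin> units" if "i < n" "j < n" "i \<noteq> j" for i j r
    using powers_inequivalent[OF x that] .
  show inj: "inj_on (\<lambda>m. z ^ m) {..<n}"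
  proof (rule inj_onI, rule ccontr)
    fix i j assume "i \<in> {..<n}" "j \<in> {..<n}" "z ^ i = z ^ j" "i \<noteq> j"
    then show False using ineq[of i j 0] by simp
  qed
  have par: "parameter x" using parameter_finite[of 0] x by simp
  show "\<not> K.vec.dependent basis"
  proof (rule independent_if_inequivalent[OF par])
    fix a b and r :: int assume "a \<in> basis" "b \<in> basis" "a \<noteq> b"
    then obtain i j where "i < n" "j < n" "i \<noteq> j" "a = z ^ i" "b = z ^ j"
      unfolding basis_def by blast
    then show "x powi r * (a / b) \<notin> units" using ineq by blast
  qed (auto simp: basis_def)
qed

lemma card_basis: "card basis = n" and finite_basis: "finite basis"
  unfolding basis_def by (auto simp: card_image[OF inj_basis])

lemma power_in_span: "z ^ k \<in> K.vec.span basis"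
proof -
  have e: "(z ^ n) ^ i = phi (Fract ((F * H ^ (q + 1)) ^ i) 1)" for i
    unfolding px_eq_phi[symmetric] px_power z_power_n ..
  have "z ^ k = (z ^ n) ^ (k div n) * z ^ (k mod n)"
    by (simp flip: power_mult power_add)
  then have zk: "z ^ k = phi (Fract ((F * H ^ (q + 1)) ^ (k div n)) 1) * z ^ (k mod n)"
    unfolding e .
  have "z ^ (k mod n) \<in> basis" using n_pos by (auto simp: basis_def)
  then show ?thesis by (subst zk) (intro K.vec.span_scale K.vec.span_base)
qed

lemma span_mult:
  assumes "a \<in> K.vec.span basis" "b \<in> K.vec.span basis"
  shows "a * b \<in> K.vec.span basis"
  using assms(1)
proof (induction rule: K.vec.span_induct_alt)
  case (step c v w)
  then obtain i where i: "v = z ^ i" by (auto simp: basis_def)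
  have "v * b \<in> K.vec.span basis"
    using assms(2)
  proof (induction rule: K.vec.span_induct_alt)
    case (step c' v' w')
    then obtain j where "v' = z ^ j" by (auto simp: basis_def)
    then have "v * (phi c' * v' + w') = phi c' * z ^ (i + j) + v * w'"
      by (simp add: i power_add algebra_simps)
    then show ?case using step by (simp add: K.vec.span_add K.vec.span_scale power_in_span)
  qed (simp add: K.vec.span_zero)
  then have "phi c * (v * b) + w * b \<in> K.vec.span basis"
    using step by (intro K.vec.span_add K.vec.span_scale)
  then show ?case by (simp add: algebra_simps)
qed (simp add: K.vec.span_zero)

text \<open>Multiplication by a carries the basis to an independent set of the same size inside the
  span, hence to another basis of it; so 1 is a times an element of the span.\<close>

lemma span_inverse:
  assumes a: "a \<in> K.vec.span basis" "a \<noteq> 0"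
  shows "inverse a \<in> K.vec.span basis"
proof -
  define B where "B = (\<lambda>b. a * b) ` basis"
  have inj: "inj_on (\<lambda>b. a * b) basis" using a by (auto simp: inj_on_def)
  have B: "finite B" "card B = card basis"
    using finite_basis by (auto simp: B_def card_image[OF inj])
  have "\<not> K.vec.dependent B"
  proof (rule K.vec.independent_if_scalars_zero[OF B(1)])
    fix f v assume *: "(\<Sum>v\<in>B. phi (f v) * v) = 0" and v: "v \<in> B"
    have "(\<Sum>v\<in>B. phi (f v) * v) = a * (\<Sum>b\<in>basis. phi (f (a * b)) * b)"
      unfolding B_def sum.reindex[OF inj] sum_distrib_left by (intro sum.cong) auto
    then have "(\<Sum>b\<in>basis. phi (f (a * b)) * b) = 0" using * a by simp
    then have "\<forall>b\<in>basis. f (a * b) = 0"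
      using independent_basis K.vec.independentD[OF independent_basis finite_basis subset_refl, of "\<lambda>b. f (a * b)"]
      by blast
    then show "f v = 0" using v by (auto simp: B_def)
  qed
  moreover have "B \<subseteq> K.vec.span basis"
    by (auto simp: B_def intro: span_mult[OF a(1) K.vec.span_base])
  ultimately have "b \<in> K.vec.span B" if "b \<in> basis" for b
  proof (rule_tac ccontr)
    assume ind: "\<not> K.vec.dependent B" and sub: "B \<subseteq> K.vec.span basis" and "b \<notin> K.vec.span B"
    then have "\<not> K.vec.dependent (insert b B)" by (intro K.vec.independent_insertI)
    then have "card (insert b B) \<le> card basis"
      using K.vec.independent_span_bound[OF finite_basis, of "insert b B"] sub that K.vec.span_base by blast
    moreover have "b \<notin> B" using \<open>b \<notin> K.vec.span B\<close> K.vec.span_base by blast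
    ultimately show False using B by simp
  qed
  then have "K.vec.span basis \<subseteq> K.vec.span B"
    by (intro K.vec.span_minimal K.vec.subspace_span) blast
  moreover have "1 \<in> K.vec.span basis" using power_in_span[of 0] by simp
  ultimately have "1 \<in> K.vec.span B" by blast
  moreover have "inverse a * v \<in> K.vec.span basis" if "v \<in> K.vec.span B" for v
    using that
  proof (induction rule: K.vec.span_induct_alt)
    case (step c v w)
    then obtain b where "b \<in> basis" "v = a * b" by (auto simp: B_def)
    then have "inverse a * v \<in> basis" using a by (simp add: mult.assoc[symmetric])
    then have "phi c * (inverse a * v) + inverse a * w \<in> K.vec.span basis"
      using step by (intro K.vec.span_add K.vec.span_scale[OF K.vec.span_base])
    then show ?case by (simp add: algebra_simps)
  qed (simp add: K.vec.span_zero)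
  ultimately show ?thesis by fastforce
qed

text \<open>Since y is z^N / H(x), the span of the powers of z contains all three generators, and it
  is closed under the field operations.\<close>

lemma span_basis: "K.vec.span basis = UNIV"
proof -
  have phi_in: "phi c \<in> K.vec.span basis" for c
    using K.vec.span_scale[OF power_in_span[of 0], of c] by simp
  have y: "y = phi (Fract 1 H) * z ^ N"
    using FH_nonzero by (simp add: phi_Fract z_power_N)
  have "f \<in> K.vec.span basis" if "f \<in> adjoin {x, y, z}" for f
    using that
  proof (induction rule: adjoin.induct)
    case (const c)
    show ?case by (subst emb_eq_phi) (rule phi_in)
  next
    case (gen s)
    have "x \<in> K.vec.span basis" using phi_in[of "Fract [:0, 1:] 1"] by (simp add: phi_Fract)
    moreover have "y \<in> K.vec.span basis"
      by (subst y) (intro K.vec.span_scale power_in_span)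
    moreover have "z \<in> K.vec.span basis" using power_in_span[of 1] by simp
    ultimately show ?case using gen by blast
  next
    case (inverse a)
    then show ?case using span_inverse by (cases "a = 0") (auto simp: K.vec.span_zero)
  qed (auto intro: K.vec.span_add K.vec.span_neg span_mult)
  then show ?thesis using generated by blast
qed

lemma coordinates: "\<exists>c. f = (\<Sum>m<n. phi (c m) * z ^ m)"
proof -
  have "f \<in> range (\<lambda>u. \<Sum>v\<in>basis. phi (u v) * v)"
    using K.vec.span_finite[OF finite_basis] span_basis by blast
  then obtain u where "f = (\<Sum>v\<in>basis. phi (u v) * v)" by blast
  then show ?thesis unfolding basis_def sum.reindex[OF inj_basis]
    by (intro exI[of _ "\<lambda>m. u (z ^ m)"]) simp
qed

lemma card_independent_le:
  "\<lbrakk>finite W; \<not> K.vec.dependent W\<rbrakk> \<Longrightarrow> card W \<le> n"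
  using K.vec.independent_span_bound[OF finite_basis, of W] span_basis card_basis by simp

end

context gk_place
begin

lemma discrete_if_parameter:
  assumes "parameter t"
  shows "\<exists>\<pi> e. discrete_valuation_ring emb R \<pi> \<and> 0 < e \<and> e \<le> n \<and> t / \<pi> ^ e \<in> units"
proof (rule discrete_if_bounded)
  fix W assume "finite W" "0 \<notin> W"
    "\<And>a b (r::int). a \<in> W \<Longrightarrow> b \<in> W \<Longrightarrow> a \<noteq> b \<Longrightarrow> t powi r * (a / b) \<notin> units"
  then show "card W \<le> n"
    by (intro card_independent_le independent_if_inequivalent[OF assms])
qed (use assms in \<open>auto simp: parameter_def\<close>)

text \<open>If all nonzero polynomials in x were units of R, then K(x) would lie in R; as z does
  too, R would be the whole field.\<close>

lemma not_all_px_units: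
  assumes xR: "x \<in> R" shows "\<exists>p. p \<noteq> 0 \<and> px p \<in> P"
proof (rule ccontr)
  assume *: "\<not> ?thesis"
  have phi_R: "phi c \<in> R" for c
  proof -
    obtain p s where "s \<noteq> 0" "phi c = px p / px s" by (rule phi_cases)
    then show ?thesis using * px_in[OF xR] units_iff[of "px s"]
      by (auto simp: divide_inverse units_def intro: mult_in)
  qed
  have "f \<in> R" for f
  proof -
    obtain c where "f = (\<Sum>m<n. phi (c m) * z ^ m)" using coordinates by blast
    then show ?thesis using phi_R z_in[OF xR] by (auto intro!: sum_in mult_in power_in)
  qed
  then show False using R by (auto simp: valuation_ring_def)
qed

lemma exists_residue_x: "x \<in> R \<Longrightarrow> \<exists>a. x - emb a \<in> P"
  using exists_residue[OF poly_root_exists] not_all_px_units by blast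

lemma discrete: "\<exists>\<pi>. discrete_valuation_ring emb R \<pi>"
proof (cases "x \<in> R")
  case True
  then show ?thesis using exists_residue_x discrete_if_parameter parameter_finite by blast
next
  case False
  then have "inverse x \<in> P" by (simp add: mem_P_iff)
  then show ?thesis using discrete_if_parameter parameter_infinite by blast
qed

end

section \<open>Values at the places\<close>

context gk_place
begin

text \<open>This value is a ramification index over K(x), and the degree n bounds it.\<close>

lemma val_parameter:
  assumes "parameter t" shows "0 < val P t" "val P t \<le> int n"
proof -
  obtain \<pi> e where e: "discrete_valuation_ring emb R \<pi>" "0 < e" "e \<le> n" "t / \<pi> ^ e \<in> units"
    using discrete_if_parameter[OF assms] by blast
  interpret D: discrete_valuation_ring emb R \<pi> by fact
  have "val P t = int e"
    using D.val_pi_mult[OF e(4), of "int e"] D.pi_nz by simp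
  then show "0 < val P t" "val P t \<le> int n" using e by auto
qed

end

locale gk_dvr = gk_setting emb q x y z P0 Pinf + discrete_valuation_ring emb R \<pi>
  for emb :: "'k::alg_closed_field \<Rightarrow> 'f::field" and q x y z P0 Pinf R \<pi>
begin

sublocale gk_place emb q x y z P0 Pinf R by unfold_locales

lemma val_px_finite:
  assumes "x - emb a \<in> P" "p \<noteq> 0"
  shows "val P (px p) = int (order a p) * val P (x - emb a)"
  using val_unit[OF px_order[OF assms]] assms x_diff_emb_nonzero[of a]
  by (simp add: val_divide val_power)

lemma val_px_infinite:
  assumes "inverse x \<in> P" "p \<noteq> 0"
  shows "val P (px p) = int (degree p) * val P x"
  using val_unit[OF px_degree[OF assms]] assms by (simp add: val_divide val_power)

lemma val_y: "int (q + 1) * val P y = val P (px F)"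
  using val_power[of y "q + 1"] unfolding y_power by simp

lemma val_z: "int n * val P z = val P (px F) + int (q + 1) * val P (px H)"
  using val_power[of z n] FH_nonzero unfolding z_power_n px_mult px_power
  by (simp add: val_mult val_power del: power_Suc)

text \<open>Since z^n has a simple zero at x = 0, n v(z) = v(x); with 0 < v(x) \<le> n this leaves
  only v(z) = 1.\<close>

lemma
  assumes x: "x \<in> P"
  shows val_x_zero: "val P x = int n" and val_z_zero: "val P z = 1" and val_y_zero: "val P y = int N"
proof -
  have "x - emb 0 \<in> P" using x by simp
  note v = val_px_finite[OF this]
  have F: "val P (px F) = val P x" and H: "val P (px H) = 0"
    using v[OF FH_nonzero(1)] v[OF FH_nonzero(2)] order_0_F order_0_H by auto
  have x1: "0 < val P x" "val P x \<le> int n"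
    using val_parameter[OF parameter_finite[of 0]] x by auto
  have nz: "int n * val P z = val P x" using val_z F H by simp
  then have "val P z > 0" using x1 n_pos by (metis mult_le_0_iff not_less of_nat_0_le_iff)
  moreover have "val P z \<le> 1" using nz x1 n_pos
    by (metis mult.right_neutral mult_le_cancel_left_pos of_nat_0_less_iff)
  ultimately show z: "val P z = 1" by simp
  then show "val P x = int n" using nz by simp
  then have "int (q + 1) * val P y = int (q + 1) * int N" using val_y F n_eq by (simp add: algebra_simps)
  then show "val P y = int N" by simp
qed

text \<open>With e = v(1/x), comparing values in the equation for z^n gives n v(z) = - e q^3. As n =
  q^3 + 1 is coprime to q^3, n divides e, and 0 < e \<le> n forces e = n.\<close>

lemma
  assumes x: "x \<notin> R"
  shows val_x_inf: "val P x = - int n" and val_z_inf: "val P z = - (int q ^ 3)"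
    and val_y_inf: "val P y = - (int q * int N)"
proof -
  have ix: "inverse x \<in> P" using x by (simp add: mem_P_iff)
  define e where "e = val P (inverse x)"
  have e: "0 < e" "e \<le> int n" and vx: "val P x = - e"
    using val_parameter[OF parameter_infinite[OF ix]] by (auto simp: e_def val_inverse)
  have F: "val P (px F) = - e * int q" and H: "val P (px H) = - e * (int q ^ 2 - int q)"
    using val_px_infinite[OF ix FH_nonzero(1)] val_px_infinite[OF ix FH_nonzero(2)] vx degree_F degree_H
    by (auto simp flip: of_nat_power)
  have nz: "int n * val P z = - (e * int q ^ 3)"
    unfolding val_z F H by (simp add: algebra_simps power2_eq_square power3_eq_cube)
  have "coprime (int n) (int q ^ 3)"
    using coprime_add_one_left[of "int q ^ 3"] by (simp only: n_def of_nat_add of_nat_power of_nat_1)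
  moreover have "int n dvd e * int q ^ 3" by (metis nz dvd_minus_iff dvd_triv_left)
  ultimately have "int n dvd e" by (simp add: coprime_dvd_mult_left_iff)
  then have en: "e = int n" using e by (meson dvd_imp_le_int zdvd_imp_le antisym)
  then show "val P x = - int n" using vx by simp
  have "int n * val P z = int n * - (int q ^ 3)" using nz unfolding en by simp
  then show "val P z = - (int q ^ 3)" using n_pos by (simp only: mult_cancel_left) simp
  have "int (q + 1) * val P y = int (q + 1) * (- (int q * int N))"
    using val_y unfolding F en n_eq by (simp add: algebra_simps)
  then show "val P y = - (int q * int N)" by (simp only: mult_cancel_left) simp
qed

text \<open>The values of the coefficients are multiples of n and v(z) is prime to n, so the terms
  have values distinct modulo n. Nothing cancels, and the sum is integral only if every term
  is.\<close>

lemma terms_in: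
  assumes dvd: "\<And>c. c \<noteq> 0 \<Longrightarrow> int n dvd val P (phi c)" and cop: "coprime (val P z) (int n)"
    and f: "(\<Sum>m<n. phi (c m) * z ^ m) \<in> R" and m: "m < n"
  shows "phi (c m) * z ^ m \<in> R"
proof (cases "c m = 0")
  case False
  define I where "I = {m. m < n \<and> c m \<noteq> 0}"
  have eq: "(\<Sum>m<n. phi (c m) * z ^ m) = (\<Sum>m\<in>I. phi (c m) * z ^ m)"
    unfolding I_def by (rule sum.mono_neutral_right) auto
  have v: "val P (phi (c m) * z ^ m) = val P (phi (c m)) + int m * val P z" if "m \<in> I" for m
    using that by (simp add: I_def val_mult val_power)
  have "inj_on (\<lambda>m. val P (phi (c m) * z ^ m)) I"
  proof (rule inj_onI, rule ccontr)
    fix i j assume ij: "i \<in> I" "j \<in> I" "i \<noteq> j"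
      and "val P (phi (c i) * z ^ i) = val P (phi (c j) * z ^ j)"
    then have "(int i - int j) * val P z = val P (phi (c j)) - val P (phi (c i))"
      using v by (simp add: algebra_simps)
    then have "int n dvd (int i - int j) * val P z"
      using dvd ij by (simp add: I_def)
    then have "int n dvd int i - int j" using cop by (simp add: coprime_commute coprime_dvd_mult_left_iff)
    moreover have "\<bar>int i - int j\<bar> < int n" "int i - int j \<noteq> 0" using ij by (auto simp: I_def)
    ultimately show False using dvd_imp_le_int[of "int i - int j" "int n"] by linarith
  qed
  then obtain k where k: "k \<in> I" "(\<Sum>m\<in>I. phi (c m) * z ^ m) \<noteq> 0"
    "val P (\<Sum>m\<in>I. phi (c m) * z ^ m) = val P (phi (c k) * z ^ k)"
    "\<forall>i\<in>I. val P (phi (c k) * z ^ k) \<le> val P (phi (c i) * z ^ i)"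
    using val_sum[of I "\<lambda>m. phi (c m) * z ^ m"] False m by (fastforce simp: I_def)
  then have "val P (phi (c m) * z ^ m) \<ge> 0"
    using f False m val_nonneg_iff[OF k(2)] unfolding eq by (force simp: I_def)
  then show ?thesis using val_nonneg_iff[of "phi (c m) * z ^ m"] False by simp
qed auto

end

section \<open>The only zero and the only pole of x\<close>

context gk_setting
begin

text \<open>By \<open>terms_in\<close>, membership in R is decided by the values of the terms, which
  depend only on the values on K(x) and at z. Applied both ways, this identifies two rings with the
  same data.\<close>

lemma ring_subset_if_terms:
  assumes R: "valuation_ring R" "valuation_ring R'"
    and dvd: "\<And>c. c \<noteq> 0 \<Longrightarrow> int n dvd val (max_ideal R) (phi c)"
    and cop: "coprime (val (max_ideal R) z) (int n)"
    and eq: "\<And>c. c \<noteq> 0 \<Longrightarrow> val (max_ideal R) (phi c) = val (max_ideal R') (phi c)"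
      "val (max_ideal R) z = val (max_ideal R') z"
  shows "R \<subseteq> R'"
proof
  fix f assume f: "f \<in> R"
  interpret A: gk_place emb q x y z P0 Pinf R by unfold_locales fact
  interpret B: gk_place emb q x y z P0 Pinf R' by unfold_locales fact
  obtain \<pi> \<pi>' where "discrete_valuation_ring emb R \<pi>" "discrete_valuation_ring emb R' \<pi>'"
    using A.discrete B.discrete by blast
  then interpret A: gk_dvr emb q x y z P0 Pinf R \<pi> + B: gk_dvr emb q x y z P0 Pinf R' \<pi>'
    by (simp_all add: gk_dvr_def gk_setting_axioms)
  obtain c where c: "f = (\<Sum>m<n. phi (c m) * z ^ m)" using coordinates by blast
  have "phi (c m) * z ^ m \<in> R'" if m: "m < n" for m
  proof (cases "c m = 0")
    case False
    have "phi (c m) * z ^ m \<in> R"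
      using A.terms_in[OF dvd cop f[unfolded c] m] by blast
    then have "0 \<le> val A.P (phi (c m) * z ^ m)"
      using False A.val_nonneg_iff[of "phi (c m) * z ^ m"] by simp
    also have "\<dots> = val B.P (phi (c m) * z ^ m)"
      using False eq by (simp add: A.val_mult A.val_power B.val_mult B.val_power)
    finally show ?thesis using False B.val_nonneg_iff[of "phi (c m) * z ^ m"] by simp
  qed auto
  then show "f \<in> R'" unfolding c by (intro B.sum_in) auto
qed

lemma ring_subset_zero:
  assumes R: "valuation_ring R" "valuation_ring R'" and x: "x \<in> max_ideal R" "x \<in> max_ideal R'"
  shows "R \<subseteq> R'"
proof -
  have vals: "val (max_ideal R) (px p / px s) = int n * (int (order 0 p) - int (order 0 s))"
      "val (max_ideal R) z = 1"
    if R: "valuation_ring R" and x: "x \<in> max_ideal R" and ps: "s \<noteq> 0" "p \<noteq> 0" for R s p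
  proof -
    interpret A: gk_place emb q x y z P0 Pinf R by unfold_locales fact
    obtain \<pi> where "discrete_valuation_ring emb R \<pi>" using A.discrete by blast
    then interpret A: gk_dvr emb q x y z P0 Pinf R \<pi> by (simp add: gk_dvr_def gk_setting_axioms)
    have "x - emb 0 \<in> A.P" using x by simp
    from A.val_px_finite[OF this ps(1)] A.val_px_finite[OF this ps(2)]
    show "val (max_ideal R) (px p / px s) = int n * (int (order 0 p) - int (order 0 s))"
      using ps A.val_x_zero[OF x] by (simp add: A.val_divide algebra_simps)
    show "val (max_ideal R) z = 1" using A.val_z_zero[OF x] .
  qed
  show ?thesis
  proof (rule ring_subset_if_terms[OF R])
    fix c :: "'k poly fract" assume "c \<noteq> 0"
    obtain p s where ps: "s \<noteq> 0" "c = Fract p s" "phi c = px p / px s" by (rule phi_cases)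
    then have "p \<noteq> 0" using \<open>c \<noteq> 0\<close> by (auto simp: Zero_fract_def eq_fract)
    then show "int n dvd val (max_ideal R) (phi c)" "val (max_ideal R) (phi c) = val (max_ideal R') (phi c)"
      using vals(1)[OF R(1) x(1) ps(1)] vals(1)[OF R(2) x(2) ps(1)] ps by auto
  qed (use vals(2)[OF R(1) x(1), of 1 1] vals(2)[OF R(2) x(2), of 1 1] in auto)
qed

lemma ring_subset_inf:
  assumes R: "valuation_ring R" "valuation_ring R'" and x: "x \<notin> R" "x \<notin> R'"
  shows "R \<subseteq> R'"
proof -
  have vals: "val (max_ideal R) (px p / px s) = int n * (int (degree s) - int (degree p))"
      "val (max_ideal R) z = - (int q ^ 3)"
    if R: "valuation_ring R" and x: "x \<notin> R" and ps: "s \<noteq> 0" "p \<noteq> 0" for R s p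
  proof -
    interpret A: gk_place emb q x y z P0 Pinf R by unfold_locales fact
    obtain \<pi> where "discrete_valuation_ring emb R \<pi>" using A.discrete by blast
    then interpret A: gk_dvr emb q x y z P0 Pinf R \<pi> by (simp add: gk_dvr_def gk_setting_axioms)
    have "inverse x \<in> A.P" using x by (simp add: A.mem_P_iff)
    from A.val_px_infinite[OF this ps(1)] A.val_px_infinite[OF this ps(2)]
    show "val (max_ideal R) (px p / px s) = int n * (int (degree s) - int (degree p))"
      using ps A.val_x_inf[OF x] by (simp add: A.val_divide algebra_simps)
    show "val (max_ideal R) z = - (int q ^ 3)" using A.val_z_inf[OF x] .
  qed
  show ?thesis
  proof (rule ring_subset_if_terms[OF R])
    fix c :: "'k poly fract" assume "c \<noteq> 0"
    obtain p s where ps: "s \<noteq> 0" "c = Fract p s" "phi c = px p / px s" by (rule phi_cases)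
    then have "p \<noteq> 0" using \<open>c \<noteq> 0\<close> by (auto simp: Zero_fract_def eq_fract)
    then show "int n dvd val (max_ideal R) (phi c)" "val (max_ideal R) (phi c) = val (max_ideal R') (phi c)"
      using vals(1)[OF R(1) x(1) ps(1)] vals(1)[OF R(2) x(2) ps(1)] ps by auto
  next
    have "coprime (int q ^ 3) (int n)"
      using coprime_add_one_right[of "int q ^ 3"] by (simp only: n_def of_nat_add of_nat_power of_nat_1)
    then show "coprime (val (max_ideal R) z) (int n)"
      using vals(2)[OF R(1) x(1), of 1 1] by simp
  qed (use vals(2)[OF R(1) x(1), of 1 1] vals(2)[OF R(2) x(2), of 1 1] in auto)
qed

lemma ring_P0: "valuation_ring (ring_at P0)" "max_ideal (ring_at P0) = P0" "x \<in> P0"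
  and ring_Pinf: "valuation_ring (ring_at Pinf)" "max_ideal (ring_at Pinf) = Pinf" "x \<notin> ring_at Pinf"
proof -
  have *: "valuation_ring (ring_at Q) \<and> max_ideal (ring_at Q) = Q" if Q: "Q \<in> places" for Q
  proof -
    obtain R where RQ: "valuation_ring R" "Q = max_ideal R" using Q by (auto simp: places_def)
    interpret valuation_ring_in emb R by unfold_locales fact
    show ?thesis using RQ ring_at_P by simp
  qed
  show "valuation_ring (ring_at P0)" "max_ideal (ring_at P0) = P0" "x \<in> P0"
    using *[of P0] P0 by (auto simp: is_P0_def)
  show V: "valuation_ring (ring_at Pinf)" and "max_ideal (ring_at Pinf) = Pinf"
    using *[of Pinf] Pinf by (auto simp: is_Pinf_def)
  interpret gk_place emb q x y z P0 Pinf "ring_at Pinf" by unfold_locales fact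
  show "x \<notin> ring_at Pinf" using Pinf y_in z_in by (auto simp: is_Pinf_def)
qed

lemma place_cases:
  assumes "P \<in> places"
  obtains "P = P0" | "P = Pinf" | R where "valuation_ring R" "P = max_ideal R" "x \<in> R" "inverse x \<in> R"
proof -
  obtain R where R: "valuation_ring R" "P = max_ideal R" using assms by (auto simp: places_def)
  interpret A: valuation_ring_in emb R by unfold_locales fact
  interpret O: valuation_ring_in emb "ring_at P0" by unfold_locales (rule ring_P0)
  interpret I: valuation_ring_in emb "ring_at Pinf" by unfold_locales (rule ring_Pinf)
  consider "x \<in> A.P" | "x \<notin> R" | "x \<in> R" "inverse x \<in> R" using A.mem_P_iff by blast
  then show thesis
  proof cases
    case 1
    then have "R = ring_at P0"
      using ring_subset_zero[OF R(1) ring_P0(1)] ring_subset_zero[OF ring_P0(1) R(1)] ring_P0 by auto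
    then show ?thesis using that(1) R ring_P0 by simp
  next
    case 2
    then have "R = ring_at Pinf"
      using ring_subset_inf[OF R(1) ring_Pinf(1)] ring_subset_inf[OF ring_Pinf(1) R(1)] ring_Pinf by auto
    then show ?thesis using that(2) R ring_Pinf by simp
  next
    case 3
    then show ?thesis using that(3) R by blast
  qed
qed

lemma P0_neq_Pinf: "P0 \<noteq> Pinf"
proof
  assume "P0 = Pinf"
  moreover interpret valuation_ring_in emb "ring_at P0" by unfold_locales (rule ring_P0)
  have "x \<in> ring_at P0" using P_subset ring_P0 by auto
  ultimately show False using ring_Pinf by simp
qed

definition mono_fun :: "int \<times> nat \<Rightarrow> 'f" where
  "mono_fun i = x powi (fst i) * y ^ (snd i div N) * z ^ (snd i mod N)"

lemma mono_fun_nonzero [simp]: "mono_fun i \<noteq> 0"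
  by (simp add: mono_fun_def)

definition pole0 :: "int \<times> nat \<Rightarrow> int" where
  "pole0 i = - (fst i * int n + int (snd i))"

definition pole_inf :: "int \<times> nat \<Rightarrow> int" where
  "pole_inf i = (fst i + int (snd i div N + snd i mod N)) * int n - int (snd i)"

lemma
  shows val_mono_P0: "val P0 (mono_fun i) = - pole0 i"
    and val_mono_Pinf: "val Pinf (mono_fun i) = - pole_inf i"
proof -
  interpret A: gk_place emb q x y z P0 Pinf "ring_at P0" by unfold_locales (rule ring_P0)
  obtain \<pi> where "discrete_valuation_ring emb (ring_at P0) \<pi>" using A.discrete by blast
  then interpret A: gk_dvr emb q x y z P0 Pinf "ring_at P0" \<pi> by (simp add: gk_dvr_def gk_setting_axioms)
  interpret B: gk_place emb q x y z P0 Pinf "ring_at Pinf" by unfold_locales (rule ring_Pinf)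
  obtain \<pi>' where "discrete_valuation_ring emb (ring_at Pinf) \<pi>'" using B.discrete by blast
  then interpret B: gk_dvr emb q x y z P0 Pinf "ring_at Pinf" \<pi>' by (simp add: gk_dvr_def gk_setting_axioms)
  define k i' j where kij: "k = fst i" "i' = snd i div N" "j = snd i mod N"
  have m: "snd i = i' * N + j" by (simp add: kij)
  have xP: "x \<in> A.P" using ring_P0 by simp
  have "val A.P (mono_fun i) = k * int n + int i' * int N + int j"
    unfolding mono_fun_def kij[symmetric]
    using A.val_x_zero[OF xP] A.val_y_zero[OF xP] A.val_z_zero[OF xP]
    by (simp add: A.val_mult A.val_power A.val_power_int)
  then show "val P0 (mono_fun i) = - pole0 i"
    unfolding pole0_def m kij(1)[symmetric] ring_P0 by (simp add: algebra_simps)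
  have "val B.P (mono_fun i) = - (k * int n) - int i' * int q * int N - int j * int q ^ 3"
    unfolding mono_fun_def kij[symmetric]
    using B.val_x_inf[OF ring_Pinf(3)] B.val_y_inf[OF ring_Pinf(3)] B.val_z_inf[OF ring_Pinf(3)]
    by (simp add: B.val_mult B.val_power B.val_power_int)
  also have "\<dots> = - pole_inf i"
  proof -
    have q3: "int q ^ 3 = int n - 1" by (simp add: n_def)
    have qN: "int q * int N = int n - int N" using n_eq by (simp add: algebra_simps)
    have "- (k * int n) - int i' * int q * int N - int j * int q ^ 3
        = - (k * int n) - int i' * (int q * int N) - int j * int q ^ 3" by simp
    then show ?thesis
      unfolding q3 qN pole_inf_def kij[symmetric] unfolding m by (simp add: algebra_simps)
  qed
  finally show "val Pinf (mono_fun i) = - pole_inf i" by (simp add: ring_Pinf)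
qed

end

section \<open>Functions regular outside the two places\<close>

lemma card_roots_separable:
  fixes p :: "'k::alg_closed_field poly"
  assumes "p \<noteq> 0" "\<And>a. poly p a = 0 \<Longrightarrow> poly (pderiv p) a \<noteq> 0"
  shows "card {a. poly p a = 0} = degree p"
  using assms
proof (induction "degree p" arbitrary: p)
  case 0
  then obtain c where "p = [:c:]" by (metis degree_0_id)
  then show ?case using 0 by auto
next
  case (Suc d)
  then obtain a where a: "poly p a = 0" using alg_closed_imp_poly_has_root[of p] by auto
  then obtain s where s: "p = [:- a, 1:] * s" by (auto simp: poly_eq_0_iff_dvd elim: dvdE)
  have s0: "s \<noteq> 0" using Suc(3) s by auto
  have deg: "degree p = Suc (degree s)" unfolding s using s0 by (subst degree_mult_eq) auto
  \<comment> \<open>The product rule shows that the simple root a of p is no root of s, and that the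
    roots of s are simple.\<close>
  have deriv: "poly (pderiv p) b = poly s b + (b - a) * poly (pderiv s) b" for b
    unfolding s by (simp only: pderiv_mult poly_add poly_mult) (simp add: pderiv_pCons algebra_simps)
  have "poly s a \<noteq> 0" using Suc(4)[OF a] deriv[of a] by auto
  moreover have "{b. poly p b = 0} = insert a {b. poly s b = 0}"
    unfolding s by auto
  moreover have "card {b. poly s b = 0} = degree s"
  proof (rule Suc(1))
    fix b assume b: "poly s b = 0"
    then have "poly p b = 0" unfolding s by simp
    from Suc(4)[OF this] b show "poly (pderiv s) b \<noteq> 0" using deriv[of b] by auto
  qed (use Suc(2) deg s0 in auto)
  ultimately show ?case using poly_roots_finite[OF s0] deg by simp
qed

text \<open>Orthogonality of the characters of the group of m-th roots of unity.\<close>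

lemma sum_roots_of_unity:
  assumes "of_nat m \<noteq> (0 :: 'k::alg_closed_field)" "m > 0"
  shows "finite {\<zeta> :: 'k. \<zeta> ^ m = 1}"
    and "(\<Sum>\<zeta> | \<zeta> ^ m = 1. \<zeta> ^ k) = (if m dvd k then of_nat m else 0 :: 'k)"
proof -
  define p :: "'k poly" where "p = monom 1 m - 1"
  have pv: "poly p a = a ^ m - 1" for a by (simp add: p_def poly_monom)
  have deg: "degree p = m"
  proof -
    have "degree (monom 1 m + (- 1) :: 'k poly) = degree (monom 1 m :: 'k poly)"
      using assms by (intro degree_add_eq_left) (auto simp: degree_monom_eq)
    then show ?thesis by (simp add: p_def degree_monom_eq)
  qed
  then have p0: "p \<noteq> 0" using assms by auto
  have "poly (pderiv p) a \<noteq> 0" if "poly p a = 0" for a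
  proof -
    have "a \<noteq> 0" using that assms pv by (auto simp: power_0_left)
    then show ?thesis using assms by (simp add: p_def pderiv_diff pderiv_monom poly_monom)
  qed
  then have card: "card {\<zeta> :: 'k. \<zeta> ^ m = 1} = m"
    using card_roots_separable[OF p0] deg pv by simp
  show fin: "finite {\<zeta> :: 'k. \<zeta> ^ m = 1}"
    using card assms by (metis card.infinite less_irrefl)
  define \<mu> where "\<mu> = {\<zeta> :: 'k. \<zeta> ^ m = 1}"
  have "(\<Sum>\<zeta>\<in>\<mu>. \<zeta> ^ k) = (if m dvd k then of_nat m else 0)"
  proof (cases "m dvd k")
    case True
    then obtain l where "k = m * l" by blast
    then have "\<zeta> ^ k = 1" if "\<zeta> \<in> \<mu>" for \<zeta> using that by (simp add: \<mu>_def power_mult)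
    then show ?thesis using True card by (simp add: \<mu>_def)
  next
    case False
    define r where "r = k mod m"
    have r: "0 < r" "r < m" using False assms by (auto simp: r_def dvd_eq_mod_eq_0)
    \<comment> \<open>Otherwise all m roots of unity would be roots of X^r - 1, whose degree r is
      less than m.\<close>
    have "\<exists>\<eta>\<in>\<mu>. \<eta> ^ k \<noteq> 1"
    proof (rule ccontr)
      assume *: "\<not> ?thesis"
      have "\<mu> \<subseteq> {a. poly (monom 1 r - 1) a = 0}"
      proof
        fix \<eta> assume \<eta>: "\<eta> \<in> \<mu>"
        have "\<eta> ^ k = (\<eta> ^ m) ^ (k div m) * \<eta> ^ r" by (simp add: r_def flip: power_mult power_add)
        then have "\<eta> ^ r = 1" using * \<eta> by (simp add: \<mu>_def)
        then show "\<eta> \<in> {a. poly (monom 1 r - 1) a = 0}" by (simp add: poly_monom)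
      qed
      note sub = this
      have "degree (monom 1 r + (- 1) :: 'k poly) = degree (monom 1 r :: 'k poly)"
        using r by (intro degree_add_eq_left) (auto simp: degree_monom_eq)
      then have d: "degree (monom 1 r - 1 :: 'k poly) = r" by (simp add: degree_monom_eq)
      from d have nz: "monom 1 r - 1 \<noteq> (0 :: 'k poly)" using r by auto
      have "card \<mu> \<le> r"
        using card_mono[OF poly_roots_finite[OF nz] sub] card_poly_roots_bound[OF nz] d by simp
      then show False using card r by (simp add: \<mu>_def)
    qed
    then obtain \<eta> where \<eta>: "\<eta> \<in> \<mu>" "\<eta> ^ k \<noteq> 1" by blast
    have \<eta>0: "\<eta> \<noteq> 0" using \<eta> assms by (auto simp: \<mu>_def power_0_left)
    \<comment> \<open>Multiplication by \<eta> permutes the roots of unity, so the sum is unchanged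
      by a factor other than 1.\<close>
    have "(\<Sum>\<zeta>\<in>\<mu>. \<zeta> ^ k) = (\<Sum>\<zeta>\<in>\<mu>. (\<eta> * \<zeta>) ^ k)"
      by (rule sum.reindex_bij_witness[of _ "\<lambda>\<zeta>. \<eta> * \<zeta>" "\<lambda>\<zeta>. \<zeta> / \<eta>"])
        (use \<eta> \<eta>0 in \<open>auto simp: \<mu>_def power_mult_distrib power_divide\<close>)
    also have "\<dots> = \<eta> ^ k * (\<Sum>\<zeta>\<in>\<mu>. \<zeta> ^ k)"
      by (simp add: power_mult_distrib sum_distrib_left)
    finally have "(1 - \<eta> ^ k) * (\<Sum>\<zeta>\<in>\<mu>. \<zeta> ^ k) = 0" by (simp add: algebra_simps)
    then show ?thesis using \<eta> False by simp
  qed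
  then show "(\<Sum>\<zeta> | \<zeta> ^ m = 1. \<zeta> ^ k) = (if m dvd k then of_nat m else 0 :: 'k)"
    by (simp add: \<mu>_def)
qed

context gk_setting
begin

text \<open>By \<open>place_cases\<close> these rings belong to exactly the places other than
  \<open>P0\<close> and \<open>Pinf\<close>. Rings, unlike \<open>val\<close>, are easily pulled
  back along an automorphism.\<close>

definition regular :: "'f set" where
  "regular = {f. \<forall>R. valuation_ring R \<longrightarrow> x \<in> R \<longrightarrow> inverse x \<in> R \<longrightarrow> f \<in> R}"

lemma regular_in:
  assumes "f \<in> regular" "valuation_ring R" "x \<in> R" "inverse x \<in> R" shows "f \<in> R"
  using assms by (simp add: regular_def)

lemma regular_add: "f \<in> regular \<Longrightarrow> g \<in> regular \<Longrightarrow> f + g \<in> regular"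
  and regular_mult: "f \<in> regular \<Longrightarrow> g \<in> regular \<Longrightarrow> f * g \<in> regular"
  and regular_emb: "emb c \<in> regular"
proof -
  have "valuation_ring_in emb R" if "valuation_ring R" for R
    using that by unfold_locales
  note * = valuation_ring_in.add_in[OF this] valuation_ring_in.mult_in[OF this] valuation_ring_in.emb_in[OF this]
  show "f \<in> regular \<Longrightarrow> g \<in> regular \<Longrightarrow> f + g \<in> regular"
    "f \<in> regular \<Longrightarrow> g \<in> regular \<Longrightarrow> f * g \<in> regular" "emb c \<in> regular"
    by (auto simp: regular_def *)
qed

lemma regular_sum: "(\<And>i. i \<in> I \<Longrightarrow> g i \<in> regular) \<Longrightarrow> sum g I \<in> regular"
  by (induction I rule: infinite_finite_induct) (use regular_emb[of 0] in \<open>auto simp: regular_add\<close>)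

text \<open>This is the automorphism over K(x) that sends z to \<zeta> z. It is built as the linear
  map with prescribed values on the basis, and it is multiplicative because it scales every power of
  z by the same power of \<zeta>.\<close>

lemma twist_exists:
  assumes \<zeta>: "\<zeta> ^ n = 1"
  shows "\<exists>\<sigma>. (\<forall>a b. \<sigma> (a + b) = \<sigma> a + \<sigma> b) \<and> (\<forall>c a. \<sigma> (phi c * a) = phi c * \<sigma> a) \<and>
    (\<forall>k. \<sigma> (z ^ k) = emb \<zeta> ^ k * z ^ k) \<and> (\<forall>a b. \<sigma> (a * b) = \<sigma> a * \<sigma> b)"
proof -
  interpret KK: vector_space_pair "\<lambda>c f. phi c * f" "\<lambda>c f. phi c * f" ..
  \<comment> \<open>\<open>inv_into\<close> recovers the exponent m from the basis element
    z^m.\<close>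
  define g where "g v = emb \<zeta> ^ (inv_into {..<n} (\<lambda>m. z ^ m) v) * v" for v
  define \<sigma> where "\<sigma> = KK.construct basis g"
  interpret L: Vector_Spaces.linear "\<lambda>c f. phi c * f" "\<lambda>c f. phi c * f" \<sigma>
    unfolding \<sigma>_def by (rule KK.linear_construct[OF independent_basis])
  have add: "\<sigma> (a + b) = \<sigma> a + \<sigma> b" and scale: "\<sigma> (phi c * a) = phi c * \<sigma> a" for a b c
    by (rule L.add, rule L.scale)
  have small: "\<sigma> (z ^ k) = emb \<zeta> ^ k * z ^ k" if "k < n" for k
    using KK.construct_basis[OF independent_basis, of "z ^ k" g] that inv_into_f_f[OF inj_basis, of k]
    by (simp add: \<sigma>_def g_def basis_def)
  \<comment> \<open>Exponents beyond n - 1 reduce modulo n, since z^n lies in K(x) and \<zeta>^n =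
    1.\<close>
  have pow: "\<sigma> (z ^ k) = emb \<zeta> ^ k * z ^ k" for k
  proof -
    define c where "c = Fract ((F * H ^ (q + 1)) ^ (k div n)) 1"
    have e: "(z ^ n) ^ (k div n) = phi c"
      unfolding px_eq_phi[symmetric] px_power z_power_n c_def ..
    have zk: "z ^ k = phi c * z ^ (k mod n)"
      unfolding e[symmetric] by (simp flip: power_mult power_add)
    have "emb \<zeta> ^ k = (emb \<zeta> ^ n) ^ (k div n) * emb \<zeta> ^ (k mod n)"
      by (simp flip: power_mult power_add)
    also have "emb \<zeta> ^ n = 1" using \<zeta> by (metis emb_power emb_1)
    finally have ek: "emb \<zeta> ^ k = emb \<zeta> ^ (k mod n)" by simp
    have "\<sigma> (z ^ k) = phi c * \<sigma> (z ^ (k mod n))" by (subst zk) (rule scale)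
    also have "\<dots> = emb \<zeta> ^ k * (phi c * z ^ (k mod n))"
      using small[of "k mod n"] n_pos unfolding ek by simp
    finally show ?thesis unfolding zk[symmetric] .
  qed
  have zero: "\<sigma> 0 = 0" using scale[of 0 0] by simp
  have "\<sigma> (a * b) = \<sigma> a * \<sigma> b" for a b
  proof -
    have "a \<in> K.vec.span basis" using span_basis by simp
    then show ?thesis
    proof (induction rule: K.vec.span_induct_alt)
      case base
      then show ?case by (simp add: zero)
    next
      case (step c v w)
      then obtain i where i: "v = z ^ i" by (auto simp: basis_def)
      have "b \<in> K.vec.span basis" using span_basis by simp
      then have "\<sigma> (v * b) = \<sigma> v * \<sigma> b"
      proof (induction rule: K.vec.span_induct_alt)
        case base
        then show ?case by (simp add: zero)
      next
        case (step d u t)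
        then obtain j where j: "u = z ^ j" by (auto simp: basis_def)
        have "v * (phi d * u + t) = phi d * z ^ (i + j) + v * t"
          by (simp add: i j power_add algebra_simps)
        then have "\<sigma> (v * (phi d * u + t)) = phi d * (emb \<zeta> ^ (i + j) * z ^ (i + j)) + \<sigma> v * \<sigma> t"
          using step by (simp only: add scale pow)
        also have "\<dots> = \<sigma> v * \<sigma> (phi d * u + t)"
          unfolding i j add scale pow by (simp add: power_add algebra_simps)
        finally show ?case .
      qed
      then show ?case
        using step(2) by (simp add: distrib_right mult.assoc add scale)
    qed
  qed
  then show ?thesis using add scale pow by blast
qed

text \<open>The preimage of a valuation ring under the automorphism is again a valuation ring, and
  it contains x and 1/x whenever the original does, because x is fixed. So f lies in the
  preimage.\<close>

lemma twist_regular: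
  assumes f: "f \<in> regular"
    and add: "\<And>a b. \<sigma> (a + b) = \<sigma> a + \<sigma> b" and scale: "\<And>c a. \<sigma> (phi c * a) = phi c * \<sigma> a"
    and mult: "\<And>a b. \<sigma> (a * b) = \<sigma> a * \<sigma> b" and one: "\<sigma> 1 = 1"
  shows "\<sigma> f \<in> regular"
  unfolding regular_def
proof (intro CollectI allI impI)
  fix R assume R: "valuation_ring R" "x \<in> R" "inverse x \<in> R"
  interpret A: gk_place emb q x y z P0 Pinf R by unfold_locales fact
  have phi: "\<sigma> (phi c) = phi c" for c using scale[of c 1] one by simp
  have zero: "\<sigma> 0 = 0" using scale[of 0 0] by simp
  have diff: "\<sigma> (a - b) = \<sigma> a - \<sigma> b" for a b
    using add[of "a - b" b] by (simp add: algebra_simps)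
  have inv: "\<sigma> (inverse a) = inverse (\<sigma> a)" for a
  proof (cases "a = 0")
    case False
    then have "\<sigma> a * \<sigma> (inverse a) = 1" using mult[of a "inverse a"] one by simp
    then show ?thesis by (metis inverse_unique)
  qed (simp add: zero)
  have emb: "\<sigma> (emb c) = emb c" for c by (subst (1 2) emb_eq_phi) (rule phi)
  have "x = phi (Fract [:0, 1:] 1)" by (simp add: phi_Fract)
  then have x: "\<sigma> x = x" using phi by metis
  define R' where "R' = {g. \<sigma> g \<in> R}"
  \<comment> \<open>The residue a of x supplies an element outside the preimage, which is therefore
    a proper subring.\<close>
  obtain a where a: "x - emb a \<in> A.P" using A.exists_residue_x R by blast
  have "inverse (x - emb a) \<notin> R"
    using a x_diff_emb_nonzero[of a] by (simp add: A.mem_P_iff)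
  then have "inverse (x - emb a) \<notin> R'" by (simp add: R'_def inv diff x emb)
  moreover have sub: "range emb \<subseteq> R'" using A.emb_in by (auto simp: R'_def emb)
  moreover have xR': "x \<in> R'" "inverse x \<in> R'" using R by (auto simp: R'_def x inv)
  moreover have "x \<notin> range emb" using x_diff_emb_nonzero by auto
  ultimately have strict: "range emb \<subset> R'" "R' \<subset> UNIV" by blast+
  have "\<forall>a\<in>R'. \<forall>b\<in>R'. a - b \<in> R' \<and> a * b \<in> R'"
    by (auto simp: R'_def diff mult intro: A.diff_in A.mult_in)
  moreover have "\<forall>g. g \<in> R' \<or> inverse g \<in> R'"
    using A.in_or_inverse_in by (auto simp: R'_def inv)
  ultimately have "valuation_ring R'" using strict unfolding valuation_ring_def by (intro conjI)
  then have "f \<in> R'" by (rule regular_in[OF f _ xR'])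
  then show "\<sigma> f \<in> R" by (simp add: R'_def)
qed

text \<open>Averaging over the Galois group of \<open>F/K(x)\<close> projects to the eigenspaces.\<close>

lemma regular_terms:
  assumes f: "(\<Sum>m<n. phi (c m) * z ^ m) \<in> regular" and l: "l < n"
  shows "phi (c l) * z ^ l \<in> regular"
proof -
  \<comment> \<open>As n = 1 in K, summing over all roots of unity returns the l-th term itself,
    without division by n.\<close>
  have n1: "of_nat n = (1 :: 'k)" using char q2 by (simp add: n_def power_0_left)
  define \<mu> where "\<mu> = {\<zeta> :: 'k. \<zeta> ^ n = 1}"
  note roots = sum_roots_of_unity[of n, where 'k = 'k, folded \<mu>_def]
  \<comment> \<open>The exponent n - l stands for - l among the natural numbers.\<close>
  have "(\<Sum>m<n. emb (\<zeta> ^ (m + (n - l))) * (phi (c m) * z ^ m)) \<in> regular" if "\<zeta> \<in> \<mu>" for \<zeta>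
  proof -
    have "\<zeta> ^ n = 1" using that by (simp add: \<mu>_def)
    from twist_exists[OF this] obtain \<sigma> where
      add: "\<And>a b. \<sigma> (a + b) = \<sigma> a + \<sigma> b" and scale: "\<And>c a. \<sigma> (phi c * a) = phi c * \<sigma> a"
      and pow: "\<And>k. \<sigma> (z ^ k) = emb \<zeta> ^ k * z ^ k" and mult: "\<And>a b. \<sigma> (a * b) = \<sigma> a * \<sigma> b"
      by blast
    have sum: "\<sigma> (\<Sum>m\<in>I. phi (c m) * z ^ m) = (\<Sum>m\<in>I. phi (c m) * (emb \<zeta> ^ m * z ^ m))" for I
      by (induction I rule: infinite_finite_induct) (use scale[of 0 0] in \<open>auto simp: add scale pow\<close>)
    have "\<sigma> (\<Sum>m<n. phi (c m) * z ^ m) \<in> regular"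
      by (rule twist_regular[OF f add scale mult]) (use pow[of 0] in simp)
    then have "emb (\<zeta> ^ (n - l)) * (\<Sum>m<n. phi (c m) * (emb \<zeta> ^ m * z ^ m)) \<in> regular"
      unfolding sum by (intro regular_mult regular_emb)
    then show ?thesis
      by (simp add: sum_distrib_left emb_power emb_mult power_add mult_ac)
  qed
  then have "(\<Sum>\<zeta>\<in>\<mu>. \<Sum>m<n. emb (\<zeta> ^ (m + (n - l))) * (phi (c m) * z ^ m)) \<in> regular"
    by (rule regular_sum)
  also have "(\<Sum>\<zeta>\<in>\<mu>. \<Sum>m<n. emb (\<zeta> ^ (m + (n - l))) * (phi (c m) * z ^ m)) =
      (\<Sum>m<n. emb (\<Sum>\<zeta>\<in>\<mu>. \<zeta> ^ (m + (n - l))) * (phi (c m) * z ^ m))"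
    by (subst sum.swap) (simp add: emb_sum sum_distrib_right)
  also have "\<dots> = (\<Sum>m<n. if m = l then phi (c l) * z ^ l else 0)"
  proof (rule sum.cong)
    fix m assume m: "m \<in> {..<n}"
    \<comment> \<open>Since 0 < m + (n - l) < 2 n, the only possible multiple of n is n
      itself.\<close>
    have "n dvd m + (n - l) \<longleftrightarrow> m = l"
    proof
      assume "n dvd m + (n - l)"
      then obtain t where t: "m + (n - l) = n * t" by blast
      have "m < n" using m by simp
      then have "0 < n * t" "n * t < n * 2" using t l by linarith+
      then have "t = 1" by (simp only: mult_less_cancel1 nat_0_less_mult_iff) linarith
      then show "m = l" using t l by simp
    qed (use l in auto)
    then show "emb (\<Sum>\<zeta>\<in>\<mu>. \<zeta> ^ (m + (n - l))) * (phi (c m) * z ^ m) = (if m = l then phi (c l) * z ^ l else 0)"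
      using roots(2) n1 n_pos by (simp add: emb_1)
  qed simp
  also have "\<dots> = phi (c l) * z ^ l" using l by simp
  finally show ?thesis .
qed

text \<open>A pole of the coefficient at \<open>x = a \<noteq> 0\<close> cannot be compensated by \<open>y\<^sup>i z\<^sup>j\<close>: as \<open>F H\<close> has only simple
  roots, the value of \<open>y\<^sup>i z\<^sup>j\<close> there is less than that of \<open>x - a\<close>.\<close>

lemma laurent_coefficient:
  assumes reg: "phi c * (y ^ i * z ^ j) \<in> regular" and ij: "i * N + j < n" "j < N"
  shows "phi c \<in> vec.span (range (\<lambda>k::int. x powi k))"
proof (cases "c = 0")
  case True
  then show ?thesis by (simp add: vec.span_zero)
next
  case False
  \<comment> \<open>A denominator s of least degree stands for a fraction in lowest terms.\<close>
  define Q where "Q s \<longleftrightarrow> s \<noteq> 0 \<and> (\<exists>p. p \<noteq> 0 \<and> phi c = px p / px s)" for s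
  obtain p s where ps: "s \<noteq> 0" "c = Fract p s" "phi c = px p / px s" by (rule phi_cases)
  then have "p \<noteq> 0" using False by (auto simp: Zero_fract_def eq_fract)
  then have "Q s" using ps unfolding Q_def by blast
  then obtain s where s: "Q s" "\<And>s'. Q s' \<Longrightarrow> degree s \<le> degree s'"
    using ex_has_least_nat[of Q s degree] by blast
  then obtain p where p: "p \<noteq> 0" "s \<noteq> 0" "phi c = px p / px s" unfolding Q_def by blast
  have root0: "a = 0" if a: "poly s a = 0" for a
  proof (rule ccontr)
    assume a0: "a \<noteq> 0"
    have pa: "poly p a \<noteq> 0"
    proof
      assume "poly p a = 0"
      then obtain p' where p': "p = [:- a, 1:] * p'" by (auto simp: poly_eq_0_iff_dvd elim: dvdE)
      obtain s' where s': "s = [:- a, 1:] * s'" using a by (auto simp: poly_eq_0_iff_dvd elim: dvdE)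
      have nz: "px [:- a, 1:] \<noteq> 0" "s' \<noteq> 0" "p' \<noteq> 0" using p p' s' by auto
      have "Q s'" unfolding Q_def using nz p(3) unfolding p' s' px_mult by (intro conjI exI[of _ p']) auto
      moreover have "degree s = Suc (degree s')" unfolding s' using nz by (subst degree_mult_eq) auto
      ultimately show False using s(2)[of s'] by simp
    qed
    obtain R where R: "valuation_ring R" "x \<in> R" "x - emb a \<in> max_ideal R"
      using exists_place_over by blast
    interpret A: gk_place emb q x y z P0 Pinf R by unfold_locales fact
    obtain \<pi> where "discrete_valuation_ring emb R \<pi>" using A.discrete by blast
    then interpret A: gk_dvr emb q x y z P0 Pinf R \<pi> by (simp add: gk_dvr_def gk_setting_axioms)
    define e where "e = val A.P (x - emb a)"
    have e: "e > 0" using A.val_parameter[OF A.parameter_finite[OF R(3)]] by (simp add: e_def)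
    note v = A.val_px_finite[OF R(3), folded e_def]
    have "emb a + (x - emb a) \<in> A.units" using a0 R by (intro A.add_unit_P A.emb_unit)
    then have "inverse x \<in> R" by (simp add: A.units_def)
    then have "phi c * (y ^ i * z ^ j) \<in> R" using regular_in[OF reg] R by blast
    then have "val A.P (phi c) + int i * val A.P y + int j * val A.P z \<ge> 0"
      using A.val_nonneg_iff[of "phi c * (y ^ i * z ^ j)"] False
      by (simp add: A.val_mult A.val_power)
    moreover have "val A.P (phi c) \<le> - e"
    proof -
      have "order a p = 0" using pa by (rule order_0I)
      moreover have "order a s \<ge> 1" using a p(2) order_root[of s a] by linarith
      ultimately show ?thesis
        using v[OF p(1)] v[OF p(2)] p e by (simp add: A.val_divide)
    qed
    \<comment> \<open>The factor n lets \<open>val_y\<close> and \<open>val_z\<close> express the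
      values by the orders of F and H. Both i N + j and j (q + 1) are at most n - 1, and the two
      orders add up to at most 1, so the total stays below n e.\<close>
    ultimately have "int n * e \<le> int n * (int i * val A.P y + int j * val A.P z)"
      by (intro mult_left_mono) auto
    also have "\<dots> = int i * int N * (int (q + 1) * val A.P y) + int j * (int n * val A.P z)"
      unfolding n_eq by (simp add: algebra_simps)
    also have "\<dots> = int i * int N * (e * int (order a F)) + int j * (e * int (order a F) + int (q + 1) * (e * int (order a H)))"
      unfolding A.val_y A.val_z v[OF FH_nonzero(1)] v[OF FH_nonzero(2)] by (simp add: algebra_simps)
    also have "\<dots> = e * int ((i * N + j) * order a F + j * (q + 1) * order a H)"
      by (simp add: algebra_simps)
    also have "\<dots> \<le> e * int (n - 1)"
    proof (rule mult_left_mono)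
      have "j * (q + 1) \<le> (N - 1) * (q + 1)" using ij by (intro mult_right_mono) auto
      also have "\<dots> \<le> n - 1" unfolding n_eq using N_pos by (cases N) auto
      finally have "(i * N + j) * order a F + j * (q + 1) * order a H \<le> (n - 1) * order a F + (n - 1) * order a H"
        using ij by (intro add_mono mult_right_mono) auto
      also have "\<dots> \<le> (n - 1) * 1"
        unfolding distrib_left[symmetric] by (intro mult_left_mono order_FH) auto
      finally show "int ((i * N + j) * order a F + j * (q + 1) * order a H) \<le> int (n - 1)"
        by (simp only: of_nat_le_iff mult_1_right)
    qed (use e in simp)
    finally have "int n * e \<le> e * int (n - 1)" .
    moreover have "int (n - 1) = int n - 1" using n_pos by linarith
    ultimately show False using e by (simp add: algebra_simps)
  qed
  \<comment> \<open>With 0 as its only possible root, s is a constant times a power of X, so the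
    fraction is a Laurent polynomial.\<close>
  obtain s' where s': "s = [:- 0, 1:] ^ order 0 s * s'" "\<not> [:- 0, 1:] dvd s'"
    using order_decomp[OF p(2), of 0] by blast
  have "degree s' = 0"
  proof (rule ccontr)
    assume "degree s' \<noteq> 0"
    then obtain a where a: "poly s' a = 0" using poly_root_exists[of s'] by auto
    then have "poly s a = 0" by (subst s'(1)) simp
    then show False using root0[of a] a s'(2) by (simp add: poly_eq_0_iff_dvd)
  qed
  then obtain d where d: "s' = [:d:]" by (metis degree_0_id)
  define k where "k = order 0 s"
  have "px s = px ([:- 0, 1:] ^ k * [:d:])" using s'(1) unfolding d k_def by (rule arg_cong)
  then have pxs: "px s = x ^ k * emb d" by (simp only: px_mult px_power px_const) simp
  have d0: "d \<noteq> 0" using s'(2) d by auto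
  have "phi c = (\<Sum>t\<le>degree p. emb (coeff p t / d) * x powi (int t - int k))"
    unfolding p(3) pxs px_altdef[of p] sum_divide_distrib
    using d0 by (intro sum.cong) (auto simp: emb_divide power_int_diff)
  also have "\<dots> \<in> vec.span (range (\<lambda>k::int. x powi k))"
    by (intro vec.span_sum vec.span_scale vec.span_base) auto
  finally show ?thesis .
qed

definition exponents :: "(int \<times> nat) set" where "exponents = {i. snd i < n}"

lemma regular_subset_span: "regular \<subseteq> vec.span (mono_fun ` exponents)"
proof
  fix f assume f: "f \<in> regular"
  obtain c where c: "f = (\<Sum>m<n. phi (c m) * z ^ m)" using coordinates by blast
  have "phi (c m) * z ^ m \<in> vec.span (mono_fun ` exponents)" if m: "m < n" for m
  proof -
    define i j where "i = m div N" and "j = m mod N"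
    have mij: "m = i * N + j" and j: "j < N" using N_pos by (auto simp: i_def j_def)
    \<comment> \<open>By \<open>z_power_N\<close>, z^m is y^i H(x)^i z^j; the power of H(x) moves
      into the coefficient.\<close>
    define d where "d = c m * Fract (H ^ i) 1"
    have "z ^ m = (z ^ N) ^ i * z ^ j" unfolding mij by (simp add: power_add power_mult[symmetric] mult.commute)
    then have eq: "phi (c m) * z ^ m = phi d * (y ^ i * z ^ j)"
      by (simp add: z_power_N d_def K.emb_mult phi_Fract power_mult_distrib px_power mult_ac)
    have "phi d * (y ^ i * z ^ j) \<in> regular"
      using regular_terms[OF f[unfolded c] m] unfolding eq .
    then have "phi d \<in> vec.span (range (\<lambda>k::int. x powi k))"
      using m mij j by (intro laurent_coefficient) auto
    then have "phi d * (y ^ i * z ^ j) \<in> vec.span (mono_fun ` exponents)"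
    proof (induction rule: vec.span_induct_alt)
      case base
      then show ?case by (simp add: vec.span_zero)
    next
      case (step a v w)
      then obtain k :: int where k: "v = x powi k" by blast
      have "v * (y ^ i * z ^ j) = mono_fun (k, m)" by (simp add: k mono_fun_def i_def j_def)
      moreover have "mono_fun (k, m) \<in> vec.span (mono_fun ` exponents)"
        using m by (intro vec.span_base) (simp add: exponents_def)
      ultimately have "emb a * (v * (y ^ i * z ^ j)) + w * (y ^ i * z ^ j) \<in> vec.span (mono_fun ` exponents)"
        using step by (intro vec.span_add vec.span_scale) auto
      then show ?case by (simp add: distrib_right mult.assoc)
    qed
    then show ?thesis unfolding eq .
  qed
  then show "f \<in> vec.span (mono_fun ` exponents)" unfolding c by (intro vec.span_sum) auto
qed

lemma mono_fun_regular: "mono_fun i \<in> regular"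
  unfolding regular_def
proof (intro CollectI allI impI)
  fix R assume R: "valuation_ring R" "x \<in> R" "inverse x \<in> R"
  interpret A: gk_place emb q x y z P0 Pinf R by unfold_locales fact
  have "x \<in> A.units" using R by (simp add: A.units_def)
  then have "x powi fst i \<in> R" using A.power_int_unit[of x "fst i"] by (simp add: A.units_def)
  then show "mono_fun i \<in> R"
    using A.y_in A.z_in R unfolding mono_fun_def by (intro A.mult_in A.power_in)
qed

end

section \<open>Dimensions of Riemann-Roch spaces\<close>

lemma (in discrete_valuation_ring) subspace_val_ge:
  "vec.subspace {f. f = 0 \<or> k \<le> val P f}"
proof -
  have *: "f = 0 \<or> k \<le> val P f \<longleftrightarrow> \<pi> powi (- k) * f \<in> R" for f
  proof (cases "f = 0")
    case False
    have "val P (\<pi> powi (- k) * f) = val P f - k"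
      using False pi_nz val_pi_mult[of 1 "- k"] by (simp add: val_mult)
    then show ?thesis using False pi_nz val_nonneg_iff[of "\<pi> powi (- k) * f"] by simp
  qed simp
  show ?thesis unfolding * vec.subspace_def
    by (auto simp: distrib_left add_in mult.left_commute[of _ "emb _"] intro: mult_in[OF emb_in])
qed

context gk_setting
begin

lemma inj_pole0: "inj_on pole0 exponents" and inj_pole_inf: "inj_on pole_inf exponents"
proof -
  have *: "a = b \<and> i = j" if "a * int n + int i = b * int n + int j" "i < n" "j < n"
    for a b :: int and i j :: nat
  proof -
    have "(int i + a * int n) div int n = a" "(int j + b * int n) div int n = b"
      using that n_pos by auto
    moreover have "int i + a * int n = int j + b * int n" using that by simp
    ultimately have "a = b" by simp
    then show ?thesis using that by simp
  qed
  show "inj_on pole0 exponents"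
  proof (rule inj_onI)
    fix i j assume "i \<in> exponents" "j \<in> exponents" "pole0 i = pole0 j"
    then show "i = j" using *[of "fst i" "snd i" "fst j" "snd j"]
      by (auto simp: pole0_def exponents_def prod_eq_iff)
  qed
  show "inj_on pole_inf exponents"
  proof (rule inj_onI)
    fix i j assume ij: "i \<in> exponents" "j \<in> exponents" and eq: "pole_inf i = pole_inf j"
    define a b where "a = fst i + int (snd i div N + snd i mod N)" and "b = fst j + int (snd j div N + snd j mod N)"
    have "b * int n + int (snd i) = a * int n + int (snd j)"
      using eq unfolding pole_inf_def a_def b_def by (simp add: algebra_simps)
    from *[OF this] have "b = a \<and> snd i = snd j" using ij by (auto simp: exponents_def)
    then show "i = j" by (auto simp: a_def b_def prod_eq_iff)
  qed
qed

definition RR_exponents :: "int \<Rightarrow> int \<Rightarrow> (int \<times> nat) set" where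
  "RR_exponents a b = {i \<in> exponents. pole0 i \<le> a \<and> pole_inf i \<le> b}"

lemma finite_RR_exponents: "finite (RR_exponents a b)"
proof (rule finite_subset)
  show "RR_exponents a b \<subseteq> {- \<bar>a\<bar> - int n..\<bar>b\<bar> + int n} \<times> {..<n}"
  proof
    fix i assume i: "i \<in> RR_exponents a b"
    have n1: "int n \<ge> 1" using n_pos by simp
    have m: "snd i < n" using i by (simp add: RR_exponents_def exponents_def)
    have "- a \<le> fst i * int n + int (snd i)" using i by (simp add: RR_exponents_def pole0_def)
    then have lo: "- \<bar>a\<bar> - int n \<le> fst i * int n" using m by linarith
    have "fst i * int n + int (snd i div N + snd i mod N) * int n - int (snd i) \<le> b"
      using i by (simp add: RR_exponents_def pole_inf_def distrib_right)
    moreover have "0 \<le> int (snd i div N + snd i mod N) * int n" by simp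
    ultimately have hi: "fst i * int n \<le> \<bar>b\<bar> + int n" using m by linarith
    have "- \<bar>a\<bar> - int n \<le> fst i"
    proof (cases "fst i \<ge> 0")
      case False
      then have "fst i * int n \<le> fst i * 1" using n1 by (intro mult_left_mono_neg) auto
      then show ?thesis using lo by linarith
    qed (use n1 in linarith)
    moreover have "fst i \<le> \<bar>b\<bar> + int n"
    proof (cases "fst i \<ge> 0")
      case True
      then have "fst i * 1 \<le> fst i * int n" using n1 by (intro mult_left_mono) auto
      then show ?thesis using hi by linarith
    qed (use n1 in linarith)
    ultimately show "i \<in> {- \<bar>a\<bar> - int n..\<bar>b\<bar> + int n} \<times> {..<n}"
      using m by (auto simp: mem_Times_iff)
  qed
qed auto

lemma discrete_P0: "\<exists>\<pi>. discrete_valuation_ring emb (ring_at P0) \<pi>"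
  and discrete_Pinf: "\<exists>\<pi>. discrete_valuation_ring emb (ring_at Pinf) \<pi>"
proof -
  interpret A: gk_place emb q x y z P0 Pinf "ring_at P0" by unfold_locales (rule ring_P0)
  interpret B: gk_place emb q x y z P0 Pinf "ring_at Pinf" by unfold_locales (rule ring_Pinf)
  show "\<exists>\<pi>. discrete_valuation_ring emb (ring_at P0) \<pi>"
    "\<exists>\<pi>. discrete_valuation_ring emb (ring_at Pinf) \<pi>"
    using A.discrete B.discrete .
qed

abbreviation D2 :: "int \<Rightarrow> int \<Rightarrow> ('f set \<Rightarrow>\<^sub>0 int)" where
  "D2 a b \<equiv> Poly_Mapping.single P0 a + Poly_Mapping.single Pinf b"

lemma riemann_roch_iff:
  "f \<in> riemann_roch_space (D2 a b) \<longleftrightarrow> f = 0 \<or> f \<in> regular \<and> - a \<le> val P0 f \<and> - b \<le> val Pinf f"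
proof (cases "f = 0")
  case False
  have look: "Poly_Mapping.lookup (D2 a b) Q = (if Q = P0 then a else if Q = Pinf then b else 0)" for Q
    using P0_neq_Pinf by (auto simp: lookup_add lookup_single when_def)
  have val_iff: "0 \<le> val (max_ideal R) f \<longleftrightarrow> f \<in> R" if "valuation_ring R" for R
  proof -
    interpret A: gk_place emb q x y z P0 Pinf R by unfold_locales fact
    obtain \<pi> where "discrete_valuation_ring emb R \<pi>" using A.discrete by blast
    then interpret A: discrete_valuation_ring emb R \<pi> .
    show ?thesis using A.val_nonneg_iff False by blast
  qed
  have P0_in: "P0 \<in> places" "Pinf \<in> places" using P0 Pinf by (auto simp: is_P0_def is_Pinf_def)
  show ?thesis
  proof
    assume f: "f \<in> riemann_roch_space (D2 a b)"
    then have v: "- Poly_Mapping.lookup (D2 a b) Q \<le> val Q f" if "Q \<in> places" for Q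
      using that False by (auto simp: riemann_roch_space_def)
    have "f \<in> R" if R: "valuation_ring R" "x \<in> R" "inverse x \<in> R" for R
    proof -
      have Q: "max_ideal R \<in> places" using R by (auto simp: places_def)
      have "x \<notin> max_ideal R"
      proof -
        interpret A: valuation_ring_in emb R by unfold_locales fact
        show ?thesis using R by (simp add: A.mem_P_iff)
      qed
      then have "max_ideal R \<noteq> P0" using ring_P0 by auto
      moreover have "max_ideal R \<noteq> Pinf"
      proof
        assume "max_ideal R = Pinf"
        interpret A: valuation_ring_in emb R by unfold_locales fact
        have "ring_at Pinf = R" using A.ring_at_P \<open>max_ideal R = Pinf\<close> by simp
        then show False using ring_Pinf R by simp
      qed
      ultimately show ?thesis using v[OF Q] look val_iff[OF R(1)] by simp
    qed
    moreover have "- a \<le> val P0 f" "- b \<le> val Pinf f"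
      using v[OF P0_in(1)] v[OF P0_in(2)] look P0_neq_Pinf by auto
    ultimately show "f = 0 \<or> f \<in> regular \<and> - a \<le> val P0 f \<and> - b \<le> val Pinf f"
      by (auto simp: regular_def)
  next
    assume f: "f = 0 \<or> f \<in> regular \<and> - a \<le> val P0 f \<and> - b \<le> val Pinf f"
    have "- Poly_Mapping.lookup (D2 a b) Q \<le> val Q f" if "Q \<in> places" for Q
      using that
    proof (cases rule: place_cases)
      case (3 R)
      have "x \<notin> max_ideal R"
      proof -
        interpret A: valuation_ring_in emb R by unfold_locales fact
        show ?thesis using 3 by (simp add: A.mem_P_iff)
      qed
      then have "Q \<noteq> P0" using ring_P0 3 by auto
      moreover have "Q \<noteq> Pinf"
      proof
        assume "Q = Pinf"
        interpret A: valuation_ring_in emb R by unfold_locales fact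
        have "ring_at Pinf = R" using A.ring_at_P \<open>Q = Pinf\<close> 3 by simp
        then show False using ring_Pinf 3 by simp
      qed
      moreover have "f \<in> R" using f False 3 regular_in by blast
      ultimately show ?thesis using look val_iff[OF 3(1)] 3 by simp
    qed (use f False look P0_neq_Pinf in auto)
    then show "f \<in> riemann_roch_space (D2 a b)" by (simp add: riemann_roch_space_def)
  qed
qed (simp add: riemann_roch_space_def)

lemma inj_mono_fun: "inj_on mono_fun exponents"
proof (rule inj_onI)
  fix i j assume "i \<in> exponents" "j \<in> exponents" "mono_fun i = mono_fun j"
  then have "pole0 i = pole0 j" using val_mono_P0[of i] val_mono_P0[of j] by simp
  then show "i = j" using inj_pole0 \<open>i \<in> exponents\<close> \<open>j \<in> exponents\<close> by (auto dest: inj_onD)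
qed

text \<open>Distinct monomials have distinct values at each of the two places, so a combination has
  the least value of its terms. Bounds on the poles of a combination thus hold for each of its
  monomials.\<close>

lemma val_linear_combination:
  assumes T: "finite T" "T \<subseteq> exponents" "T \<noteq> {}" "\<And>i. i \<in> T \<Longrightarrow> u i \<noteq> 0"
  shows "(\<Sum>i\<in>T. emb (u i) * mono_fun i) \<noteq> 0"
    and "i \<in> T \<Longrightarrow> val P0 (\<Sum>i\<in>T. emb (u i) * mono_fun i) \<le> - pole0 i"
    and "i \<in> T \<Longrightarrow> val Pinf (\<Sum>i\<in>T. emb (u i) * mono_fun i) \<le> - pole_inf i"
proof -
  obtain \<pi> \<pi>' where "discrete_valuation_ring emb (ring_at P0) \<pi>" "discrete_valuation_ring emb (ring_at Pinf) \<pi>'"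
    using discrete_P0 discrete_Pinf by blast
  then interpret A: discrete_valuation_ring emb "ring_at P0" \<pi> + B: discrete_valuation_ring emb "ring_at Pinf" \<pi>' .
  have A: "val P0 (emb (u i) * mono_fun i) = - pole0 i" if "i \<in> T" for i
    using A.val_mult[of "emb (u i)" "mono_fun i"] T(4)[OF that] A.val_emb[of "u i"] val_mono_P0 ring_P0 by simp
  have B: "val Pinf (emb (u i) * mono_fun i) = - pole_inf i" if "i \<in> T" for i
    using B.val_mult[of "emb (u i)" "mono_fun i"] T(4)[OF that] B.val_emb[of "u i"] val_mono_Pinf ring_Pinf by simp
  have "inj_on (\<lambda>i. val P0 (emb (u i) * mono_fun i)) T"
    using A inj_on_subset[OF inj_pole0 T(2)] by (simp add: inj_on_def)
  then obtain m where m: "m \<in> T" "(\<Sum>i\<in>T. emb (u i) * mono_fun i) \<noteq> 0"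
    "val P0 (\<Sum>i\<in>T. emb (u i) * mono_fun i) = val P0 (emb (u m) * mono_fun m)"
    "\<And>i. i \<in> T \<Longrightarrow> val P0 (emb (u m) * mono_fun m) \<le> val P0 (emb (u i) * mono_fun i)"
    using A.val_sum[OF T(1,3), of "\<lambda>i. emb (u i) * mono_fun i", unfolded ring_P0] T(4) by auto
  show "(\<Sum>i\<in>T. emb (u i) * mono_fun i) \<noteq> 0" by (rule m)
  show "i \<in> T \<Longrightarrow> val P0 (\<Sum>i\<in>T. emb (u i) * mono_fun i) \<le> - pole0 i"
    using m(3) m(4)[of i] A[of i] A[OF m(1)] by simp
  have "inj_on (\<lambda>i. val Pinf (emb (u i) * mono_fun i)) T"
    using B inj_on_subset[OF inj_pole_inf T(2)] by (simp add: inj_on_def)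
  then obtain m where m: "m \<in> T"
    "val Pinf (\<Sum>i\<in>T. emb (u i) * mono_fun i) = val Pinf (emb (u m) * mono_fun m)"
    "\<And>i. i \<in> T \<Longrightarrow> val Pinf (emb (u m) * mono_fun m) \<le> val Pinf (emb (u i) * mono_fun i)"
    using B.val_sum[OF T(1,3), of "\<lambda>i. emb (u i) * mono_fun i", unfolded ring_Pinf] T(4) by auto
  show "i \<in> T \<Longrightarrow> val Pinf (\<Sum>i\<in>T. emb (u i) * mono_fun i) \<le> - pole_inf i"
    using m(2) m(3)[of i] B[of i] B[OF m(1)] by simp
qed

lemma independent_mono_fun: "\<not> vec.dependent (mono_fun ` RR_exponents a b)"
proof (rule vec.independent_if_scalars_zero)
  show "finite (mono_fun ` RR_exponents a b)" by (simp add: finite_RR_exponents)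
  fix f v assume sum0: "(\<Sum>v\<in>mono_fun ` RR_exponents a b. emb (f v) * v) = 0"
    and v: "v \<in> mono_fun ` RR_exponents a b"
  have inj: "inj_on mono_fun (RR_exponents a b)"
    using inj_mono_fun by (rule inj_on_subset) (auto simp: RR_exponents_def)
  define T where "T = {i \<in> RR_exponents a b. f (mono_fun i) \<noteq> 0}"
  have "(\<Sum>i\<in>T. emb (f (mono_fun i)) * mono_fun i) = (\<Sum>i\<in>RR_exponents a b. emb (f (mono_fun i)) * mono_fun i)"
    using finite_RR_exponents by (intro sum.mono_neutral_left) (auto simp: T_def)
  also have "\<dots> = 0" using sum0 by (simp add: sum.reindex[OF inj])
  finally have T0: "(\<Sum>i\<in>T. emb (f (mono_fun i)) * mono_fun i) = 0" .
  have T: "finite T" "T \<subseteq> exponents" "\<And>i. i \<in> T \<Longrightarrow> f (mono_fun i) \<noteq> 0"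
    using finite_RR_exponents[of a b] by (auto simp: T_def RR_exponents_def intro: rev_finite_subset)
  have "T = {}"
  proof (rule ccontr)
    assume "T \<noteq> {}"
    from val_linear_combination(1)[OF T(1,2) this, of "\<lambda>i. f (mono_fun i)"] T(3) T0
    show False by blast
  qed
  then show "f v = 0" using v by (auto simp: T_def)
qed

lemma riemann_roch_eq_span: "riemann_roch_space (D2 a b) = vec.span (mono_fun ` RR_exponents a b)"
proof
  obtain \<pi> \<pi>' where "discrete_valuation_ring emb (ring_at P0) \<pi>" "discrete_valuation_ring emb (ring_at Pinf) \<pi>'"
    using discrete_P0 discrete_Pinf by blast
  then interpret A: discrete_valuation_ring emb "ring_at P0" \<pi> + B: discrete_valuation_ring emb "ring_at Pinf" \<pi>' .
  have "vec.subspace ({f. f = 0 \<or> - a \<le> val P0 f} \<inter> {f. f = 0 \<or> - b \<le> val Pinf f} \<inter> regular)"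
    using A.subspace_val_ge[of "- a"] B.subspace_val_ge[of "- b"] ring_P0 ring_Pinf
    by (intro vec.subspace_inter)
      (auto simp: vec.subspace_def regular_emb[of 0, simplified] intro: regular_add regular_mult regular_emb)
  moreover have "riemann_roch_space (D2 a b) = {f. f = 0 \<or> - a \<le> val P0 f} \<inter> {f. f = 0 \<or> - b \<le> val Pinf f} \<inter> regular"
    using regular_emb[of 0] by (auto simp: riemann_roch_iff)
  ultimately have sub: "vec.subspace (riemann_roch_space (D2 a b))" by simp
  show "vec.span (mono_fun ` RR_exponents a b) \<subseteq> riemann_roch_space (D2 a b)"
  proof (rule vec.span_minimal[OF _ sub])
    show "mono_fun ` RR_exponents a b \<subseteq> riemann_roch_space (D2 a b)"
      by (auto simp: riemann_roch_iff RR_exponents_def mono_fun_regular val_mono_P0 val_mono_Pinf)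
  qed
  show "riemann_roch_space (D2 a b) \<subseteq> vec.span (mono_fun ` RR_exponents a b)"
  proof
    fix f assume f: "f \<in> riemann_roch_space (D2 a b)"
    show "f \<in> vec.span (mono_fun ` RR_exponents a b)"
    proof (cases "f = 0")
      case False
      with f have f': "f \<in> regular" "- a \<le> val P0 f" "- b \<le> val Pinf f" by (auto simp: riemann_roch_iff)
      then have "f \<in> vec.span (mono_fun ` exponents)" using regular_subset_span by blast
      then obtain t r where t: "finite t" "t \<subseteq> mono_fun ` exponents" "f = (\<Sum>v\<in>t. emb (r v) * v)"
        unfolding vec.span_explicit by blast
      obtain T0 where T0: "T0 \<subseteq> exponents" "t = mono_fun ` T0" "finite T0"
        using finite_subset_image[OF t(1,2)] by blast
      define T where "T = {i\<in>T0. r (mono_fun i) \<noteq> 0}"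
      have "f = (\<Sum>i\<in>T0. emb (r (mono_fun i)) * mono_fun i)"
        unfolding t(3) T0(2) by (simp add: sum.reindex[OF inj_on_subset[OF inj_mono_fun T0(1)]])
      also have "\<dots> = (\<Sum>i\<in>T. emb (r (mono_fun i)) * mono_fun i)"
        using T0(3) by (intro sum.mono_neutral_right) (auto simp: T_def)
      finally have fT: "f = (\<Sum>i\<in>T. emb (r (mono_fun i)) * mono_fun i)" .
      then have Tne: "T \<noteq> {}" using False by auto
      have T: "finite T" "T \<subseteq> exponents" "\<And>i. i \<in> T \<Longrightarrow> r (mono_fun i) \<noteq> 0"
        using T0 by (auto simp: T_def)
      have "i \<in> RR_exponents a b" if i: "i \<in> T" for i
        using val_linear_combination(2,3)[of T "\<lambda>i. r (mono_fun i)" i, OF T(1,2) Tne T(3) i] i T(2) f'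
        unfolding fT[symmetric] by (auto simp: RR_exponents_def)
      then show ?thesis unfolding fT
        by (intro vec.span_sum vec.span_scale vec.span_base) auto
    qed (simp add: vec.span_zero)
  qed
qed

lemma ell_eq_card: "ell (D2 a b) = card (RR_exponents a b)"
proof -
  have "ell (D2 a b) = card (mono_fun ` RR_exponents a b)"
    unfolding ell_def riemann_roch_eq_span by (rule vec.dim_span_eq_card_independent[OF independent_mono_fun])
  also have "\<dots> = card (RR_exponents a b)"
    by (intro card_image inj_on_subset[OF inj_mono_fun]) (auto simp: RR_exponents_def)
  finally show ?thesis .
qed

text \<open>By \<open>ell_eq_card\<close>, lowering a by 1 keeps the dimension exactly when it
  removes no monomial, that is, when every monomial of pole order exactly a at \<open>P0\<close> has
  order above b at \<open>Pinf\<close>; likewise for b.\<close>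

lemma pure_gaps_iff:
  "(a, b) \<in> pure_gaps P0 Pinf \<longleftrightarrow> 0 \<le> a \<and> 0 \<le> b \<and>
     (\<forall>i\<in>exponents. (pole0 i = a \<longrightarrow> b < pole_inf i) \<and> (pole_inf i = b \<longrightarrow> a < pole0 i))"
proof -
  have D: "D2 a b - Poly_Mapping.single P0 1 = D2 (a - 1) b" "D2 a b - Poly_Mapping.single Pinf 1 = D2 a (b - 1)"
    by (simp_all add: single_diff)
  have card_eq: "card A = card B \<longleftrightarrow> A \<subseteq> B" if "finite A" "B \<subseteq> A" for A B :: "(int \<times> nat) set"
    using that by (metis card_subset_eq subset_antisym order_refl)
  have 1: "ell (D2 a b) = ell (D2 (a - 1) b) \<longleftrightarrow> (\<forall>i\<in>exponents. pole0 i = a \<longrightarrow> b < pole_inf i)"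
    unfolding ell_eq_card
    by (subst card_eq[OF finite_RR_exponents]) (force simp: RR_exponents_def)+
  have 2: "ell (D2 a b) = ell (D2 a (b - 1)) \<longleftrightarrow> (\<forall>i\<in>exponents. pole_inf i = b \<longrightarrow> a < pole0 i)"
    unfolding ell_eq_card
    by (subst card_eq[OF finite_RR_exponents]) (force simp: RR_exponents_def)+
  show ?thesis
    unfolding pure_gaps_def Let_def using 1 2 by (auto simp: D)
qed

end

section \<open>Counting\<close>

lemma sum_diff_real: "2 * (\<Sum>i\<le>k. a - real i) = (real k + 1) * (2 * a - real k)"
  by (induction k) (simp_all add: algebra_simps)

lemma sum_sum_diff_real:
  "3 * (\<Sum>k\<le>d. (real k + 1) * (2 * a - real k)) = (real d + 1) * (real d + 2) * (3 * a - real d)"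
  by (induction d) (simp_all add: algebra_simps)

text \<open>Row by row, the number of lattice points (i, j) with i \<le> q, j < N and i + j <
  U.\<close>

definition count_below :: "nat \<Rightarrow> nat \<Rightarrow> nat \<Rightarrow> nat" where
  "count_below q N U = (\<Sum>i\<le>q. min N (U - i))"

text \<open>The number of pairs of points of the rectangle i \<le> q, j < N where (i, j) lies on the
  line i + j = U, so that j = U - i, and (i', j') lies below that line with i' \<le> i.\<close>

definition count_on :: "nat \<Rightarrow> nat \<Rightarrow> nat \<Rightarrow> nat" where
  "count_on q N U = (\<Sum>i | i \<le> q \<and> i \<le> U \<and> U - i < N. \<Sum>i'\<le>i. min N (U - i'))"

lemma sum_truncated_diff:
  assumes "k \<le> U" "U \<le> N"
  shows "2 * real (\<Sum>i\<le>k. min N (U - i)) = (real k + 1) * (2 * real U - real k)"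
proof -
  have "real (\<Sum>i\<le>k. min N (U - i)) = (\<Sum>i\<le>k. real U - real i)"
    unfolding of_nat_sum using assms by (intro sum.cong) (auto simp: min_def of_nat_diff)
  then show ?thesis by (simp only: sum_diff_real)
qed

text \<open>For U < N the bound N never truncates a row, and rows beyond k contribute
  nothing.\<close>

lemma count_low:
  assumes "U < N" "k = min q U"
  shows "2 * real (count_below q N U) = (real k + 1) * (2 * real U - real k)" (is ?below)
    and "6 * real (count_on q N U) = (real k + 1) * (real k + 2) * (3 * real U - real k)" (is ?on)
proof -
  have "count_below q N U = (\<Sum>i\<le>k. min N (U - i))"
    unfolding count_below_def using assms(2) by (intro sum.mono_neutral_right) auto
  then show ?below using sum_truncated_diff[of k U N] assms by simp
  have "{i. i \<le> q \<and> i \<le> U \<and> U - i < N} = {..k}" using assms by auto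
  then have "2 * real (count_on q N U) = (\<Sum>i\<le>k. 2 * real (\<Sum>i'\<le>i. min N (U - i')))"
    by (simp only: count_on_def of_nat_sum sum_distrib_left)
  also have "\<dots> = (\<Sum>i\<le>k. (real i + 1) * (2 * real U - real i))"
    using assms by (intro sum.cong sum_truncated_diff) auto
  finally show ?on using sum_sum_diff_real[of "real U" k] by simp
qed

text \<open>With N = M + 1 and U = M + V the first V rows have full length M + 1; the following ones
  have lengths M, M - 1, and so on.\<close>

lemma sum_min_high:
  assumes "V + d \<le> M"
  shows "2 * real (\<Sum>i\<le>V + d. min (M + 1) (M + V - i)) =
    2 * real V * (real M + 1) + (real d + 1) * (2 * real M - real d)"
proof -
  have "{..V + d} = {..<V} \<union> {V..V + d}" by auto
  then have "(\<Sum>i\<le>V + d. min (M + 1) (M + V - i)) =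
      (\<Sum>i<V. min (M + 1) (M + V - i)) + (\<Sum>i=V..V + d. min (M + 1) (M + V - i))"
    by (simp only:) (rule sum.union_disjoint; auto)
  also have "(\<Sum>i<V. min (M + 1) (M + V - i)) = (\<Sum>i<V. M + 1)"
    by (intro sum.cong) auto
  also have "(\<Sum>i=V..V + d. min (M + 1) (M + V - i)) = (\<Sum>t\<le>d. M - t)"
    by (rule sum.reindex_bij_witness[of _ "\<lambda>t. t + V" "\<lambda>i. i - V"]) auto
  finally have eq: "(\<Sum>i\<le>V + d. min (M + 1) (M + V - i)) = V * (M + 1) + (\<Sum>t\<le>d. M - t)"
    by simp
  have "real (\<Sum>t\<le>d. M - t) = (\<Sum>t\<le>d. real M - real t)"
    unfolding of_nat_sum using assms by (intro sum.cong) (auto simp: of_nat_diff)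
  then have "2 * real (\<Sum>t\<le>d. M - t) = (real d + 1) * (2 * real M - real d)"
    by (simp only: sum_diff_real)
  then show ?thesis unfolding eq of_nat_add by (simp add: algebra_simps)
qed

lemma count_high:
  assumes "q \<le> M" "V + d = q"
  shows "2 * real (count_below q (M + 1) (M + V)) =
      2 * real V * (real M + 1) + (real d + 1) * (2 * real M - real d)"
    and "6 * real (count_on q (M + 1) (M + V)) =
      6 * (real d + 1) * real V * (real M + 1) + (real d + 1) * (real d + 2) * (3 * real M - real d)"
proof -
  show "2 * real (count_below q (M + 1) (M + V)) =
      2 * real V * (real M + 1) + (real d + 1) * (2 * real M - real d)"
    using sum_min_high[of V d M] assms by (simp only: count_below_def)
  have "{i. i \<le> q \<and> i \<le> M + V \<and> M + V - i < M + 1} = {V..V + d}" using assms by auto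
  then have "2 * real (count_on q (M + 1) (M + V)) = (\<Sum>i=V..V + d. 2 * real (\<Sum>i'\<le>i. min (M + 1) (M + V - i')))"
    by (simp only: count_on_def of_nat_sum sum_distrib_left)
  also have "\<dots> = (\<Sum>t\<le>d. 2 * real (\<Sum>i'\<le>V + t. min (M + 1) (M + V - i')))"
    by (rule sum.reindex_bij_witness[of _ "\<lambda>t. V + t" "\<lambda>i. i - V"]) auto
  also have "\<dots> = (\<Sum>t\<le>d. 2 * real V * (real M + 1) + (real t + 1) * (2 * real M - real t))"
    using assms by (intro sum.cong sum_min_high) auto
  also have "\<dots> = (real d + 1) * (2 * real V * (real M + 1)) + (\<Sum>t\<le>d. (real t + 1) * (2 * real M - real t))"
    by (simp add: sum.distrib)
  finally show "6 * real (count_on q (M + 1) (M + V)) =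
      6 * (real d + 1) * real V * (real M + 1) + (real d + 1) * (real d + 2) * (3 * real M - real d)"
    using sum_sum_diff_real[of "real M" d] by (simp add: algebra_simps)
qed

lemma sum_antidifference:
  fixes h S :: "real \<Rightarrow> real"
  assumes "\<And>u. c * h u = S (u + 1) - S u"
  shows "c * (\<Sum>U<m. h (real U)) = S (real m) - S 0"
  by (induction m) (simp_all add: distrib_left assms add.commute)

text \<open>The count is a polynomial in \<open>U\<close> on each of the ranges \<open>U < q\<close>, \<open>q \<le> U < M\<close> and \<open>M \<le> U\<close>, where
  \<open>M = q\<^sup>2 - q\<close>; \<open>S1\<close>, \<open>S2\<close> and \<open>S3\<close> are antidifferences, found by Faulhaber summation.\<close>

lemma weighted_count:
  assumes q: "q \<ge> 2" and N: "N = q\<^sup>2 - q + 1"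
  shows "120 * (\<Sum>U<q\<^sup>2. (real q ^ 2 - 1 - real U) * (real (count_below q N U) ^ 2 + 2 * real (count_on q N U)))
    = real q * (real q - 1) *
        (10 * real q ^ 8 + 10 * real q ^ 7 - 25 * real q ^ 6 - 9 * real q ^ 5
         + 71 * real q ^ 4 - 111 * real q ^ 3 - 86 * (real q)\<^sup>2 + 128 * real q - 12)"
    (is "120 * (\<Sum>U<_. ?g U) = ?rhs")
proof -
  define M where "M = q\<^sup>2 - q"
  define r where "r = real q"
  have qq: "2 * q \<le> q\<^sup>2" using q by (simp add: power2_eq_square)
  then have qM: "q \<le> M" by (simp add: M_def)
  have NM: "N = M + 1" by (simp add: N M_def)
  have Mr: "real M = r ^ 2 - r" unfolding M_def r_def using qq by (simp add: of_nat_diff)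
  \<comment> \<open>12 clears the denominators of both closed forms: 12 c^2 is 3 (2 c)^2 and 24 e is
    4 (6 e).\<close>
  have scale: "12 * (w * (c ^ 2 + 2 * e)) = w * (3 * C ^ 2 + 4 * E)"
    if "2 * c = C" "6 * e = E" for w c e C E :: real
    using that by (auto simp: power2_eq_square algebra_simps)
  \<comment> \<open>Here k = min q U equals U; it equals q in \<open>h2\<close>, and
    \<open>h3\<close> uses V = U - M with d = q - V.\<close>
  define h1 where "h1 u =
    (r^2 - 1 - u) * (3 * ((u + 1) * (2 * u - u))^2 + 4 * ((u + 1) * (u + 2) * (3 * u - u)))" for u
  define S1 where "S1 u =
    (- 5 * u^6 + 6 * u^5 * r^2 - 19 * u^5 + 20 * u^4 * r^2 - 30 * u^4 + 30 * u^3 * r^2 + 5 * u^3 - 20 * u^2 * r^2 + 35 * u^2 - 36 * u * r^2 + 14 * u)" for u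
  have S1: "10 * h1 u = S1 (u + 1) - S1 u" for u
    unfolding h1_def S1_def by (simp add: algebra_simps eval_nat_numeral)
  define h2 where "h2 u =
    (r^2 - 1 - u) * (3 * ((r + 1) * (2 * u - r))^2 + 4 * ((r + 1) * (r + 2) * (3 * u - r)))" for u
  define S2 where "S2 u =
    (- 6 * u^4 * r^2 - 12 * u^4 * r - 6 * u^4 + 8 * u^3 * r^4 + 24 * u^3 * r^3 + 20 * u^3 * r^2 - 8 * u^3 * r - 12 * u^3 - 12 * u^2 * r^5 - 27 * u^2 * r^4 - 2 * u^2 * r^3 + 27 * u^2 * r^2 + 20 * u^2 * r + 6 * u^2 + 6 * u * r^6 + 16 * u * r^5 - 5 * u * r^4 - 42 * u * r^3 - 23 * u * r^2 + 16 * u * r + 12 * u)" for u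
  have S2: "2 * h2 u = S2 (u + 1) - S2 u" for u
    unfolding h2_def S2_def by (simp add: algebra_simps eval_nat_numeral)
  define h3 where "h3 u =
    (r - 1 - u) * (3 * (2 * u * ((r^2 - r) + 1) + ((r - u) + 1) * (2 * (r^2 - r) - (r - u)))^2 + 4 * (6 * ((r - u) + 1) * u * ((r^2 - r) + 1) + ((r - u) + 1) * ((r - u) + 2) * (3 * (r^2 - r) - (r - u))))" for u
  define S3 where "S3 u =
    (- 5 * u^6 + 30 * u^5 * r + 37 * u^5 + 30 * u^4 * r^3 - 45 * u^4 * r^2 - 215 * u^4 * r - 10 * u^4 - 120 * u^3 * r^4 - 80 * u^3 * r^3 + 430 * u^3 * r^2 + 100 * u^3 * r - 155 * u^3 - 60 * u^2 * r^6 + 180 * u^2 * r^5 + 285 * u^2 * r^4 - 520 * u^2 * r^3 - 270 * u^2 * r^2 + 495 * u^2 * r + 15 * u^2 + 120 * u * r^7 - 180 * u * r^6 - 270 * u * r^5 + 425 * u * r^4 + 220 * u * r^3 - 465 * u * r^2 - 90 * u * r + 118 * u)" for u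
  have S3: "10 * h3 u = S3 (u + 1) - S3 u" for u
    unfolding h3_def S3_def by (simp add: algebra_simps eval_nat_numeral)
  have low: "12 * ?g U = h1 (real U)" if "U < q" for U
  proof -
    have "U < N" "U = min q U" using that qM NM by auto
    note c = count_low[OF this]
    show ?thesis unfolding scale[OF c] h1_def r_def ..
  qed
  have mid: "12 * ?g U = h2 (real U)" if "q \<le> U" "U < M" for U
  proof -
    have "U < N" "q = min q U" using that NM by auto
    note c = count_low[OF this]
    show ?thesis unfolding scale[OF c] h2_def r_def ..
  qed
  have high: "12 * ?g (M + V) = h3 (real V)" if "V < q" for V
  proof -
    have d: "V + (q - V) = q" "real (q - V) = r - real V" using that by (auto simp: r_def of_nat_diff)
    note c = count_high[OF qM d(1), folded NM, unfolded d(2) Mr]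
    have "real q ^ 2 - 1 - real (M + V) = r - 1 - real V" using Mr by (simp add: r_def)
    then show ?thesis unfolding scale[OF c] h3_def by simp
  qed
  have split: "sum f {..<q\<^sup>2} = sum f {..<q} + sum f {q..<M} + sum f {M..<M + q}" for f :: "nat \<Rightarrow> real"
  proof -
    have "q\<^sup>2 = M + q" using qq by (simp add: M_def)
    then show ?thesis
      using sum.atLeastLessThan_concat[of 0 q M f] sum.atLeastLessThan_concat[of 0 M "M + q" f] qM
      by (simp add: atLeast0LessThan)
  qed
  have "(\<Sum>U<q\<^sup>2. 12 * ?g U) = (\<Sum>U<q. 12 * ?g U) + (\<Sum>U=q..<M. 12 * ?g U) + (\<Sum>U=M..<M + q. 12 * ?g U)"
    by (rule split)
  also have "(\<Sum>U=M..<M + q. 12 * ?g U) = (\<Sum>V<q. 12 * ?g (M + V))"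
    by (rule sum.reindex_bij_witness[of _ "\<lambda>V. M + V" "\<lambda>U. U - M"]) auto
  also have "\<dots> = (\<Sum>V<q. h3 (real V))" by (intro sum.cong high) auto
  also have "(\<Sum>U<q. 12 * ?g U) = (\<Sum>U<q. h1 (real U))" by (intro sum.cong low) auto
  also have "(\<Sum>U=q..<M. 12 * ?g U) = (\<Sum>U=q..<M. h2 (real U))" by (intro sum.cong mid) auto
  also have "\<dots> = (\<Sum>U<M. h2 (real U)) - (\<Sum>U<q. h2 (real U))"
    using sum.atLeastLessThan_concat[of 0 q M "\<lambda>U. h2 (real U)"] qM by (simp add: atLeast0LessThan)
  \<comment> \<open>120 is 12 from \<open>scale\<close> times 10 from the antidifferences;
    \<open>S2\<close> carries only the factor 2, hence the 5.\<close>
  finally have "120 * (\<Sum>U<q\<^sup>2. ?g U) = 10 * (\<Sum>U<q. h1 (real U)) +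
      5 * (2 * (\<Sum>U<M. h2 (real U)) - 2 * (\<Sum>U<q. h2 (real U))) + 10 * (\<Sum>V<q. h3 (real V))"
    by (simp add: sum_distrib_left[symmetric])
  also have "\<dots> = S1 r + 5 * (S2 (r ^ 2 - r) - S2 r) + S3 r"
    unfolding sum_antidifference[of 10 h1, OF S1] sum_antidifference[of 2 h2, OF S2]
      sum_antidifference[of 10 h3, OF S3] Mr r_def[symmetric]
    by (simp add: S1_def S3_def)
  also have "\<dots> = ?rhs"
    unfolding S1_def S2_def S3_def r_def[symmetric] by (simp add: algebra_simps eval_nat_numeral)
  finally show ?thesis .
qed

section \<open>The index set of the gaps\<close>

definition cells :: "nat \<Rightarrow> (int \<times> int) set" where
  "cells q = {0..int q} \<times> {0..(int q)\<^sup>2 - int q}"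

definition weight :: "int \<times> int \<Rightarrow> int" where
  "weight p = fst p + snd p"

definition idx :: "nat \<Rightarrow> int \<times> int \<Rightarrow> int" where
  "idx q p = fst p * ((int q)\<^sup>2 - int q + 1) + snd p"

text \<open>The pair (T, idx p - idx p') is lexicographically below (weight p, 0).\<close>

definition admissible :: "nat \<Rightarrow> int \<Rightarrow> int \<times> int \<Rightarrow> int \<times> int \<Rightarrow> bool" where
  "admissible q T p p' \<longleftrightarrow> T < weight p \<or> T = weight p \<and> idx q p < idx q p'"

definition gap_index :: "nat \<Rightarrow> (int \<times> int \<times> (int \<times> int) \<times> (int \<times> int)) set" where
  "gap_index q = {(A, B, p, p'). 1 \<le> A \<and> 1 \<le> B \<and> p \<in> cells q \<and> p' \<in> cells q \<and>
     admissible q (A + B) p p' \<and> admissible q (A + B) p' p}"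

definition gap_point :: "nat \<Rightarrow> int \<times> int \<times> (int \<times> int) \<times> (int \<times> int) \<Rightarrow> int \<times> int" where
  "gap_point q = (\<lambda>(A, B, p, p'). (A * (int q ^ 3 + 1) - idx q p, B * (int q ^ 3 + 1) - idx q p'))"

lemma cells_iff: "p \<in> cells q \<longleftrightarrow> 0 \<le> fst p \<and> fst p \<le> int q \<and> 0 \<le> snd p \<and> snd p \<le> (int q)\<^sup>2 - int q"
  by (auto simp: cells_def mem_Times_iff)

lemma q_le_square: "int q \<le> (int q)\<^sup>2"
  by (cases q) (auto simp: power2_eq_square)

lemma idx_bounds:
  assumes "p \<in> cells q" shows "0 \<le> idx q p" "idx q p < int q ^ 3 + 1"
proof -
  have N: "0 \<le> (int q)\<^sup>2 - int q + 1" using q_le_square[of q] by simp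
  show "0 \<le> idx q p" using assms N by (simp add: idx_def cells_iff)
  have "fst p * ((int q)\<^sup>2 - int q + 1) \<le> int q * ((int q)\<^sup>2 - int q + 1)"
    using assms N by (intro mult_right_mono) (auto simp: cells_iff)
  moreover have "int q * ((int q)\<^sup>2 - int q + 1) + ((int q)\<^sup>2 - int q) = int q ^ 3"
    by (simp add: algebra_simps power2_eq_square power3_eq_cube)
  ultimately show "idx q p < int q ^ 3 + 1"
    using assms by (simp add: idx_def cells_iff)
qed

lemma idx_less_if_fst_less:
  assumes "p \<in> cells q" "p' \<in> cells q" "fst p < fst p'"
  shows "idx q p < idx q p'"
proof -
  have N: "0 \<le> (int q)\<^sup>2 - int q + 1" using q_le_square[of q] by simp
  have "(fst p + 1) * ((int q)\<^sup>2 - int q + 1) \<le> fst p' * ((int q)\<^sup>2 - int q + 1)"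
    using assms N by (intro mult_right_mono) auto
  then show ?thesis using assms by (simp add: idx_def cells_iff distrib_right)
qed

lemma inj_idx: "inj_on (idx q) (cells q)"
proof (rule inj_onI)
  fix p p' assume p: "p \<in> cells q" "p' \<in> cells q" "idx q p = idx q p'"
  then have "fst p = fst p'"
    using idx_less_if_fst_less[of p q p'] idx_less_if_fst_less[of p' q p]
    by (cases "fst p" "fst p'" rule: linorder_cases) auto
  then show "p = p'" using p by (simp add: idx_def prod_eq_iff)
qed

text \<open>The first coordinates decide unless they agree, and then the weights do. This turns the
  comparison of indices into the condition \<open>i2 \<le> i1\<close> of \<open>G3\<close>.\<close>

lemma idx_less_iff:
  assumes "p \<in> cells q" "p' \<in> cells q" "weight p < weight p'"
  shows "idx q p < idx q p' \<longleftrightarrow> fst p \<le> fst p'"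
proof (cases "fst p" "fst p'" rule: linorder_cases)
  case equal
  then show ?thesis using assms by (simp add: idx_def weight_def)
qed (use idx_less_if_fst_less[of p q p'] idx_less_if_fst_less[of p' q p] assms in auto)

lemma inj_gap_point: "inj_on (gap_point q) (gap_index q)"
proof -
  define n where "n = int q ^ 3 + 1"
  have *: "A = A' \<and> p = p'" if e: "A * n - idx q p = A' * n - idx q p'" and p: "p \<in> cells q" "p' \<in> cells q" for A A' p p'
  proof -
    have "(idx q p' + A * n) div n = A" "(idx q p + A' * n) div n = A'"
      using idx_bounds[OF p(1)] idx_bounds[OF p(2)] by (auto simp: n_def)
    moreover have "idx q p' + A * n = idx q p + A' * n" using e by simp
    ultimately have "A = A'" by simp
    then show ?thesis using e inj_onD[OF inj_idx _ p] by simp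
  qed
  show ?thesis
  proof (rule inj_onI)
    fix a b assume ab: "a \<in> gap_index q" "b \<in> gap_index q" "gap_point q a = gap_point q b"
    obtain A B p p' where a: "a = (A, B, p, p')" by (metis prod.exhaust)
    obtain A' B' s s' where b: "b = (A', B', s, s')" by (metis prod.exhaust)
    have c: "p \<in> cells q" "p' \<in> cells q" "s \<in> cells q" "s' \<in> cells q"
      using ab by (auto simp: gap_index_def a b)
    have "A * n - idx q p = A' * n - idx q s" "B * n - idx q p' = B' * n - idx q s'"
      using ab(3) by (auto simp: gap_point_def a b n_def)
    from *[OF this(1)] *[OF this(2)] c show "a = b" by (simp add: a b)
  qed
qed

text \<open>The largest weight is q^2. If A + B reached it, both conditions would need equality,
  each with its index below the other. This is the bound q^2 - 3 on k = A + B - 2.\<close>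

lemma gap_index_weight:
  assumes "(A, B, p, p') \<in> gap_index q" shows "A + B + 1 \<le> (int q)\<^sup>2"
proof -
  have "weight p \<le> (int q)\<^sup>2" "weight p' \<le> (int q)\<^sup>2"
    using assms by (auto simp: gap_index_def cells_iff weight_def)
  then show ?thesis using assms by (auto simp: gap_index_def admissible_def)
qed

text \<open>Coordinates from the corner of maximal weight turn the conditions \<open>weight p > T\<close> into
  \<open>i + j < U\<close>, where \<open>T = q\<^sup>2 - U\<close>.\<close>

definition corner :: "nat \<Rightarrow> nat \<times> nat \<Rightarrow> int \<times> int" where
  "corner q = (\<lambda>(i, j). (int q - int i, (int q)\<^sup>2 - int q - int j))"

lemma inj_corner: "inj (corner q)"
  by (auto simp: inj_def corner_def)

lemma corner_cells:
  assumes "N = q\<^sup>2 - q + 1"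
  shows "corner q (i, j) \<in> cells q \<longleftrightarrow> i \<le> q \<and> j < N"
    and "weight (corner q (i, j)) = (int q)\<^sup>2 - int i - int j"
proof -
  have "int N = (int q)\<^sup>2 - int q + 1"
    using q_le_square[of q] assms by (simp add: of_nat_diff power2_nat_le_imp_le flip: of_nat_power)
  then show "corner q (i, j) \<in> cells q \<longleftrightarrow> i \<le> q \<and> j < N"
    by (auto simp: corner_def cells_iff)
  show "weight (corner q (i, j)) = (int q)\<^sup>2 - int i - int j"
    by (simp add: corner_def weight_def)
qed

lemma corner_surj:
  assumes "p \<in> cells q" shows "\<exists>i j. p = corner q (i, j)"
  using assms
  by (intro exI[of _ "nat (int q - fst p)"] exI[of _ "nat ((int q)\<^sup>2 - int q - snd p)"])
    (auto simp: corner_def cells_iff prod_eq_iff)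

lemma card_above:
  assumes N: "N = q\<^sup>2 - q + 1"
  shows "card {p \<in> cells q. (int q)\<^sup>2 - int U < weight p} = count_below q N U"
proof -
  define I where "I = (SIGMA i:{..q}. {..<min N (U - i)})"
  have "{p \<in> cells q. (int q)\<^sup>2 - int U < weight p} = corner q ` I"
  proof (intro equalityI subsetI)
    fix p assume p: "p \<in> {p \<in> cells q. (int q)\<^sup>2 - int U < weight p}"
    then obtain i j where "p = corner q (i, j)" using corner_surj by blast
    then show "p \<in> corner q ` I" using p corner_cells[OF N, of i j] by (auto simp: I_def)
  next
    fix p assume "p \<in> corner q ` I"
    then obtain i j where "p = corner q (i, j)" "(i, j) \<in> I" by auto
    then show "p \<in> {p \<in> cells q. (int q)\<^sup>2 - int U < weight p}"
      using corner_cells[OF N, of i j] by (auto simp: I_def)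
  qed
  then have "card {p \<in> cells q. (int q)\<^sup>2 - int U < weight p} = card I"
    by (simp add: card_image inj_on_subset[OF inj_corner])
  also have "\<dots> = count_below q N U" by (simp add: I_def count_below_def)
  finally show ?thesis .
qed

definition boundary_pairs :: "nat \<Rightarrow> int \<Rightarrow> ((int \<times> int) \<times> (int \<times> int)) set" where
  "boundary_pairs q T = {(p, p'). p \<in> cells q \<and> p' \<in> cells q \<and> weight p = T \<and> T < weight p' \<and> idx q p < idx q p'}"

lemma card_boundary_pairs:
  assumes N: "N = q\<^sup>2 - q + 1"
  shows "card (boundary_pairs q ((int q)\<^sup>2 - int U)) = count_on q N U"
proof -
  \<comment> \<open>On the line i + j = U the first point is determined by i, so only i is recorded
    for it.\<close>
  define I where "I = (SIGMA i:{i. i \<le> q \<and> i \<le> U \<and> U - i < N}. SIGMA i':{..i}. {..<min N (U - i')})"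
  define f where "f = (\<lambda>(i, i', j'). (corner q (i, U - i), corner q (i', j')))"
  have inj: "inj_on f I"
    using injD[OF inj_corner[of q]] by (fastforce simp: inj_on_def f_def)
  have "boundary_pairs q ((int q)\<^sup>2 - int U) = f ` I"
  proof (intro equalityI subsetI)
    fix c assume c: "c \<in> boundary_pairs q ((int q)\<^sup>2 - int U)"
    obtain p p' where pp: "c = (p, p')" by (cases c)
    then obtain i j i' j' where ij: "p = corner q (i, j)" "p' = corner q (i', j')"
      using c corner_surj[of p q] corner_surj[of p' q] by (auto simp: boundary_pairs_def)
    have "fst p \<le> fst p'" using c idx_less_iff[of p q p'] by (auto simp: boundary_pairs_def pp)
    then have "i' \<le> i" by (simp add: ij corner_def)
    moreover have "i + j = U" "i' + j' < U" "i \<le> q" "j < N" "j' < N"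
      using c corner_cells[OF N, of i j] corner_cells[OF N, of i' j']
      by (auto simp: boundary_pairs_def pp ij)
    ultimately have "(i, i', j') \<in> I" "c = f (i, i', j')" by (auto simp: I_def f_def pp ij)
    then show "c \<in> f ` I" by blast
  next
    fix c assume "c \<in> f ` I"
    then obtain i i' j' where I: "(i, i', j') \<in> I" and c: "c = (corner q (i, U - i), corner q (i', j'))"
      by (auto simp: f_def)
    have cells: "corner q (i, U - i) \<in> cells q" "corner q (i', j') \<in> cells q"
      using I corner_cells(1)[OF N] by (auto simp: I_def)
    moreover have w: "weight (corner q (i, U - i)) = (int q)\<^sup>2 - int U" "(int q)\<^sup>2 - int U < weight (corner q (i', j'))"
      using I corner_cells(2)[OF N] by (auto simp: I_def of_nat_diff)
    moreover have "idx q (corner q (i, U - i)) < idx q (corner q (i', j'))"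
      using idx_less_iff[OF cells] w I by (auto simp: I_def corner_def)
    ultimately show "c \<in> boundary_pairs q ((int q)\<^sup>2 - int U)" by (simp add: boundary_pairs_def c)
  qed
  then have "card (boundary_pairs q ((int q)\<^sup>2 - int U)) = card I"
    by (simp add: card_image[OF inj])
  also have "\<dots> = count_on q N U" by (simp add: I_def count_on_def)
  finally show ?thesis .
qed

definition admissible_pairs :: "nat \<Rightarrow> int \<Rightarrow> ((int \<times> int) \<times> (int \<times> int)) set" where
  "admissible_pairs q T = {(p, p'). p \<in> cells q \<and> p' \<in> cells q \<and> admissible q T p p' \<and> admissible q T p' p}"

lemma finite_cells: "finite (cells q)"
  by (simp add: cells_def)

text \<open>Either both weights exceed T, or exactly one equals T, in two symmetric ways. Both
  cannot equal T, since each index would be below the other.\<close>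

lemma card_admissible_pairs:
  assumes N: "N = q\<^sup>2 - q + 1"
  shows "card (admissible_pairs q ((int q)\<^sup>2 - int U)) = count_below q N U ^ 2 + 2 * count_on q N U"
proof -
  define T where "T = (int q)\<^sup>2 - int U"
  define C where "C = {p \<in> cells q. T < weight p}"
  define E where "E = boundary_pairs q T"
  have fin: "finite C" "finite E"
    using finite_cells[of q] by (auto simp: C_def E_def boundary_pairs_def intro: rev_finite_subset[of "cells q \<times> cells q"])
  have "admissible_pairs q T = C \<times> C \<union> (E \<union> prod.swap ` E)"
    by (force simp: admissible_pairs_def admissible_def C_def E_def boundary_pairs_def image_iff)
  moreover have "C \<times> C \<inter> (E \<union> prod.swap ` E) = {}" "E \<inter> prod.swap ` E = {}"
    by (auto simp: C_def E_def boundary_pairs_def)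
  ultimately have "card (admissible_pairs q T) = card C * card C + (card E + card (prod.swap ` E))"
    using fin by (simp add: card_Un_disjoint card_cartesian_product)
  also have "card (prod.swap ` E) = card E" by (intro card_image) (auto simp: inj_on_def)
  finally show ?thesis
    using card_above[OF N, of U] card_boundary_pairs[OF N, of U]
    by (simp add: T_def C_def E_def power2_eq_square)
qed

text \<open>U fixes the sum A + B = q^2 - U, which splits into two positive parts in q^2 - U - 1
  ways.\<close>

lemma card_gap_index:
  assumes N: "N = q\<^sup>2 - q + 1"
  shows "card (gap_index q) = (\<Sum>U<q\<^sup>2. (q\<^sup>2 - U - 1) * (count_below q N U ^ 2 + 2 * count_on q N U))"
proof -
  define I where "I = (SIGMA U:{..<q\<^sup>2}. {1..q\<^sup>2 - U - 1} \<times> admissible_pairs q ((int q)\<^sup>2 - int U))"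
  define g where "g = (\<lambda>(U :: nat, A :: nat, p :: int \<times> int, p' :: int \<times> int). (int A, (int q)\<^sup>2 - int U - int A, p, p'))"
  have inj: "inj_on g I" by (auto simp: inj_on_def g_def)
  have "gap_index q = g ` I"
  proof (intro equalityI subsetI)
    fix c assume c: "c \<in> gap_index q"
    obtain A B p p' where c': "c = (A, B, p, p')" by (metis prod.exhaust)
    have w: "A + B + 1 \<le> (int q)\<^sup>2" "1 \<le> A" "1 \<le> B"
      using gap_index_weight[of A B p p' q] c by (auto simp: c' gap_index_def)
    define U where "U = nat ((int q)\<^sup>2 - (A + B))"
    have U: "int U = (int q)\<^sup>2 - (A + B)" using w by (simp add: U_def)
    have "U < q\<^sup>2"
    proof -
      have "int U < int (q\<^sup>2)" using U w by simp
      then show ?thesis by (simp only: of_nat_less_iff)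
    qed
    moreover have "nat A \<le> q\<^sup>2 - U - 1"
    proof -
      have "int (nat A) + int U + 1 \<le> int (q\<^sup>2)" using U w by simp
      then show ?thesis by linarith
    qed
    moreover have "(p, p') \<in> admissible_pairs q ((int q)\<^sup>2 - int U)"
      using c by (auto simp: admissible_pairs_def U c' gap_index_def)
    ultimately have "(U, nat A, p, p') \<in> I" using w by (auto simp: I_def)
    moreover have "c = g (U, nat A, p, p')" using w U by (simp add: g_def c')
    ultimately show "c \<in> g ` I" by blast
  next
    fix c assume "c \<in> g ` I"
    then obtain U A p p' where I: "(U, A, p, p') \<in> I" and c: "c = (int A, (int q)\<^sup>2 - int U - int A, p, p')"
      by (auto simp: g_def)
    have "U < q\<^sup>2" "1 \<le> A" "A \<le> q\<^sup>2 - U - 1" using I by (auto simp: I_def)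
    then have "int A + int U + 1 \<le> int (q\<^sup>2)" by linarith
    then show "c \<in> gap_index q"
      using I by (auto simp: c gap_index_def I_def admissible_pairs_def)
  qed
  then have "card (gap_index q) = card I" by (simp add: card_image[OF inj])
  also have "\<dots> = (\<Sum>U<q\<^sup>2. (q\<^sup>2 - U - 1) * card (admissible_pairs q ((int q)\<^sup>2 - int U)))"
  proof -
    have "finite (admissible_pairs q T)" for T
      using finite_cells[of q] by (auto simp: admissible_pairs_def intro: rev_finite_subset[of "cells q \<times> cells q"])
    then show ?thesis by (simp add: I_def card_cartesian_product)
  qed
  finally show ?thesis by (simp add: card_admissible_pairs[OF N])
qed

lemma real_card_gap_index:
  assumes q: "q \<ge> 2"
  shows "real (card (gap_index q)) = real q * (real q - 1) *
       (10 * real q ^ 8 + 10 * real q ^ 7 - 25 * real q ^ 6 - 9 * real q ^ 5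
        + 71 * real q ^ 4 - 111 * real q ^ 3 - 86 * (real q)\<^sup>2 + 128 * real q - 12) / 120"
proof -
  have "real (card (gap_index q)) = (\<Sum>U<q\<^sup>2. (real q ^ 2 - 1 - real U) *
      (real (count_below q (q\<^sup>2 - q + 1) U) ^ 2 + 2 * real (count_on q (q\<^sup>2 - q + 1) U)))"
    unfolding card_gap_index[OF refl] of_nat_sum
  proof (intro sum.cong refl)
    fix U assume "U \<in> {..<q\<^sup>2}"
    then have "real (q\<^sup>2 - U - 1) = real q ^ 2 - 1 - real U" by (simp add: of_nat_diff)
    then show "real ((q\<^sup>2 - U - 1) * (count_below q (q\<^sup>2 - q + 1) U ^ 2 + 2 * count_on q (q\<^sup>2 - q + 1) U)) =
      (real q ^ 2 - 1 - real U) *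
      (real (count_below q (q\<^sup>2 - q + 1) U) ^ 2 + 2 * real (count_on q (q\<^sup>2 - q + 1) U))"
      by simp
  qed
  then show ?thesis using weighted_count[OF q refl] by simp
qed

section \<open>Matching with the sets of the theorem\<close>

lemma gamma_eq:
  "gamma (int q) (fst p') (snd p') 1 (fst p) (snd p) (k + 1) =
     ((k + 1) * (int q ^ 3 + 1) - idx q p, int q ^ 3 + 1 - idx q p')"
  by (simp add: gamma_def idx_def algebra_simps power2_eq_square power3_eq_cube)

text \<open>k_s + 2 is the weight of a cell with first coordinate i_s, and the bounds on i_s say
  that the cell lies in the rectangle.\<close>

lemma G1_eq:
  "G1 (int q) k = {((k + 1) * (int q ^ 3 + 1) - idx q p, int q ^ 3 + 1 - idx q p') | p p'.
     p \<in> cells q \<and> p' \<in> cells q \<and> k + 2 < weight p \<and> k + 2 < weight p'}"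
proof (intro equalityI subsetI)
  fix v assume "v \<in> G1 (int q) k"
  then obtain i1 i2 k1 k2 where *: "v = gamma (int q) i1 (k1 - i1 + 2) 1 i2 (k2 - i2 + 2) (k + 1)"
     "max 0 (k1 - (int q)\<^sup>2 + int q + 2) \<le> i1" "i1 \<le> min (int q) (k1 + 2)" "k < k1" "k1 \<le> (int q)\<^sup>2 - 2"
     "max 0 (k2 - (int q)\<^sup>2 + int q + 2) \<le> i2" "i2 \<le> min (int q) (k2 + 2)" "k < k2" "k2 \<le> (int q)\<^sup>2 - 2"
    unfolding G1_def by blast
  define p p' where "p = (i2, k2 - i2 + 2)" and "p' = (i1, k1 - i1 + 2)"
  have "v = ((k + 1) * (int q ^ 3 + 1) - idx q p, int q ^ 3 + 1 - idx q p')"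
    using gamma_eq[of q p' p k] *(1) by (simp add: p_def p'_def)
  moreover have "p \<in> cells q" "p' \<in> cells q" "k + 2 < weight p" "k + 2 < weight p'"
    using * by (auto simp: p_def p'_def cells_iff weight_def)
  ultimately show "v \<in> {((k + 1) * (int q ^ 3 + 1) - idx q p, int q ^ 3 + 1 - idx q p') | p p'.
     p \<in> cells q \<and> p' \<in> cells q \<and> k + 2 < weight p \<and> k + 2 < weight p'}" by blast
next
  fix v assume "v \<in> {((k + 1) * (int q ^ 3 + 1) - idx q p, int q ^ 3 + 1 - idx q p') | p p'.
     p \<in> cells q \<and> p' \<in> cells q \<and> k + 2 < weight p \<and> k + 2 < weight p'}"
  then obtain p p' where *: "v = ((k + 1) * (int q ^ 3 + 1) - idx q p, int q ^ 3 + 1 - idx q p')"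
    "p \<in> cells q" "p' \<in> cells q" "k + 2 < weight p" "k + 2 < weight p'" by blast
  then show "v \<in> G1 (int q) k"
    unfolding G1_def *(1) gamma_eq[of q p' p k, symmetric]
    by (intro CollectI exI[of _ "fst p'"] exI[of _ "fst p"] exI[of _ "weight p' - 2"] exI[of _ "weight p - 2"])
      (auto simp: cells_iff weight_def)
qed

text \<open>The cell with first coordinate \<open>i2\<close> now has weight exactly k + 2, and
  \<open>i2 \<le> i1\<close> compares indices by \<open>idx_less_iff\<close>.\<close>

lemma G3_eq:
  assumes k: "k + 2 \<ge> 0"
  shows "G3 (int q) k = {((k + 1) * (int q ^ 3 + 1) - idx q p, int q ^ 3 + 1 - idx q p') | p p'.
     (p, p') \<in> boundary_pairs q (k + 2)}"
proof (intro equalityI subsetI)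
  fix v assume "v \<in> G3 (int q) k"
  then obtain i1 i2 k1 where *: "v = gamma (int q) i1 (k1 - i1 + 2) 1 i2 (k - i2 + 2) (k + 1)"
     "max 0 (k1 - (int q)\<^sup>2 + int q + 2) \<le> i1" "i1 \<le> min (int q) (k1 + 2)" "k < k1" "k1 \<le> (int q)\<^sup>2 - 2"
     "max 0 (k - (int q)\<^sup>2 + int q + 2) \<le> i2" "i2 \<le> min (int q) (k + 2)" "i2 \<le> i1"
    unfolding G3_def by blast
  define p p' where "p = (i2, k - i2 + 2)" and "p' = (i1, k1 - i1 + 2)"
  have v: "v = ((k + 1) * (int q ^ 3 + 1) - idx q p, int q ^ 3 + 1 - idx q p')"
    using gamma_eq[of q p' p k] *(1) by (simp add: p_def p'_def)
  have cells: "p \<in> cells q" "p' \<in> cells q" and w: "k + 2 = weight p" "k + 2 < weight p'"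
    using * by (auto simp: p_def p'_def cells_iff weight_def)
  have "idx q p < idx q p'"
    using idx_less_iff[OF cells] w * by (simp add: p_def p'_def)
  then have "(p, p') \<in> boundary_pairs q (k + 2)"
    using cells w by (simp add: boundary_pairs_def)
  with v show "v \<in> {((k + 1) * (int q ^ 3 + 1) - idx q p, int q ^ 3 + 1 - idx q p') | p p'.
     (p, p') \<in> boundary_pairs q (k + 2)}" by blast
next
  fix v assume "v \<in> {((k + 1) * (int q ^ 3 + 1) - idx q p, int q ^ 3 + 1 - idx q p') | p p'.
     (p, p') \<in> boundary_pairs q (k + 2)}"
  then obtain p p' where *: "v = ((k + 1) * (int q ^ 3 + 1) - idx q p, int q ^ 3 + 1 - idx q p')"
    "p \<in> cells q" "p' \<in> cells q" "k + 2 = weight p" "k + 2 < weight p'" "idx q p < idx q p'"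
    by (auto simp: boundary_pairs_def)
  have "fst p \<le> fst p'" using idx_less_iff[OF *(2,3)] * by simp
  moreover have "snd p = k - fst p + 2" using *(4) by (simp add: weight_def)
  moreover have "snd p' = (weight p' - 2) - fst p' + 2" by (simp add: weight_def)
  ultimately show "v \<in> G3 (int q) k"
    unfolding G3_def *(1) gamma_eq[of q p' p k, symmetric] using *(2-5)
    by (intro CollectI exI[of _ "fst p'"] exI[of _ "fst p"] exI[of _ "weight p' - 2"])
      (auto simp: cells_iff weight_def)
qed

lemma admissible_if_boundary:
  "(p, p') \<in> boundary_pairs q T \<Longrightarrow>
     p \<in> cells q \<and> p' \<in> cells q \<and> admissible q T p p' \<and> admissible q T p' p"
  by (auto simp: boundary_pairs_def admissible_def)

text \<open>A pair (A, B) corresponds to k = A + B - 2 and j = B - 1, since translation by w_j moves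
  j (q^3 + 1) from the first coordinate to the second. \<open>G1\<close> covers two weights above A
  + B, \<open>G3\<close> and \<open>G4\<close> one weight equal to it.\<close>

lemma union_eq_gap_points:
  "(\<Union>k\<in>{0..(int q)\<^sup>2 - 3}. \<Union>j\<in>{0..k}. (\<lambda>v. v + w (int q) j) ` (G1 (int q) k \<union> G3 (int q) k \<union> G4 (int q) k))
    = gap_point q ` gap_index q" (is "?L = ?R")
proof (intro equalityI subsetI)
  define n where "n = int q ^ 3 + 1"
  fix u assume "u \<in> ?L"
  then obtain k j where kj: "k \<in> {0..(int q)\<^sup>2 - 3}" "j \<in> {0..k}"
    and "u \<in> (\<lambda>v. v + w (int q) j) ` (G1 (int q) k \<union> G3 (int q) k \<union> G4 (int q) k)"
    by (elim UN_E)
  then obtain v where v: "v \<in> G1 (int q) k \<union> G3 (int q) k \<union> G4 (int q) k" and u: "u = v + w (int q) j"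
    by (elim imageE)
  have k: "0 \<le> k" "k \<le> (int q)\<^sup>2 - 3" "0 \<le> j" "j \<le> k" using kj by auto
  have "\<exists>p p'. v = ((k + 1) * n - idx q p, n - idx q p') \<and> p \<in> cells q \<and> p' \<in> cells q \<and>
      admissible q (k + 2) p p' \<and> admissible q (k + 2) p' p"
    using v
  proof (elim UnE)
    assume "v \<in> G1 (int q) k"
    then show ?thesis unfolding G1_eq n_def admissible_def by blast
  next
    assume "v \<in> G3 (int q) k"
    moreover have "k + 2 \<ge> 0" using k by simp
    ultimately obtain p p' where "v = ((k + 1) * n - idx q p, n - idx q p')" "(p, p') \<in> boundary_pairs q (k + 2)"
      unfolding n_def by (subst (asm) G3_eq) blast+
    then show ?thesis using admissible_if_boundary by blast
  next
    assume "v \<in> G4 (int q) k"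
    then obtain a b where "(a, b) \<in> G3 (int q) k" and vab: "v = (b, a) - w (int q) k"
      unfolding G4_def by blast
    moreover have "k + 2 \<ge> 0" using k by simp
    ultimately obtain p p' where "(a, b) = ((k + 1) * n - idx q p, n - idx q p')" and p: "(p, p') \<in> boundary_pairs q (k + 2)"
      unfolding n_def by (subst (asm) G3_eq) blast+
    \<comment> \<open>Subtracting w_k after the swap restores the factor k + 1 in the first
      coordinate, with the two cells exchanged.\<close>
    then have "v = ((k + 1) * n - idx q p', n - idx q p)"
      using vab by (simp add: w_def n_def algebra_simps)
    then show ?thesis using admissible_if_boundary[OF p] by blast
  qed
  then obtain p p' where p: "v = ((k + 1) * n - idx q p, n - idx q p')" "p \<in> cells q" "p' \<in> cells q"
      "admissible q (k + 2) p p'" "admissible q (k + 2) p' p" by blast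
  then have "(k + 1 - j, j + 1, p, p') \<in> gap_index q"
    using k by (simp add: gap_index_def)
  moreover have "u = gap_point q (k + 1 - j, j + 1, p, p')"
    by (simp add: u p(1) gap_point_def w_def n_def algebra_simps)
  ultimately show "u \<in> ?R" by blast
next
  define n where "n = int q ^ 3 + 1"
  fix u assume "u \<in> ?R"
  then obtain A B p p' where g: "(A, B, p, p') \<in> gap_index q" and u: "u = gap_point q (A, B, p, p')"
    by (metis (no_types, lifting) imageE prod.exhaust)
  define k j where "k = A + B - 2" and "j = B - 1"
  have k: "0 \<le> k" "k \<le> (int q)\<^sup>2 - 3" "0 \<le> j" "j \<le> k"
    using gap_index_weight[OF g] g by (auto simp: k_def j_def gap_index_def)
  define v where "v = ((k + 1) * n - idx q p, n - idx q p')"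
  have uv: "u = v + w (int q) j"
    by (simp add: u v_def gap_point_def w_def n_def k_def j_def algebra_simps)
  have cells: "p \<in> cells q" "p' \<in> cells q" and adm: "admissible q (k + 2) p p'" "admissible q (k + 2) p' p"
    using g by (auto simp: gap_index_def k_def)
  consider "k + 2 < weight p" "k + 2 < weight p'" | "(p, p') \<in> boundary_pairs q (k + 2)" | "(p', p) \<in> boundary_pairs q (k + 2)"
    using adm cells unfolding admissible_def boundary_pairs_def by fastforce
  then have "v \<in> G1 (int q) k \<union> G3 (int q) k \<union> G4 (int q) k"
  proof cases
    case 1
    then show ?thesis using cells unfolding G1_eq v_def n_def by blast
  next
    case 2
    moreover have "k + 2 \<ge> 0" using k by simp
    ultimately have "v \<in> G3 (int q) k" unfolding v_def n_def by (subst G3_eq) blast+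
    then show ?thesis by blast
  next
    case 3
    moreover have "k + 2 \<ge> 0" using k by simp
    ultimately have "((k + 1) * n - idx q p', n - idx q p) \<in> G3 (int q) k"
      unfolding n_def by (subst G3_eq) blast+
    \<comment> \<open>\<open>G4\<close> asks for positive coordinates; they are positive because
      every index is less than n.\<close>
    moreover have "0 < n - idx q p" "0 < n - idx q p'" "0 \<le> k * n"
      using idx_bounds[OF cells(1)] idx_bounds[OF cells(2)] k by (auto simp: n_def)
    moreover from this have "0 < (k + 1) * n - idx q p'" by (simp add: distrib_right)
    moreover have "v = (n - idx q p, (k + 1) * n - idx q p') - w (int q) k"
      by (simp add: v_def w_def n_def algebra_simps)
    ultimately show ?thesis unfolding G4_def by blast
  qed
  then have "u \<in> (\<lambda>v. v + w (int q) j) ` (G1 (int q) k \<union> G3 (int q) k \<union> G4 (int q) k)"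
    unfolding uv by (rule imageI)
  moreover have "k \<in> {0..(int q)\<^sup>2 - 3}" "j \<in> {0..k}" using k by auto
  ultimately show "u \<in> ?L" by (intro UN_I)
qed

section \<open>The pure gaps\<close>

text \<open>m - m' lies strictly between - n and n, so any difference between s and t outweighs it.
  The lexicographic order of the gaps comes from here.\<close>

lemma scaled_less_iff:
  fixes n s t m m' :: int
  assumes "0 \<le> m" "m < n" "0 \<le> m'" "m' < n"
  shows "s * n + m - m' < t * n \<longleftrightarrow> s < t \<or> s = t \<and> m < m'"
proof (cases s t rule: linorder_cases)
  case less
  then have "(s + 1) * n \<le> t * n" using assms by (intro mult_right_mono) auto
  then show ?thesis using assms less by (simp add: distrib_right)
next
  case greater
  then have "(t + 1) * n \<le> s * n" using assms by (intro mult_right_mono) auto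
  then show ?thesis using assms greater by (simp add: distrib_right)
qed simp

context gk_setting
begin

definition cell :: "nat \<Rightarrow> int \<times> int" where
  "cell m = (int (m div N), int (m mod N))"

lemma int_N: "int N = (int q)\<^sup>2 - int q + 1" and int_n: "int n = int q ^ 3 + 1"
  using q_le_q2 by (auto simp: N_def n_def of_nat_diff)

lemma cell:
  assumes "m < n"
  shows "cell m \<in> cells q" "idx q (cell m) = int m" "weight (cell m) = int (m div N + m mod N)"
proof -
  have "m div N < q + 1" using assms N_pos by (simp add: less_mult_imp_div_less n_eq)
  moreover have "m mod N < N" using N_pos by simp
  ultimately show "cell m \<in> cells q"
    unfolding cells_iff cell_def using int_N by auto
  show "idx q (cell m) = int m"
    unfolding idx_def cell_def int_N[symmetric] fst_conv snd_conv by (simp flip: of_nat_mult of_nat_add)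
  show "weight (cell m) = int (m div N + m mod N)"
    by (simp add: weight_def cell_def)
qed

lemma cells_cell:
  assumes "p \<in> cells q" shows "cell (nat (idx q p)) = p" "nat (idx q p) < n"
proof -
  show "nat (idx q p) < n" using idx_bounds[OF assms] int_n by linarith
  then have "idx q (cell (nat (idx q p))) = idx q p"
    using cell(2) idx_bounds[OF assms] by simp
  then show "cell (nat (idx q p)) = p"
    using inj_onD[OF inj_idx] cell(1)[OF \<open>nat (idx q p) < n\<close>] assms by blast
qed

lemma pole0_eq: "pole0 (- A, m) = A * int n - int m"
  by (simp add: pole0_def)

lemma pole_inf_eq: "m < n \<Longrightarrow> pole_inf (k, m) = (k + weight (cell m)) * int n - int m"
  by (simp add: pole_inf_def cell(3))

lemma admissible_iff:
  assumes "m < n" "m' < n"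
  shows "admissible q T (cell m) (cell m') \<longleftrightarrow> T * int n + int m - int m' < weight (cell m) * int n"
  using scaled_less_iff[of "int m" "int n" "int m'" T "weight (cell m)"] assms
  by (simp add: admissible_def cell(2))

lemma representation: "\<exists>A. \<exists>m<n. (a :: int) = A * int n - int m"
proof -
  have n: "int n > 0" using n_pos by simp
  define d r where "d = (- a) div int n" and "r = (- a) mod int n"
  have "- a = d * int n + r" unfolding d_def r_def by (rule div_mult_mod_eq[symmetric])
  moreover have "0 \<le> r" "r < int n" using n by (auto simp: r_def)
  ultimately show ?thesis by (intro exI[of _ "- d"] exI[of _ "nat r"]) (auto simp: nat_less_iff)
qed

text \<open>If \<open>A = 0\<close>, the first cell is the origin, whose weight \<open>0\<close> is not admissible.\<close>

lemma admissible_pos: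
  assumes m: "m < n" "m' < n" and nonneg: "0 \<le> A * int n - int m" "0 \<le> B * int n - int m'"
    and adm: "admissible q (A + B) (cell m) (cell m')"
  shows "1 \<le> A"
proof (rule ccontr)
  assume "\<not> 1 \<le> A"
  have pos: "0 \<le> C" if "0 \<le> C * int n - int l" for C l
  proof (rule ccontr)
    assume "\<not> 0 \<le> C"
    then have "C * int n < 0" using n_pos by (simp add: mult_less_0_iff)
    then show False using that by simp
  qed
  have "A = 0" "0 \<le> B" using pos[OF nonneg(1)] pos[OF nonneg(2)] \<open>\<not> 1 \<le> A\<close> by auto
  then have "m = 0" using nonneg by simp
  then have "weight (cell m) = 0" by (simp add: cell_def weight_def)
  then have "B = 0" "int m < int m'"
    using adm \<open>A = 0\<close> \<open>0 \<le> B\<close> m by (auto simp: admissible_def cell(2))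
  then show False using nonneg by simp
qed

text \<open>Either pole order determines the monomial. The one of order A n - m at \<open>P0\<close>
  is (- A, m), and its order (weight - A) n - m at \<open>Pinf\<close> exceeds B n - m' exactly
  under admissibility; the other condition is symmetric.\<close>

lemma pure_gaps_eq: "pure_gaps P0 Pinf = gap_point q ` gap_index q"
proof (intro equalityI subsetI)
  fix v assume v: "v \<in> pure_gaps P0 Pinf"
  obtain a b where ab: "v = (a, b)" by (cases v)
  obtain A m where a: "m < n" "a = A * int n - int m" using representation by blast
  obtain B m' where b: "m' < n" "b = B * int n - int m'" using representation by blast
  have nonneg: "0 \<le> a" "0 \<le> b" and
    gap: "\<And>i. i \<in> exponents \<Longrightarrow> pole0 i = a \<Longrightarrow> b < pole_inf i" "\<And>i. i \<in> exponents \<Longrightarrow> pole_inf i = b \<Longrightarrow> a < pole0 i"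
    using v unfolding ab pure_gaps_iff by blast+
  have "b < pole_inf (- A, m)" using a by (intro gap) (auto simp: exponents_def pole0_eq)
  then have adm1: "admissible q (A + B) (cell m) (cell m')"
    unfolding admissible_iff[OF a(1) b(1)] pole_inf_eq[OF a(1)] b(2) by (simp add: algebra_simps)
  \<comment> \<open>The power of x for which the monomial with index m' has pole order b at
    infinity.\<close>
  define k where "k = B - weight (cell m')"
  have "a < pole0 (k, m')" using b by (intro gap) (auto simp: exponents_def pole_inf_eq k_def)
  then have adm2: "admissible q (A + B) (cell m') (cell m)"
    unfolding admissible_iff[OF b(1) a(1)] pole0_def k_def a(2) by (simp add: algebra_simps)
  have "1 \<le> A" using admissible_pos[OF a(1) b(1) _ _ adm1] nonneg a b by simp
  moreover have "1 \<le> B" using admissible_pos[OF b(1) a(1), of B A] nonneg a b adm2 by (simp add: add.commute)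
  ultimately have "(A, B, cell m, cell m') \<in> gap_index q"
    using cell(1) a b adm1 adm2 by (simp add: gap_index_def)
  moreover have "v = gap_point q (A, B, cell m, cell m')"
    using cell(2) a b int_n by (simp add: gap_point_def ab)
  ultimately show "v \<in> gap_point q ` gap_index q" by blast
next
  fix v assume "v \<in> gap_point q ` gap_index q"
  then obtain A B p p' where g: "(A, B, p, p') \<in> gap_index q" and v: "v = gap_point q (A, B, p, p')"
    by (metis (no_types, lifting) imageE prod.exhaust)
  define m m' where "m = nat (idx q p)" and "m' = nat (idx q p')"
  have cells: "p \<in> cells q" "p' \<in> cells q" using g by (auto simp: gap_index_def)
  have m: "m < n" "cell m = p" and m': "m' < n" "cell m' = p'"
    unfolding m_def m'_def using cells_cell cells by auto
  have AB: "1 \<le> A" "1 \<le> B" and adm: "admissible q (A + B) (cell m) (cell m')" "admissible q (A + B) (cell m') (cell m)"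
    using g m m' by (auto simp: gap_index_def)
  define a b where "a = A * int n - int m" and "b = B * int n - int m'"
  have vab: "v = (a, b)"
    using cell(2)[OF m(1)] cell(2)[OF m'(1)] m m' int_n by (simp add: v gap_point_def a_def b_def)
  have "1 * int n \<le> A * int n" "1 * int n \<le> B * int n" using AB by (intro mult_right_mono; simp)+
  then have nonneg: "0 \<le> a" "0 \<le> b" unfolding a_def b_def using m(1) m'(1) by linarith+
  have "b < pole_inf i" if i: "i \<in> exponents" "pole0 i = a" for i
  proof -
    have "i = (- A, m)"
      by (rule inj_onD[OF inj_pole0 _ i(1)]) (use i m in \<open>auto simp: pole0_eq a_def exponents_def\<close>)
    then show ?thesis
      using adm(1) unfolding admissible_iff[OF m(1) m'(1)] by (simp add: pole_inf_eq[OF m(1)] b_def algebra_simps)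
  qed
  moreover have "a < pole0 i" if i: "i \<in> exponents" "pole_inf i = b" for i
  proof -
    have "i = (B - weight (cell m'), m')"
      by (rule inj_onD[OF inj_pole_inf _ i(1)]) (use i m' in \<open>auto simp: pole_inf_eq b_def exponents_def\<close>)
    then show ?thesis
      using adm(2) unfolding admissible_iff[OF m'(1) m(1)] by (simp add: pole0_def a_def algebra_simps)
  qed
  ultimately show "v \<in> pure_gaps P0 Pinf" unfolding vab pure_gaps_iff using nonneg by blast
qed

end

text \<open>Translation by 1 permutes the field, so the sum of all elements equals itself plus the
  cardinality.\<close>

lemma of_nat_card_eq_0: "of_nat (card (UNIV :: 'a::{field,finite} set)) = (0 :: 'a)"
proof -
  have "(\<Sum>x\<in>UNIV. x) = (\<Sum>x\<in>UNIV. x + (1 :: 'a))"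
    by (rule sum.reindex_bij_witness[of _ "\<lambda>x. x + 1" "\<lambda>x. x - 1"]) auto
  then show ?thesis by (simp add: sum.distrib)
qed

theorem theorem4p7:
  fixes q :: nat
    and emb :: "'a::{field,finite} alg_closure \<Rightarrow> 'f::field"
    and x y z :: 'f
    and P0 Pinf :: "'f set"
  assumes "\<exists>p n. prime p \<and> n > 0 \<and> q = p ^ n"
    and "card (UNIV :: 'a set) = q ^ 6"
    and "gk_function_field emb q x y z"
    and "gk_function_field.is_P0 emb x y z P0"
    and "gk_function_field.is_Pinf emb x y z Pinf"
  shows "field_ext.pure_gaps emb P0 Pinf =
           (\<Union>k\<in>{0..(int q)\<^sup>2 - 3}. \<Union>j\<in>{0..k}.
              (\<lambda>v. v + w (int q) j) ` (G1 (int q) k \<union> G3 (int q) k \<union> G4 (int q) k))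
       \<and> real (card (field_ext.pure_gaps emb P0 Pinf)) =
           real q * (real q - 1) *
             (10 * real q ^ 8 + 10 * real q ^ 7 - 25 * real q ^ 6 - 9 * real q ^ 5
              + 71 * real q ^ 4 - 111 * real q ^ 3 - 86 * (real q)\<^sup>2 + 128 * real q - 12) / 120"
proof -
  have q2: "q \<ge> 2"
  proof -
    obtain p m where p: "prime p" "m > 0" "q = p ^ m" using assms(1) by blast
    have "p ^ 1 \<le> p ^ m" using p prime_gt_0_nat[of p] by (intro power_increasing) auto
    then show ?thesis using p prime_ge_2_nat[of p] by simp
  qed
  \<comment> \<open>The field has q^6 elements, so q^6 and hence q vanish in it, and
    \<open>to_ac\<close> carries this to the closure.\<close>
  have "of_nat q ^ 6 = (0 :: 'a)"
    using of_nat_card_eq_0[where 'a = 'a] unfolding assms(2) by simp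
  then have q0: "of_nat q = (0 :: 'a)" by simp
  have "to_ac (of_nat i :: 'a) = of_nat i" for i by (induction i) auto
  then have char: "of_nat q = (0 :: 'a alg_closure)" using q0 by (metis to_ac_0)
  interpret gk_function_field emb q x y z by fact
  interpret gk_setting emb q x y z P0 Pinf
    using q2 char assms(4,5) by unfold_locales
  show ?thesis
    unfolding pure_gaps_eq union_eq_gap_points card_image[OF inj_gap_point]
    using real_card_gap_index[OF q2] by blast
qed

end
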